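(* The loop-erased random walks on the finite pre-Sierpiński gaskets, with laws $\tilde P_N$, $N\in\mathbb Z_+$, extend to a loop-erased random walk on the infinite pre-Sierpiński gasket $F_0$. Precisely: there exists a probability measure $P$ on $(\Omega,\mathcal B)$ such that $P\circ\pi_N^{-1}=\tilde P_N$ for every $N\in\mathbb Z_+$. Consequently, under $P$, the process $X=(X(i))_{i\ge 0}$ defined by $X(\omega)(i)=\omega_N(i)$ for $i\le 2^N$ (well defined, independently of the choice of $N$ with $2^N\ge i$) is an infinite loopless nearest-neighbour random path on $F_0$ starting at $O$.
   Context: **Graph.** $\mathbb N=\{1,2,\dots\}$, $\mathbb Z_+=\{0,1,2,\dots\}$. Let $O=(0,0)$, $a_0=(\frac12,\frac{\sqrt3}2)$, $b_0=(1,0)$, $a_N=2^Na_0$, $b_N=2^Nb_0$. Let $F'_0$ be the graph consisting of the three vertices and three edges of the triangle $Oa_0b_0$, and $F'_{N+1}=F'_N\cup(F'_N+a_N)\cup(F'_N+b_N)$ for $N\in\mathbb Z_+$. Let $F'^R_N$ be the reflection of $F'_N$ in the $y$-axis. The (infinite) pre-Sierpiński gasket is $F_0=\bigcup_{N\ge1}(F'_N\cup F'^R_N)$, with vertex set $G_0$ and edge set $E_0$ (every vertex has degree 4). For $M\in\mathbb Z_+$ put $G_M=2^MG_0$, $E_M=2^ME_0$. A $2^M$-triangle is a translate of the closed filled triangle $Oa_Mb_M$ with vertices in $G_M$ and sides that are edges in $E_M$. **Paths.** A finite path is $w=(w(0),\dots,w(n))$ in $G_0$ with $w(i-1),w(i)$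 joined by an edge of $E_0$; its length is $\ell(w)=n$. It is loopless if $w(i)\ne w(j)$ for $i\neq j$. For a path with $w(0)\in G_M$ let $T^M_0(w)=0$ and $T^M_i(w)=\inf\{j>T^M_{i-1}(w): w(j)\in G_M\setminus\{w(T^M_{i-1}(w))\}\}$, $i=1,\dots,m$, where $m$ is the smallest integer with $T^M_{m+1}(w)=\infty$. For $N\in\mathbb Z_+$ define sets of finite paths starting at $O$: - $W_N$: $w(T^N_1)=a_N$ and $\ell(w)=T^N_1(w)$; - $V_N$: $w(T^N_1)=b_N$, $w(T^N_2)=a_N$ and $\ell(w)=T^N_2(w)$; - $W_N^b$, $V_N^b$: the same with the roles of $a_N$ and $b_N$ exchanged. Let $U_N=W_N\cup V_N\cup W_N^b\cup V_N^b$ and let $\Gamma_N$ be the set of loopless paths in $U_N$. **Exit times.** For a path $w$ starting at $O$ (with $m\ge1$), let $T^{ex,M}_0(w)=0$ and let $\Delta_1$ be the $2^M$-triangle containing $w(T^M_0)$ and $w(T^M_1)$. For $i\ge1$ let $J(i)$ be the smallest $j<m$ with $T^M_j(w)>T^{ex,M}_{i-1}(w)$ and $w(T^M_{j+1})\notin\Delta_i$ if such $j$ exists, and $J(i)=m$ otherwise; put $T^{ex,M}_i(w)=T^M_{J(i)}(w)$. If $J(i)<m$, let $\Delta_{i+1}$ be the $2^M$-triangle containing $w(T_i^{ex,M})$ and $w(T^M_{J(i)+1})$ and continue; if $J(i)=m$, stop. **Loop erasure (erasing larger loops first).** For a path $u$ with both endpoints in $G_k$ and $\ell(u)=T^k_m(u)$,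 set $c_j=u(T^k_j)$, $\tau_0=\max\{j:c_j=c_0\}$ and, while $\tau_i<m$, $\tau_{i+1}=\max\{j:c_j=c_{\tau_i+1}\}$; let $\mathcal E_ku$ be the concatenation of the segments of $u$ over the time intervals $[T^k_{\tau_i},T^k_{\tau_i+1}]$, over all $i$ with $\tau_i<m$, in order. (That is, the coarse path $(c_0,\dots,c_m)$ is loop-erased chronologically and the original fine structure is restored on the surviving coarse steps.) For $w\in U_N$ put $w^{(N)}=w$; for $k=N-1,N-2,\dots,0$ cut $w^{(k+1)}$ at its exit times $T^{ex,k+1}_i$ into consecutive pieces, apply $\mathcal E_k$ to each piece, and concatenate to obtain $w^{(k)}$. Set $Lw=w^{(0)}\in\Gamma_N$. **Measures.** Let $P^{(1)}_N,P^{(2)}_N$ be the probability measures on $W_N$, $W_N^b$ giving each path $w$ mass $(1/4)^{\ell(w)-1}$, and $P_N^{(3)},P_N^{(4)}$ those on $V_N$, $V_N^b$ giving each $w$ mass $(1/4)^{\ell(w)-2}$. Let $\hat P^{(i)}_N=P^{(i)}_N\circ L^{-1}$ on $\Gamma_N$. For $w\in\Gamma_N$ and $N\ge1$, $w|_{N-1}$ denotes $w$ stopped at $T_1^{ex,N-1}(w)$. Let $$\Omega=\{\omega=(\omega_0,\omega_1,\dots):\omega_N\in\Gamma_N\ (N\in\mathbb Z_+),\ \omega_N|_{N-1}=\omega_{N-1}\ (N\in\mathbb N)\},$$ $\mathcal B$ the $\sigma$-algebra generated by cylinder sets, $\pi_N\omega=(\omega_0,\dots,\omega_N)$, and let $\tilde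 P_N$ be the probability measure on $\pi_N\Omega$ given by $$\tilde P_N[(\omega_0,\dots,\omega_N)]=\tfrac{11}{28}\big(\hat P^{(1)}_N[\omega_N]+\hat P^{(2)}_N[\omega_N]\big)+\tfrac{3}{28}\big(\hat P^{(3)}_N[\omega_N]+\hat P^{(4)}_N[\omega_N]\big).$$ $\tilde P_N$ is the law of the loop-erased random walk on the finite gasket. *)

theory Defs
  imports "HOL-Probability.Probability"
begin

type_synonym point = "real \<times> real"

definition apex :: "nat \<Rightarrow> point" where
  "apex N = 2 ^ N *\<^sub>R (1 / 2, sqrt 3 / 2)"

definition corner :: "nat \<Rightarrow> point" where
  "corner N = 2 ^ N *\<^sub>R (1, 0)"

text \<open>A graph is given by its vertex set and by its set of undirected edges,
  each edge being the two-element set of its end points.\<close>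

fun finite_vertices :: "nat \<Rightarrow> point set" where
  "finite_vertices 0 = {0, apex 0, corner 0}"
| "finite_vertices (Suc N) = finite_vertices N
     \<union> (+) (apex N) ` finite_vertices N \<union> (+) (corner N) ` finite_vertices N"

fun finite_edges :: "nat \<Rightarrow> point set set" where
  "finite_edges 0 = {{0, apex 0}, {0, corner 0}, {apex 0, corner 0}}"
| "finite_edges (Suc N) = finite_edges N
     \<union> image ((+) (apex N)) ` finite_edges N \<union> image ((+) (corner N)) ` finite_edges N"

definition reflect :: "point \<Rightarrow> point" where
  "reflect p = (- fst p, snd p)"

definition gasket_vertices :: "nat \<Rightarrow> point set" where
  "gasket_vertices M = (*\<^sub>R) (2 ^ M) `
     (\<Union>N\<in>{1..}. finite_vertices N \<union> reflect ` finite_vertices N)"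

definition gasket_edges :: "nat \<Rightarrow> point set set" where
  "gasket_edges M = image ((*\<^sub>R) (2 ^ M)) `
     (\<Union>N\<in>{1..}. finite_edges N \<union> image reflect ` finite_edges N)"

definition triangles :: "nat \<Rightarrow> point set set" where
  "triangles M = {(+) v ` (convex hull {0, apex M, corner M}) | v.
     {v, v + apex M, v + corner M} \<subseteq> gasket_vertices M \<and>
     {{v, v + apex M}, {v, v + corner M}, {v + apex M, v + corner M}} \<subseteq> gasket_edges M}"

text \<open>The triangle is unique when \<open>x\<close> and \<open>y\<close> are joined by an edge of
  \<open>gasket_edges M\<close>, the only case in which it is used.\<close>

definition triangle_through :: "nat \<Rightarrow> point \<Rightarrow> point \<Rightarrow> point set" where
  "triangle_through M x y = (THE D. D \<in> triangles M \<and> x \<in> D \<and> y \<in> D)"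

text \<open>The path \<open>(w(0), \<dots>, w(n))\<close> is the list with these \<open>n + 1\<close> entries.\<close>

type_synonym path = "point list"

definition path_length :: "path \<Rightarrow> nat" where
  "path_length w = length w - 1"

definition is_path :: "path \<Rightarrow> bool" where
  "is_path w \<longleftrightarrow> w \<noteq> [] \<and> set w \<subseteq> gasket_vertices 0 \<and>
     (\<forall>i < path_length w. {w ! i, w ! Suc i} \<in> gasket_edges 0)"

text \<open>The hitting times \<open>T\<^sup>M\<^sub>i(w)\<close>; the infimum of the empty set is \<open>\<infinity>\<close> in \<open>enat\<close>.\<close>

fun hit :: "nat \<Rightarrow> path \<Rightarrow> nat \<Rightarrow> enat" where
  "hit M w 0 = 0"
| "hit M w (Suc i) = (case hit M w i of
      \<infinity> \<Rightarrow> \<infinity>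
    | enat t \<Rightarrow> Inf (enat ` {j. t < j \<and> j \<le> path_length w \<and> w ! j \<in> gasket_vertices M - {w ! t}}))"

definition hit_time :: "nat \<Rightarrow> path \<Rightarrow> nat \<Rightarrow> nat" where
  "hit_time M w i = the_enat (hit M w i)"

definition hit_point :: "nat \<Rightarrow> path \<Rightarrow> nat \<Rightarrow> point" where
  "hit_point M w i = w ! hit_time M w i"

definition num_hits :: "nat \<Rightarrow> path \<Rightarrow> nat" where
  "num_hits M w = (LEAST m. hit M w (Suc m) = \<infinity>)"

text \<open>\<open>W N (apex N)\<close> and \<open>W N (corner N)\<close> are the sets \<open>W\<^sub>N\<close> and \<open>W\<^sub>N\<^sup>b\<close>;
  \<open>V N (corner N) (apex N)\<close> and \<open>V N (apex N) (corner N)\<close> are \<open>V\<^sub>N\<close> and \<open>V\<^sub>N\<^sup>b\<close>.\<close>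

definition W :: "nat \<Rightarrow> point \<Rightarrow> path set" where
  "W N p = {w. is_path w \<and> w ! 0 = 0 \<and>
     hit N w 1 = enat (path_length w) \<and> hit_point N w 1 = p}"

definition V :: "nat \<Rightarrow> point \<Rightarrow> point \<Rightarrow> path set" where
  "V N q p = {w. is_path w \<and> w ! 0 = 0 \<and>
     hit N w 2 = enat (path_length w) \<and> hit_point N w 1 = q \<and> hit_point N w 2 = p}"

definition U :: "nat \<Rightarrow> path set" where
  "U N = W N (apex N) \<union> V N (corner N) (apex N) \<union> W N (corner N) \<union> V N (apex N) (corner N)"

definition \<Gamma> :: "nat \<Rightarrow> path set" where
  "\<Gamma> N = {w \<in> U N. distinct w}"

text \<open>\<open>exit_index M w i\<close> is \<open>J(i)\<close>, with \<open>J(0) = 0\<close>; hence \<open>\<Delta>\<^sub>i\<close> is the triangle through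
  the points hit at the coarse steps \<open>J(i - 1)\<close> and \<open>J(i - 1) + 1\<close> for every \<open>i \<ge> 1\<close>.
  Once \<open>J(i) = m\<close>, the value \<open>m\<close> is repeated.\<close>

fun exit_index :: "nat \<Rightarrow> path \<Rightarrow> nat \<Rightarrow> nat" where
  "exit_index M w 0 = 0"
| "exit_index M w (Suc i) =
    (let J = exit_index M w i;
         D = triangle_through M (hit_point M w J) (hit_point M w (Suc J));
         Q = (\<lambda>j. j < num_hits M w \<and> hit_time M w j > hit_time M w J \<and>
                  hit_point M w (Suc j) \<notin> D)
     in if \<exists>j. Q j then LEAST j. Q j else num_hits M w)"

definition exit_time :: "nat \<Rightarrow> path \<Rightarrow> nat \<Rightarrow> nat" where
  "exit_time M w i = hit_time M w (exit_index M w i)"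

definition num_exits :: "nat \<Rightarrow> path \<Rightarrow> nat" where
  "num_exits M w = (LEAST i. exit_index M w i = num_hits M w)"

definition segment :: "path \<Rightarrow> nat \<Rightarrow> nat \<Rightarrow> path" where
  "segment w s t = take (Suc (t - s)) (drop s w)"

text \<open>Concatenation of paths, the first of which starts at \<open>x\<close> and each of which starts
  where its predecessor ends; the repeated points are kept only once.\<close>

definition join_paths :: "point \<Rightarrow> path list \<Rightarrow> path" where
  "join_paths x us = x # concat (map tl us)"

fun last_visit :: "nat \<Rightarrow> path \<Rightarrow> nat \<Rightarrow> nat" where
  "last_visit k u 0 = Max {j. j \<le> num_hits k u \<and> hit_point k u j = hit_point k u 0}"
| "last_visit k u (Suc i) =
    (if last_visit k u i < num_hits k u
     then Max {j. j \<le> num_hits k u \<and> hit_point k u j = hit_point k u (Suc (last_visit k u i))}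
     else num_hits k u)"

definition erase :: "nat \<Rightarrow> path \<Rightarrow> path" where
  "erase k u = join_paths (u ! 0)
     (map (\<lambda>i. segment u (hit_time k u (last_visit k u i)) (hit_time k u (Suc (last_visit k u i))))
        [0..<(LEAST i. last_visit k u i = num_hits k u)])"

definition erase_level :: "nat \<Rightarrow> path \<Rightarrow> path" where
  "erase_level k w = join_paths (w ! 0)
     (map (\<lambda>i. erase k (segment w (exit_time (Suc k) w i) (exit_time (Suc k) w (Suc i))))
        [0..<num_exits (Suc k) w])"

fun loop_erasure :: "nat \<Rightarrow> path \<Rightarrow> path" where
  "loop_erasure 0 w = w"
| "loop_erasure (Suc k) w = loop_erasure k (erase_level k w)"

definition W_law :: "nat \<Rightarrow> point \<Rightarrow> path measure" where
  "W_law N p = point_measure (W N p) (\<lambda>w. ennreal ((1 / 4) ^ (path_length w - 1)))"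

definition V_law :: "nat \<Rightarrow> point \<Rightarrow> point \<Rightarrow> path measure" where
  "V_law N q p = point_measure (V N q p) (\<lambda>w. ennreal ((1 / 4) ^ (path_length w - 2)))"

definition erased_law :: "nat \<Rightarrow> path measure \<Rightarrow> path measure" where
  "erased_law N Q = distr Q (count_space (\<Gamma> N)) (loop_erasure N)"

definition stopped :: "nat \<Rightarrow> path \<Rightarrow> path" where
  "stopped M w = segment w 0 (exit_time M w 1)"

definition \<Omega> :: "(nat \<Rightarrow> path) set" where
  "\<Omega> = {\<omega>. (\<forall>N. \<omega> N \<in> \<Gamma> N) \<and> (\<forall>N. stopped N (\<omega> (Suc N)) = \<omega> N)}"

text \<open>The tuple \<open>(\<omega>\<^sub>0, \<dots>, \<omega>\<^sub>N)\<close> is a list of length \<open>N + 1\<close>.\<close>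

definition proj :: "nat \<Rightarrow> (nat \<Rightarrow> path) \<Rightarrow> path list" where
  "proj N \<omega> = map \<omega> [0..<Suc N]"

definition cylinder_sets :: "(nat \<Rightarrow> path) set set" where
  "cylinder_sets = {proj N -` A \<inter> \<Omega> | N A. A \<subseteq> proj N ` \<Omega>}"

definition LERW_law :: "nat \<Rightarrow> path list measure" where
  "LERW_law N = point_measure (proj N ` \<Omega>) (\<lambda>\<eta>.
     ennreal (11 / 28) *
       (emeasure (erased_law N (W_law N (apex N))) {\<eta> ! N} +
        emeasure (erased_law N (W_law N (corner N))) {\<eta> ! N}) +
     ennreal (3 / 28) *
       (emeasure (erased_law N (V_law N (corner N) (apex N))) {\<eta> ! N} +
        emeasure (erased_law N (V_law N (apex N) (corner N))) {\<eta> ! N}))"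

text \<open>\<open>X(\<omega>)(i)\<close> is read off from the least \<open>N\<close> with \<open>i \<le> 2\<^sup>N\<close>; the independence of the choice
  of \<open>N\<close> is part of the theorem.\<close>

definition X :: "(nat \<Rightarrow> path) \<Rightarrow> nat \<Rightarrow> point" where
  "X \<omega> i = \<omega> (LEAST N. i \<le> 2 ^ N) ! i"

end

theory Submission
  imports Defs
begin

text \<open>Such a measure exists as soon as the laws of the loop-erased walks are consistent:
  stopping the loop-erased walk of level \<open>N + 1\<close> at its first exit from a triangle of
  side \<open>2 ^ N\<close> must give the loop-erased walk of level \<open>N\<close>. A projective
  limit (\<open>projective_limit_pmf\<close>) then produces \<open>P\<close>, and the path
  properties hold for every sequence in \<open>\<Omega>\<close>: each \<open>\<omega> N\<close> is
  an initial segment of \<open>\<omega> (Suc N)\<close>, and it has at least \<open>2 ^ N\<close>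
  steps because it ends at distance \<open>2 ^ N\<close> from the origin (\<open>U_length\<close>).
  Consistency (\<open>lerw_consistent\<close>) splits into two facts, one about paths and one about
  masses.

  The fact about paths is that erasure is local. Write a path that moves between vertices of the
  grid of side \<open>2 ^ k\<close> as the list of its steps at that scale. The first operation of
  the erasure of level \<open>N + 1\<close>, namely \<open>erase_level N\<close>, is the
  chronological loop erasure of this list with \<open>k = N\<close>, so its result has a
  self-avoiding coarse path. From then on everything happens triangle by triangle. A self-avoiding
  path that starts in a triangle, ends at one of its corners and meets no coarse vertex other than
  its corners cannot leave it, since the only way back would be through the corner by which it left
  (\<open>stays_in_cell\<close>). Hence the cuts made at the exit times of one scale remain cuts at
  all smaller scales, because the steps on the two sides of such a cut lie in two different
  triangles (\<open>erased_to_join\<close>, \<open>loop_erasure_breaks\<close>). So erasing the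
  whole path and stopping it at the first exit gives the erasure of its first piece alone
  (\<open>stopped_loop_erasure\<close>).

  The fact about masses is that this first piece, namely the path stopped at its first exit after
  the single operation \<open>erase_level N\<close>, has the law of the unerased walk of level
  \<open>N\<close> (\<open>first_piece_law\<close>). The weight \<open>(1 / 4) ^ n\<close> of a path
  is that of simple random walk on a graph of degree 4. Solving the Dirichlet problem on the
  midpoints of a triangle of side \<open>2 ^ (k + 1)\<close> shows that a step of this scale again
  has mass \<open>1 / 4\<close> (\<open>decimates\<close>). The mass of all walks whose loop erasure
  begins with a prescribed list of steps is a product: the loops at the starting point, the first
  surviving step, the loops at its end point that avoid the start, and so on
  (\<open>surviving_first\<close>). The loop factors are quotients of hitting probabilities, hence
  rational numbers that come out of small linear systems. With them the masses of the four path
  classes of level \<open>N + 1\<close> above a given piece \<open>u\<close> are explicit multiples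
  of the weight of \<open>u\<close> (\<open>masses_one\<close>, \<open>masses_two\<close>), and the
  mixture with weights \<open>11 / 28\<close> and \<open>3 / 28\<close> is a fixed point:
  \<open>11 / 7 * (19 / 30 + 1 / 6) + 12 / 7 * (7 / 120 + 1 / 8) = 11 / 7\<close> for pieces that go
  straight to a corner and
  \<open>11 / 7 * (2 / 15 + 2 / 3) + 12 / 7 * (1 / 10 + 1 / 6) = 12 / 7\<close> for pieces that
  visit both corners.\<close>

section \<open>The gasket as a union of triangular cells\<close>

text \<open>Coordinates with respect to the lattice basis given by \<open>apex 0\<close> and
  \<open>corner 0\<close>. In them the triangles of the gasket become the sets
  \<open>s \<ge> a\<close>, \<open>t \<ge> b\<close>, \<open>s + t \<le> a + b + 2 ^ k\<close>, and
  doubling acts on binary digits.\<close>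

definition pt :: "real \<Rightarrow> real \<Rightarrow> point" where
  "pt s t = (s / 2 + t, s * (sqrt 3 / 2))"

lemma pt_inject [simp]: "pt s t = pt s' t' \<longleftrightarrow> s = s' \<and> t = t'"
proof
  assume "pt s t = pt s' t'"
  then have "s / 2 + t = s' / 2 + t'" "s * (sqrt 3 / 2) = s' * (sqrt 3 / 2)" by (simp_all add: pt_def)
  moreover from this(2) have "s = s'" by simp
  ultimately show "s = s' \<and> t = t'" by simp
qed simp

lemma pt_add: "pt s t + pt s' t' = pt (s + s') (t + t')"
  by (simp add: pt_def algebra_simps)

lemma pt_diff: "pt s t - pt s' t' = pt (s - s') (t - t')"
  by (simp add: pt_def algebra_simps diff_divide_distrib)

lemma pt_scale: "c *\<^sub>R pt s t = pt (c * s) (c * t)"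
  by (simp add: pt_def algebra_simps)

lemma zero_eq_pt: "0 = pt 0 0"
  by (simp add: pt_def zero_prod_def)

lemma apex_eq_pt: "apex k = pt (2 ^ k) 0" and corner_eq_pt: "corner k = pt 0 (2 ^ k)"
  by (simp_all add: apex_def corner_def pt_def)

lemma reflect_pt: "reflect (pt s t) = pt s (- (s + t))"
  by (simp add: reflect_def pt_def)

text \<open>The lower left corners of the unit triangles, in lattice coordinates. The two triangles
  at the origin are mirror images of each other, and every triangle of side 2 carries three unit
  triangles, obtained by doubling the coordinates and appending one of the digit pairs (0,0), (1,0),
  (0,1). This description has no preferred direction of growth, unlike the union of the finite
  gaskets and their reflections.\<close>

inductive cell :: "int \<Rightarrow> int \<Rightarrow> bool" where
  right: "cell 0 0"
| left: "cell 0 (- 1)"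
| low: "cell i l \<Longrightarrow> cell (2 * i) (2 * l)"
| top: "cell i l \<Longrightarrow> cell (2 * i + 1) (2 * l)"
| far: "cell i l \<Longrightarrow> cell (2 * i) (2 * l + 1)"

lemma cell_iff_parent: "cell i l \<longleftrightarrow> cell (i div 2) (l div 2) \<and> \<not> (odd i \<and> odd l)"
proof
  assume "cell i l"
  then show "cell (i div 2) (l div 2) \<and> \<not> (odd i \<and> odd l)"
    by cases (auto intro: cell.right cell.left)
next
  assume *: "cell (i div 2) (l div 2) \<and> \<not> (odd i \<and> odd l)"
  show "cell i l"
  proof (cases "even i")
    case True
    then obtain a where "i = 2 * a" by blast
    then show ?thesis using * cell.low[of a "l div 2"] cell.far[of a "l div 2"]
      by (cases "even l") (auto elim!: evenE oddE)
  next
    case False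
    then obtain a where "i = 2 * a + 1" by (auto elim: oddE)
    then show ?thesis using * cell.top[of a "l div 2"]
      by (cases "even l") (auto elim!: evenE oddE)
  qed
qed

lemma cell_nonneg: "cell i l \<Longrightarrow> i \<ge> 0"
  by (induction rule: cell.induct) auto

text \<open>The combinatorial form of the fact that every vertex has degree 4: the three upward
  triangles that have the lattice point (i,l) as a corner are listed, and two of them belong to the
  gasket. Halving the coordinates proves it. If both are even the question is the same one level up,
  and in the other cases two of the candidates have the same parent while the third has two odd
  coordinates.\<close>

lemma cell_two:
  assumes "cell i l \<or> cell (i - 1) l \<or> cell i (l - 1)"
  shows "(cell i l \<and> cell (i - 1) l \<and> \<not> cell i (l - 1)) \<or>
         (cell i l \<and> \<not> cell (i - 1) l \<and> cell i (l - 1)) \<or>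
         (\<not> cell i l \<and> cell (i - 1) l \<and> cell i (l - 1))"
  using assms
proof (induction "nat (\<bar>i\<bar> + \<bar>l\<bar>)" arbitrary: i l rule: less_induct)
  case less
  have odd_red: "(2 * a + 1 - 1) = 2 * a" for a :: int by simp
  have ev: "(2 * a - 1) div 2 = a - 1" for a :: int by simp
  consider (z) "i = 0" "l = 0"
    | (ee) a b where "i = 2 * a" "l = 2 * b" "(a, b) \<noteq> (0, 0)"
    | (eo) a b where "i = 2 * a" "l = 2 * b + 1"
    | (oe) a b where "i = 2 * a + 1" "l = 2 * b"
    | (oo) a b where "i = 2 * a + 1" "l = 2 * b + 1"
    by (cases "even i"; cases "even l"; cases "i = 0"; cases "l = 0") (auto elim!: evenE oddE)
  then show ?case
  proof cases
    case z
    then show ?thesis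
      using cell.right cell.left cell_nonneg[of "- 1" 0] by auto
  next
    case (ee a b)
    have 1: "cell i l \<longleftrightarrow> cell a b"
      and 2: "cell (i - 1) l \<longleftrightarrow> cell (a - 1) b"
      and 3: "cell i (l - 1) \<longleftrightarrow> cell a (b - 1)"
      using ee ev by (subst cell_iff_parent; simp)+
    have "nat (\<bar>a\<bar> + \<bar>b\<bar>) < nat (\<bar>i\<bar> + \<bar>l\<bar>)" using ee by auto
    from less(1)[OF this] less(2) show ?thesis unfolding 1 2 3 .
  next
    case (eo a b)
    have 1: "cell i l \<longleftrightarrow> cell a b"
      and 2: "\<not> cell (i - 1) l"
      and 3: "cell i (l - 1) \<longleftrightarrow> cell a b"
      using eo ev by (subst cell_iff_parent; simp)+
    then show ?thesis using less(2) by simp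
  next
    case (oe a b)
    have 1: "cell i l \<longleftrightarrow> cell a b"
      and 2: "\<not> cell i (l - 1)"
      and 3: "cell (i - 1) l \<longleftrightarrow> cell a b"
      using oe ev by (subst cell_iff_parent; simp)+
    then show ?thesis using less(2) by simp
  next
    case (oo a b)
    have 1: "\<not> cell i l"
      and 2: "cell (i - 1) l \<longleftrightarrow> cell a b"
      and 3: "cell i (l - 1) \<longleftrightarrow> cell a b"
      using oo ev by (subst cell_iff_parent; simp)+
    then show ?thesis using less(2) by simp
  qed
qed

text \<open>A triangle of side \<open>2 ^ k\<close> is represented by its lower left corner.\<close>

definition cells :: "nat \<Rightarrow> point set" where
  "cells k = {pt (2 ^ k * of_int i) (2 ^ k * of_int l) | i l. cell i l}"

lemma cellsI: "cell i l \<Longrightarrow> pt (2 ^ k * of_int i) (2 ^ k * of_int l) \<in> cells k"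
  by (auto simp: cells_def)

definition corners :: "nat \<Rightarrow> point \<Rightarrow> point set" where
  "corners k v = {v, v + apex k, v + corner k}"

definition sides :: "nat \<Rightarrow> point \<Rightarrow> point set set" where
  "sides k v = {{v, v + apex k}, {v, v + corner k}, {v + apex k, v + corner k}}"

definition tri :: "nat \<Rightarrow> point \<Rightarrow> point set" where
  "tri k v = (+) v ` (convex hull {0, apex k, corner k})"

lemma tri_pt: "tri k (pt a b) = {pt s t | s t. a \<le> s \<and> b \<le> t \<and> s + t \<le> a + b + 2 ^ k}"
proof (intro equalityI subsetI)
  fix x assume "x \<in> tri k (pt a b)"
  then obtain u v :: real where x: "x = pt (a + 2 ^ k * u) (b + 2 ^ k * v)" and *: "0 \<le> u" "0 \<le> v" "u + v \<le> 1"
    unfolding tri_def convex_hull_3_alt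
    by (auto simp: zero_eq_pt apex_eq_pt corner_eq_pt pt_add pt_diff pt_scale mult.commute)
  have "2 ^ k * u + 2 ^ k * v \<le> (2::real) ^ k"
    using mult_left_mono[OF *(3), of "2 ^ k"] by (simp add: algebra_simps)
  then show "x \<in> {pt s t | s t. a \<le> s \<and> b \<le> t \<and> s + t \<le> a + b + 2 ^ k}"
    using * x by auto
next
  fix x assume "x \<in> {pt s t | s t. a \<le> s \<and> b \<le> t \<and> s + t \<le> a + b + 2 ^ k}"
  then obtain s t where x: "x = pt s t" and *: "a \<le> s" "b \<le> t" "s + t \<le> a + b + 2 ^ k" by blast
  define u v where "u = (s - a) / 2 ^ k" and "v = (t - b) / 2 ^ k"
  have uv: "0 \<le> u" "0 \<le> v" "u + v \<le> 1"
    using * by (auto simp: u_def v_def simp flip: add_divide_distrib)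
  have "s = a + 2 ^ k * u" "t = b + 2 ^ k * v" by (simp_all add: u_def v_def)
  then have "x = pt a b + (0 + u *\<^sub>R (apex k - 0) + v *\<^sub>R (corner k - 0))"
    by (simp add: x apex_eq_pt corner_eq_pt pt_add pt_scale mult.commute)
  then show "x \<in> tri k (pt a b)"
    unfolding tri_def convex_hull_3_alt using uv by blast
qed

lemma corners_pt: "corners k (pt a b) = {pt a b, pt (a + 2 ^ k) b, pt a (b + 2 ^ k)}"
  by (simp add: corners_def apex_eq_pt corner_eq_pt pt_add)

lemma corners_subset_tri: "corners k v \<subseteq> tri k v"
proof -
  obtain a b where v: "v = pt a b"
  proof -
    have "v = pt (snd v / (sqrt 3 / 2)) (fst v - snd v / (sqrt 3 / 2) / 2)"
      by (simp add: pt_def prod_eq_iff)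
    then show ?thesis using that by blast
  qed
  show ?thesis by (simp add: v corners_pt tri_pt)
qed

lemma finite_corners [simp]: "finite (corners k v)"
  by (simp add: corners_def)

lemma card_corners: "card (corners k v) = 3"
  using apex_eq_pt[of k] corner_eq_pt[of k]
  by (simp add: corners_def zero_eq_pt)

fun finite_cells :: "nat \<Rightarrow> point set" where
  "finite_cells 0 = {0}"
| "finite_cells (Suc N) = finite_cells N \<union> (+) (apex N) ` finite_cells N \<union> (+) (corner N) ` finite_cells N"

lemma corners_shift: "corners k (c + v) = (+) c ` corners k v"
  by (auto simp: corners_def add.assoc)

lemma sides_shift: "sides k (c + v) = image ((+) c) ` sides k v"
  by (auto simp: sides_def add.assoc)

lemma finite_vertices_eq: "finite_vertices N = (\<Union>v\<in>finite_cells N. corners 0 v)"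
proof (induction N)
  case (Suc N)
  then show ?case by (simp add: image_UN UN_Un corners_shift)
qed (simp add: corners_def)

lemma finite_edges_eq: "finite_edges N = (\<Union>v\<in>finite_cells N. sides 0 v)"
proof (induction N)
  case (Suc N)
  then show ?case by (simp add: image_UN UN_Un sides_shift)
qed (simp add: sides_def)

text \<open>The finite gaskets grow outwards by translation, but \<open>cell\<close> grows inwards
  by subdivision. Both give the same sets because the two kinds of steps commute.\<close>

lemma finite_cells_double:
  "finite_cells (Suc N) = (\<lambda>v. 2 *\<^sub>R v) ` finite_cells N \<union> (\<lambda>v. apex 0 + 2 *\<^sub>R v) ` finite_cells N
     \<union> (\<lambda>v. corner 0 + 2 *\<^sub>R v) ` finite_cells N"
proof (induction N)
  case 0
  show ?case by simp
next
  case (Suc N)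
  have 2: "2 *\<^sub>R apex N = apex (Suc N)" "2 *\<^sub>R corner N = corner (Suc N)"
    by (simp_all add: apex_def corner_def)
  have shift: "(\<lambda>v. c + 2 *\<^sub>R v) ` ((+) d ` F) = (+) (2 *\<^sub>R d) ` ((\<lambda>v. c + 2 *\<^sub>R v) ` F)"
    for c d :: point and F
    by (simp add: image_image scaleR_add_right add.left_commute)
  have shift0: "(\<lambda>v. 2 *\<^sub>R v) ` ((+) d ` F) = (+) (2 *\<^sub>R d) ` ((\<lambda>v. 2 *\<^sub>R v) ` F)"
    for d :: point and F
    by (simp add: image_image scaleR_add_right)
  have "finite_cells (Suc (Suc N)) = finite_cells (Suc N) \<union> (+) (apex (Suc N)) ` finite_cells (Suc N)
    \<union> (+) (corner (Suc N)) ` finite_cells (Suc N)" by simp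
  also have "\<dots> = (\<lambda>v. 2 *\<^sub>R v) ` (finite_cells N \<union> (+) (apex N) ` finite_cells N \<union> (+) (corner N) ` finite_cells N)
     \<union> (\<lambda>v. apex 0 + 2 *\<^sub>R v) ` (finite_cells N \<union> (+) (apex N) ` finite_cells N \<union> (+) (corner N) ` finite_cells N)
     \<union> (\<lambda>v. corner 0 + 2 *\<^sub>R v) ` (finite_cells N \<union> (+) (apex N) ` finite_cells N \<union> (+) (corner N) ` finite_cells N)"
    unfolding Suc.IH image_Un shift shift0 2 by blast
  finally show ?case by simp
qed

text \<open>The reflection of a triangle is the triangle whose lower left corner is the reflection
  of the lower right one.\<close>

definition flip_cell :: "point \<Rightarrow> point" where
  "flip_cell v = reflect v - corner 0"

lemma corners_flip_cell: "corners 0 (flip_cell v) = reflect ` corners 0 v"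
  by (auto simp: corners_def flip_cell_def reflect_def apex_def corner_def prod_eq_iff)

lemma sides_flip_cell: "sides 0 (flip_cell v) = image reflect ` sides 0 v"
proof -
  have "flip_cell v = reflect (v + corner 0)" "flip_cell v + corner 0 = reflect v"
    "flip_cell v + apex 0 = reflect (v + apex 0)"
    by (simp_all add: flip_cell_def reflect_def apex_def corner_def prod_eq_iff)
  then show ?thesis by (auto simp: sides_def)
qed

lemma finite_cells_doubleI:
  assumes "u \<in> finite_cells N"
  shows "2 *\<^sub>R u \<in> finite_cells (Suc N)" "apex 0 + 2 *\<^sub>R u \<in> finite_cells (Suc N)"
    "corner 0 + 2 *\<^sub>R u \<in> finite_cells (Suc N)"
  using assms unfolding finite_cells_double by blast+

lemma flip_cell_double:
  "flip_cell (corner 0 + 2 *\<^sub>R u) = 2 *\<^sub>R flip_cell u" "flip_cell (apex 0 + 2 *\<^sub>R u) = apex 0 + 2 *\<^sub>R flip_cell u"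
  "flip_cell (2 *\<^sub>R u) = corner 0 + 2 *\<^sub>R flip_cell u"
  by (simp_all add: flip_cell_def reflect_def corner_def apex_def prod_eq_iff)

lemma cells_0_eq: "cells 0 = (\<Union>N. finite_cells N \<union> flip_cell ` finite_cells N)"
proof (intro equalityI subsetI)
  let ?R = "\<Union>N. finite_cells N \<union> flip_cell ` finite_cells N"
  have D: "2 *\<^sub>R w \<in> ?R \<and> apex 0 + 2 *\<^sub>R w \<in> ?R \<and> corner 0 + 2 *\<^sub>R w \<in> ?R" if w: "w \<in> ?R" for w
  proof -
    from w obtain N where "w \<in> finite_cells N \<union> flip_cell ` finite_cells N" by (rule UN_E)
    then consider "w \<in> finite_cells N" | u where "u \<in> finite_cells N" "w = flip_cell u" by blast
    then show ?thesis
    proof cases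
      case 1
      from finite_cells_doubleI[OF this] show ?thesis by (intro conjI UN_I[OF UNIV_I] UnI1)
    next
      case (2 u)
      from finite_cells_doubleI[OF 2(1), THEN imageI, of flip_cell, unfolded flip_cell_double]
      show ?thesis unfolding 2(2) by (intro conjI UN_I[OF UNIV_I] UnI2)
    qed
  qed
  fix v assume "v \<in> cells 0"
  then obtain i l where v: "v = pt (of_int i) (of_int l)" and "cell i l"
    by (auto simp: cells_def)
  from this(2) have "pt (of_int i) (of_int l) \<in> ?R"
  proof induction
    case right
    have "pt (of_int 0) (of_int 0) \<in> finite_cells 0" by (simp add: zero_eq_pt)
    then show ?case by (intro UN_I[OF UNIV_I] UnI1)
  next
    case left
    have "pt (of_int 0) (of_int (- 1)) \<in> flip_cell ` finite_cells 0"
      by (simp add: zero_eq_pt flip_cell_def reflect_pt corner_eq_pt pt_diff)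
    then show ?case by (intro UN_I[OF UNIV_I] UnI2)
  next
    case (low i l)
    then show ?case using D[of "pt (of_int i) (of_int l)"] by (simp add: pt_scale)
  next
    case (top i l)
    then show ?case using D[of "pt (of_int i) (of_int l)"]
      by (simp add: pt_scale apex_eq_pt pt_add add.commute)
  next
    case (far i l)
    then show ?case using D[of "pt (of_int i) (of_int l)"]
      by (simp add: pt_scale corner_eq_pt pt_add add.commute)
  qed
  then show "v \<in> ?R" using v by blast
next
  have D: "2 *\<^sub>R w \<in> cells 0 \<and> apex 0 + 2 *\<^sub>R w \<in> cells 0 \<and> corner 0 + 2 *\<^sub>R w \<in> cells 0"
    if w0: "w \<in> cells 0" for w
  proof -
    from w0 obtain i l where w: "w = pt (of_int i) (of_int l)" and c: "cell i l"
      by (auto simp: cells_def)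
    have I: "cell i' l' \<Longrightarrow> pt (of_int i') (of_int l') \<in> cells 0" for i' l'
      by (auto simp: cells_def)
    show ?thesis using I[OF cell.low[OF c]] I[OF cell.top[OF c]] I[OF cell.far[OF c]]
      by (simp add: w pt_scale pt_add apex_eq_pt corner_eq_pt add.commute)
  qed
  have *: "v \<in> cells 0 \<and> flip_cell v \<in> cells 0" if "v \<in> finite_cells N" for v N
    using that
  proof (induction N arbitrary: v)
    case 0
    have "pt (of_int 0) (of_int 0) \<in> cells 0" "pt (of_int 0) (of_int (- 1)) \<in> cells 0"
      using cellsI[OF cell.right, of 0] cellsI[OF cell.left, of 0] by simp_all
    then show ?case using 0 by (simp add: zero_eq_pt flip_cell_def reflect_pt corner_eq_pt pt_diff)
  next
    case (Suc N)
    then obtain u where u: "u \<in> finite_cells N" "v = 2 *\<^sub>R u \<or> v = apex 0 + 2 *\<^sub>R u \<or> v = corner 0 + 2 *\<^sub>R u"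
      unfolding finite_cells_double by blast
    have "w \<in> cells 0 \<and> flip_cell w \<in> cells 0"
      if "w = 2 *\<^sub>R u \<or> w = apex 0 + 2 *\<^sub>R u \<or> w = corner 0 + 2 *\<^sub>R u" for w
      using that D[of u] D[of "flip_cell u"] Suc.IH[OF u(1)]
      by (elim disjE) (simp_all only: flip_cell_double simp_thms)
    then show ?case using u(2) by blast
  qed
  fix v assume "v \<in> (\<Union>N. finite_cells N \<union> flip_cell ` finite_cells N)"
  then obtain N where "v \<in> finite_cells N \<union> flip_cell ` finite_cells N" by (rule UN_E)
  then show "v \<in> cells 0" using * by blast
qed

lemma finite_cells_mono: "finite_cells 0 \<subseteq> finite_cells N" "finite_cells N \<subseteq> finite_cells (Suc N)"
  by (induction N) auto

lemma cells_0_eq_from_1: "cells 0 = (\<Union>N\<in>{1..}. finite_cells N \<union> flip_cell ` finite_cells N)"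
proof -
  have "finite_cells N \<union> flip_cell ` finite_cells N \<subseteq> finite_cells (Suc N) \<union> flip_cell ` finite_cells (Suc N)" for N
    using finite_cells_mono(2)[of N] by blast
  moreover have "Suc N \<in> {1..}" for N by simp
  ultimately have "(\<Union>N. finite_cells N \<union> flip_cell ` finite_cells N)
     \<subseteq> (\<Union>N\<in>{1..}. finite_cells N \<union> flip_cell ` finite_cells N)"
    by (intro UN_least) (rule order_trans[OF _ UN_upper], assumption)
  moreover have "(\<Union>N\<in>{1..}. finite_cells N \<union> flip_cell ` finite_cells N)
     \<subseteq> (\<Union>N. finite_cells N \<union> flip_cell ` finite_cells N)" by (rule UN_mono) auto
  ultimately show ?thesis unfolding cells_0_eq by (rule subset_antisym)
qed

lemma cells_scale: "cells k = (*\<^sub>R) (2 ^ k) ` cells 0"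
proof -
  have "cells j = (\<lambda>(i, l). pt (2 ^ j * of_int i) (2 ^ j * of_int l)) ` {(i, l). cell i l}" for j
    by (auto simp: cells_def image_iff)
  from this[of k] this[of 0] show ?thesis by (simp add: image_image case_prod_unfold pt_scale)
qed

lemma corners_scale: "corners k (2 ^ k *\<^sub>R v) = (*\<^sub>R) (2 ^ k) ` corners 0 v"
  by (simp add: corners_def apex_def corner_def scaleR_add_right)

lemma sides_scale: "sides k (2 ^ k *\<^sub>R v) = image ((*\<^sub>R) (2 ^ k)) ` sides 0 v"
  by (simp add: sides_def apex_def corner_def scaleR_add_right)

lemma gasket_vertices_eq: "gasket_vertices k = (\<Union>v\<in>cells k. corners k v)"
proof -
  have "(\<Union>N\<in>{1..}. finite_vertices N \<union> reflect ` finite_vertices N) = (\<Union>v\<in>cells 0. corners 0 v)"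
    unfolding cells_0_eq_from_1 finite_vertices_eq image_UN corners_flip_cell[symmetric] by blast
  then show ?thesis
    unfolding gasket_vertices_def cells_scale[of k] by (simp add: image_UN corners_scale)
qed

lemma gasket_edges_eq: "gasket_edges k = (\<Union>v\<in>cells k. sides k v)"
proof -
  have "(\<Union>N\<in>{1..}. finite_edges N \<union> image reflect ` finite_edges N) = (\<Union>v\<in>cells 0. sides 0 v)"
    unfolding cells_0_eq_from_1 finite_edges_eq image_UN sides_flip_cell[symmetric] by blast
  then show ?thesis
    unfolding gasket_edges_def cells_scale[of k] by (simp add: image_UN sides_scale)
qed

section \<open>Adjacency and the mutual position of cells\<close>

text \<open>Points happen to be pairs; from here on they are not to be split into
  coordinates.\<close>

declare split_paired_All [simp del] split_paired_Ex [simp del]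

lemma cells_E:
  assumes "v \<in> cells k"
  obtains i l where "v = pt (2 ^ k * of_int i) (2 ^ k * of_int l)" "cell i l"
  using assms by (auto simp: cells_def)

lemma tri_cell:
  "tri k (pt (2 ^ k * of_int i) (2 ^ k * of_int l)) =
     {pt s t | s t. of_int i \<le> s / 2 ^ k \<and> of_int l \<le> t / 2 ^ k \<and> s / 2 ^ k + t / 2 ^ k \<le> of_int i + of_int l + 1}"
  unfolding tri_pt by (auto simp: field_simps)

lemma corners_cell:
  "corners k (pt (2 ^ k * of_int i) (2 ^ k * of_int l)) =
     {pt (2 ^ k * of_int i) (2 ^ k * of_int l), pt (2 ^ k * of_int (i + 1)) (2 ^ k * of_int l),
      pt (2 ^ k * of_int i) (2 ^ k * of_int (l + 1))}"
  by (simp add: corners_pt algebra_simps)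

text \<open>If two different triangles of the same side share a point, then they are two of the
  three around a lattice point and meet there only. The coordinates are divided by the side, so
  corners are integral. That the three points are separated comes from the integrality of
  \<open>i' - i\<close> and \<open>l' - l\<close>.\<close>

lemma triangles_meet:
  fixes i l i' l' :: int and s t :: real
  assumes "of_int i \<le> s" "of_int l \<le> t" "s + t \<le> of_int i + of_int l + 1"
    and "of_int i' \<le> s" "of_int l' \<le> t" "s + t \<le> of_int i' + of_int l' + 1"
    and "(i, l) \<noteq> (i', l')"
  shows "(i' \<ge> i + 1 \<and> s = of_int i + 1 \<and> t = of_int l \<and> ((i', l') = (i + 1, l) \<or> (i', l') = (i + 1, l - 1)))
     \<or> (l' \<ge> l + 1 \<and> s = of_int i \<and> t = of_int l + 1 \<and> ((i', l') = (i, l + 1) \<or> (i', l') = (i - 1, l + 1)))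
     \<or> (i' \<le> i \<and> l' \<le> l \<and> s = of_int i \<and> t = of_int l \<and> ((i', l') = (i - 1, l) \<or> (i', l') = (i, l - 1)))"
proof -
  consider "i' \<ge> i + 1" | "i' \<le> i" "l' \<ge> l + 1" | "i' \<le> i - 1" "l' \<le> l" | "i' = i" "l' \<le> l - 1"
    using assms(7) by fastforce
  then show ?thesis
  proof cases
    case 1
    then have "real_of_int i' \<ge> of_int i + 1" by linarith
    then have e: "s = of_int i + 1" "t = of_int l" using assms by linarith+
    have "real_of_int i' = of_int (i + 1)" "real_of_int l' \<le> of_int l" "real_of_int l' \<ge> of_int (l - 1)"
      using assms e \<open>real_of_int i' \<ge> of_int i + 1\<close> by simp_all
    then have "i' = i + 1" "l' = l \<or> l' = l - 1" by linarith+
    then show ?thesis using e by auto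
  next
    case 2
    then have "real_of_int l' \<ge> of_int l + 1" by linarith
    then have e: "s = of_int i" "t = of_int l + 1" using assms by linarith+
    have "real_of_int l' = of_int (l + 1)" "real_of_int i' \<le> of_int i" "real_of_int i' \<ge> of_int (i - 1)"
      using assms e \<open>real_of_int l' \<ge> of_int l + 1\<close> by simp_all
    then have "l' = l + 1" "i' = i \<or> i' = i - 1" by linarith+
    then show ?thesis using e by auto
  next
    case 3
    then have "real_of_int i' \<le> of_int i - 1" "real_of_int l' \<le> of_int l" by linarith+
    then have e: "s = of_int i" "t = of_int l" "real_of_int i' = of_int (i - 1)" "real_of_int l' = of_int l"
      using assms by simp_all
    then have "i' = i - 1" "l' = l" by linarith+
    then show ?thesis using e by auto
  next
    case 4
    then have "real_of_int i' = of_int i" "real_of_int l' \<le> of_int l - 1" by linarith+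
    then have e: "s = of_int i" "t = of_int l" "real_of_int l' = of_int (l - 1)"
      using assms by simp_all
    then have "l' = l - 1" by linarith
    then show ?thesis using e 4 by auto
  qed
qed

text \<open>Different triangles of one scale meet in at most one point, and that point is a corner
  of both. All later arguments about the geometry of the gasket rest on this.\<close>

lemma tri_Int_tri:
  assumes "u \<in> cells k" "v \<in> cells k" "u \<noteq> v" "p \<in> tri k u" "p \<in> tri k v"
  shows "p \<in> corners k u" "p \<in> corners k v"
    and "q \<in> tri k u \<Longrightarrow> q \<in> tri k v \<Longrightarrow> q = p"
proof -
  obtain i l where u: "u = pt (2 ^ k * of_int i) (2 ^ k * of_int l)" using assms(1) by (rule cells_E)
  obtain i' l' where v: "v = pt (2 ^ k * of_int i') (2 ^ k * of_int l')" using assms(2) by (rule cells_E)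
  have ne: "(i, l) \<noteq> (i', l')" using u v assms(3) by auto
  have key: "\<exists>s t. r = pt (2 ^ k * s) (2 ^ k * t) \<and>
      ((i' \<ge> i + 1 \<and> s = of_int i + 1 \<and> t = of_int l \<and> ((i', l') = (i + 1, l) \<or> (i', l') = (i + 1, l - 1)))
     \<or> (l' \<ge> l + 1 \<and> s = of_int i \<and> t = of_int l + 1 \<and> ((i', l') = (i, l + 1) \<or> (i', l') = (i - 1, l + 1)))
     \<or> (i' \<le> i \<and> l' \<le> l \<and> s = of_int i \<and> t = of_int l \<and> ((i', l') = (i - 1, l) \<or> (i', l') = (i, l - 1))))"
    if r: "r \<in> tri k u" "r \<in> tri k v" for r
  proof -
    from r(1) obtain s t where st: "r = pt s t" "of_int i \<le> s / 2 ^ k \<and> of_int l \<le> t / 2 ^ k \<and> s / 2 ^ k + t / 2 ^ k \<le> of_int i + of_int l + 1"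
      unfolding u tri_cell by blast
    moreover from r(2) have "of_int i' \<le> s / 2 ^ k \<and> of_int l' \<le> t / 2 ^ k \<and> s / 2 ^ k + t / 2 ^ k \<le> of_int i' + of_int l' + 1"
      unfolding v tri_cell st(1) by auto
    moreover have "r = pt (2 ^ k * (s / 2 ^ k)) (2 ^ k * (t / 2 ^ k))" by (simp add: st(1))
    ultimately show ?thesis using triangles_meet[of i "s / 2 ^ k" l "t / 2 ^ k" i' l'] ne by blast
  qed
  show "p \<in> corners k u" using key[OF assms(4,5)] by (auto simp: u corners_cell)
  show "p \<in> corners k v" using key[OF assms(4,5)] by (auto simp: v corners_cell)
  assume q: "q \<in> tri k u" "q \<in> tri k v"
  show "q = p" using key[OF assms(4,5)] key[OF q] by auto
qed

lemma gasket_verticesI: "v \<in> cells k \<Longrightarrow> p \<in> corners k v \<Longrightarrow> p \<in> gasket_vertices k"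
  by (auto simp: gasket_vertices_eq)

lemma gasket_vertices_tri:
  assumes "v \<in> cells k" "p \<in> tri k v" "p \<in> gasket_vertices k"
  shows "p \<in> corners k v"
proof -
  obtain u where u: "u \<in> cells k" "p \<in> corners k u" using assms(3) by (auto simp: gasket_vertices_eq)
  have "p \<in> tri k u" using u(2) corners_subset_tri by blast
  then show ?thesis
    using tri_Int_tri(2)[OF u(1) assms(1) _ _ assms(2)] u(2) by (cases "u = v") simp_all
qed

definition adj :: "nat \<Rightarrow> point \<Rightarrow> point \<Rightarrow> bool" where
  "adj k p q \<longleftrightarrow> {p, q} \<in> gasket_edges k"

lemma adj_iff: "adj k p q \<longleftrightarrow> p \<noteq> q \<and> (\<exists>v\<in>cells k. p \<in> corners k v \<and> q \<in> corners k v)"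
proof -
  have n: "v \<noteq> v + apex k" "v \<noteq> v + corner k" "v + apex k \<noteq> v + corner k" for v
    using apex_eq_pt[of k] corner_eq_pt[of k] by (simp_all add: zero_eq_pt)
  have "{p, q} \<in> sides k v \<longleftrightarrow> p \<noteq> q \<and> p \<in> corners k v \<and> q \<in> corners k v" for v
    unfolding sides_def corners_def using n[of v] by (auto simp: doubleton_eq_iff)
  then show ?thesis by (auto simp: adj_def gasket_edges_eq)
qed

lemma adj_vertices: "adj k p q \<Longrightarrow> p \<in> gasket_vertices k \<and> q \<in> gasket_vertices k"
  by (auto simp: adj_iff gasket_vertices_eq)

lemma corners_inj:
  assumes "u \<in> cells k" "v \<in> cells k" "p \<in> corners k u" "q \<in> corners k u" "p \<in> corners k v" "q \<in> corners k v" "p \<noteq> q"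
  shows "u = v"
proof (rule ccontr)
  assume "u \<noteq> v"
  moreover have "p \<in> tri k u" "p \<in> tri k v" "q \<in> tri k u" "q \<in> tri k v"
    using assms(3-6) corners_subset_tri by blast+
  ultimately show False
    using tri_Int_tri(3)[OF assms(1,2)] assms(7) by simp
qed

lemma triangles_eq: "triangles k = tri k ` cells k"
proof -
  have "v \<in> cells k" if sub: "sides k v \<subseteq> gasket_edges k" for v
  proof -
    have "adj k v (v + apex k)"
      using sub by (auto simp: sides_def adj_def)
    then obtain u where u: "u \<in> cells k" "v \<in> corners k u" "v + apex k \<in> corners k u" unfolding adj_iff by blast
    then obtain i l where "u = pt (2 ^ k * of_int i) (2 ^ k * of_int l)" by (meson cells_E)
    with u(2,3) have "u = v" by (auto simp: corners_def apex_eq_pt corner_eq_pt pt_add)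
    then show "v \<in> cells k" using u by simp
  qed
  moreover have "sides k v \<subseteq> gasket_edges k \<and> corners k v \<subseteq> gasket_vertices k" if "v \<in> cells k" for v
    using that unfolding gasket_edges_eq gasket_vertices_eq by blast
  ultimately have "corners k v \<subseteq> gasket_vertices k \<and> sides k v \<subseteq> gasket_edges k \<longleftrightarrow> v \<in> cells k" for v by blast
  then show ?thesis
    unfolding triangles_def tri_def[symmetric] sides_def[symmetric] corners_def[symmetric] by blast
qed

lemma triangle_through_eq:
  assumes "v \<in> cells k" "p \<in> corners k v" "q \<in> corners k v" "p \<noteq> q"
  shows "triangle_through k p q = tri k v"
  unfolding triangle_through_def triangles_eq
proof (rule the_equality)
  show "tri k v \<in> tri k ` cells k \<and> p \<in> tri k v \<and> q \<in> tri k v"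
    using assms corners_subset_tri by blast
  fix D assume "D \<in> tri k ` cells k \<and> p \<in> D \<and> q \<in> D"
  then obtain u where "u \<in> cells k" "D = tri k u" "p \<in> tri k u" "q \<in> tri k u" by blast
  then show "D = tri k v"
    using tri_Int_tri(3)[of u k v q p] assms corners_subset_tri by (cases "u = v") blast+
qed

lemma mid_corner: "p + apex (Suc k) = p + apex k + apex k" "p + corner (Suc k) = p + corner k + corner k"
  by (simp_all add: apex_def corner_def flip: scaleR_add_left)

lemma subcells:
  assumes "v \<in> cells (Suc k)"
  shows "v \<in> cells k" "v + apex k \<in> cells k" "v + corner k \<in> cells k"
proof -
  obtain i l where v: "v = pt (2 ^ Suc k * of_int i) (2 ^ Suc k * of_int l)" and c: "cell i l"
    using assms by (rule cells_E)
  have I: "cell i' l' \<Longrightarrow> pt (2 ^ k * of_int i') (2 ^ k * of_int l') \<in> cells k" for i' l'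
    by (auto simp: cells_def)
  show "v \<in> cells k" "v + apex k \<in> cells k" "v + corner k \<in> cells k"
    using I[OF cell.low[OF c]] I[OF cell.top[OF c]] I[OF cell.far[OF c]]
    by (simp_all add: v pt_scale pt_add apex_eq_pt corner_eq_pt algebra_simps)
qed

text \<open>Dividing the lattice coordinates by 2 gives the containing triangle.\<close>

lemma parent_cell:
  assumes "u \<in> cells k"
  obtains v where "v \<in> cells (Suc k)" "tri k u \<subseteq> tri (Suc k) v"
proof -
  obtain i l where u: "u = pt (2 ^ k * of_int i) (2 ^ k * of_int l)" and c: "cell i l"
    using assms by (rule cells_E)
  from c have c': "cell (i div 2) (l div 2)" "\<not> (odd i \<and> odd l)" by (subst (asm) cell_iff_parent; simp)+
  define a b where "a = i div 2" and "b = l div 2"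
  have ab: "2 * a \<le> i" "2 * b \<le> l" "i + l + 1 \<le> 2 * a + 2 * b + 2"
    using c'(2) unfolding a_def b_def by presburger+
  have ab': "2 * real_of_int a \<le> of_int i" "2 * real_of_int b \<le> of_int l"
     "real_of_int i + of_int l + 1 \<le> 2 * of_int a + 2 * of_int b + 2"
    using ab by linarith+
  have "tri k u \<subseteq> tri (Suc k) (pt (2 ^ Suc k * of_int a) (2 ^ Suc k * of_int b))"
  proof
    fix x assume "x \<in> tri k u"
    then obtain s t where x: "x = pt s t" "of_int i \<le> s / 2 ^ k" "of_int l \<le> t / 2 ^ k"
      "s / 2 ^ k + t / 2 ^ k \<le> of_int i + of_int l + 1" unfolding u tri_cell by blast
    define S T where "S = s / 2 ^ k" and "T = t / 2 ^ k"
    have "s / 2 ^ Suc k = S / 2" "t / 2 ^ Suc k = T / 2" by (simp_all add: S_def T_def)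
    moreover have "of_int a \<le> S / 2" "of_int b \<le> T / 2" "S / 2 + T / 2 \<le> of_int a + of_int b + 1"
      using x(2-4)[folded S_def T_def] ab' by linarith+
    ultimately have "of_int a \<le> s / 2 ^ Suc k" "of_int b \<le> t / 2 ^ Suc k"
      "s / 2 ^ Suc k + t / 2 ^ Suc k \<le> of_int a + of_int b + 1" by simp_all
    then show "x \<in> tri (Suc k) (pt (2 ^ Suc k * of_int a) (2 ^ Suc k * of_int b))"
      unfolding tri_cell x(1) by blast
  qed
  moreover have "pt (2 ^ Suc k * of_int a) (2 ^ Suc k * of_int b) \<in> cells (Suc k)"
    using c'(1) unfolding a_def b_def cells_def by blast
  ultimately show ?thesis using that by blast
qed

lemma ancestor_cell:
  assumes "j \<le> k" "u \<in> cells j"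
  shows "\<exists>v\<in>cells k. tri j u \<subseteq> tri k v"
  using assms(1)
proof (induction k rule: dec_induct)
  case base
  then show ?case using assms(2) by blast
next
  case (step n)
  then show ?case by (meson parent_cell order_trans)
qed

lemma gasket_vertices_Suc: "gasket_vertices (Suc k) \<subseteq> gasket_vertices k"
proof
  fix p assume "p \<in> gasket_vertices (Suc k)"
  then obtain v where v: "v \<in> cells (Suc k)" "p \<in> corners (Suc k) v" by (auto simp: gasket_vertices_eq)
  then consider "p = v" | "p = v + apex k + apex k" | "p = v + corner k + corner k"
    by (auto simp: corners_def mid_corner)
  then show "p \<in> gasket_vertices k"
    using subcells[OF v(1)] gasket_verticesI[of v k p] gasket_verticesI[of "v + apex k" k p]
      gasket_verticesI[of "v + corner k" k p]
    by cases (simp_all add: corners_def)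
qed

text \<open>An edge of a finer scale stays inside one triangle of the coarser scale; this is why a
  path can change triangles only at corners.\<close>

lemma adj_in_tri: "j \<le> k \<Longrightarrow> adj j p q \<Longrightarrow> \<exists>v\<in>cells k. p \<in> tri k v \<and> q \<in> tri k v"
  by (meson adj_iff ancestor_cell corners_subset_tri subsetD)

lemma two_cells:
  assumes "p \<in> gasket_vertices k"
  obtains u v where "u \<noteq> v" "{w \<in> cells k. p \<in> corners k w} = {u, v}"
proof -
  obtain w i l where w: "w \<in> cells k" "p \<in> corners k w" "w = pt (2 ^ k * of_int i) (2 ^ k * of_int l)" "cell i l"
    using assms unfolding gasket_vertices_eq by (fastforce elim: cells_E)
  then obtain a b where p: "p = pt (2 ^ k * of_int a) (2 ^ k * of_int b)"
    and c: "cell a b \<or> cell (a - 1) b \<or> cell a (b - 1)"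
  proof -
    have "(p = pt (2 ^ k * of_int i) (2 ^ k * of_int l)) \<or> (p = pt (2 ^ k * of_int (i + 1)) (2 ^ k * of_int l)) \<or>
      (p = pt (2 ^ k * of_int i) (2 ^ k * of_int (l + 1)))"
      using w(2) unfolding w(3) corners_cell by blast
    then show thesis
      using w(4) that[of i l] that[of "i + 1" l] that[of i "l + 1"] by auto
  qed
  let ?c = "\<lambda>i l. pt (2 ^ k * of_int i) (2 ^ k * of_int l)"
  have mem: "?c i l \<in> cells k \<longleftrightarrow> cell i l" for i l by (auto simp: cells_def)
  have "w \<in> cells k \<and> p \<in> corners k w \<longleftrightarrow> (w = ?c a b \<and> cell a b) \<or> (w = ?c (a - 1) b \<and> cell (a - 1) b) \<or>
      (w = ?c a (b - 1) \<and> cell a (b - 1))" for w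
  proof
    assume "w \<in> cells k \<and> p \<in> corners k w"
    moreover from this obtain i l where "w = ?c i l" "cell i l" by (meson cells_E)
    ultimately show "(w = ?c a b \<and> cell a b) \<or> (w = ?c (a - 1) b \<and> cell (a - 1) b) \<or>
      (w = ?c a (b - 1) \<and> cell a (b - 1))" unfolding p by (auto simp: corners_cell simp del: of_int_add)
  next
    assume "(w = ?c a b \<and> cell a b) \<or> (w = ?c (a - 1) b \<and> cell (a - 1) b) \<or>
      (w = ?c a (b - 1) \<and> cell a (b - 1))"
    then show "w \<in> cells k \<and> p \<in> corners k w"
      unfolding p using mem[of a b] mem[of "a - 1" b] mem[of a "b - 1"]
        corners_cell[of k a b] corners_cell[of k "a - 1" b] corners_cell[of k a "b - 1"]
      by (elim disjE) simp_all
  qed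
  then have S: "{w \<in> cells k. p \<in> corners k w} = {w. (w = ?c a b \<and> cell a b) \<or> (w = ?c (a - 1) b \<and> cell (a - 1) b) \<or>
      (w = ?c a (b - 1) \<and> cell a (b - 1))}" by blast
  have ne: "?c a b \<noteq> ?c (a - 1) b" "?c a b \<noteq> ?c a (b - 1)" "?c (a - 1) b \<noteq> ?c a (b - 1)" by auto
  from cell_two[OF c] show ?thesis
  proof (elim disjE)
    assume *: "cell a b \<and> cell (a - 1) b \<and> \<not> cell a (b - 1)"
    show ?thesis by (rule that[OF ne(1)], unfold S) (use * in blast)
  next
    assume *: "cell a b \<and> \<not> cell (a - 1) b \<and> cell a (b - 1)"
    show ?thesis by (rule that[OF ne(2)], unfold S) (use * in blast)
  next
    assume *: "\<not> cell a b \<and> cell (a - 1) b \<and> cell a (b - 1)"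
    show ?thesis by (rule that[OF ne(3)], unfold S) (use * in blast)
  qed
qed

section \<open>Paths as lists of coarse steps\<close>

text \<open>A step is stored without its starting point \<open>c\<close>, so that the steps of a
  path can be concatenated. It may revisit \<open>c\<close> on the way.\<close>

definition is_step :: "nat \<Rightarrow> point \<Rightarrow> path \<Rightarrow> bool" where
  "is_step k c t \<longleftrightarrow> t \<noteq> [] \<and> last t \<in> gasket_vertices k \<and> last t \<noteq> c \<and> set (butlast t) \<inter> gasket_vertices k \<subseteq> {c}"

text \<open>\<open>steps k x ts\<close> says that \<open>ts\<close> is the decomposition of the path
  \<open>x # concat ts\<close> at its hitting times of scale \<open>k\<close>, and that the path
  ends at such a time. Working with lists of steps replaces all index computations with hitting
  times by list operations.\<close>

fun steps :: "nat \<Rightarrow> point \<Rightarrow> path list \<Rightarrow> bool" where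
  "steps k x [] \<longleftrightarrow> True"
| "steps k x (t # ts) \<longleftrightarrow> is_step k x t \<and> steps k (last t) ts"

text \<open>The coarse path \<open>c\<^sub>0, \<dots>, c\<^sub>m\<close>.\<close>

abbreviation skel :: "point \<Rightarrow> path list \<Rightarrow> point list" where
  "skel x ts \<equiv> x # map last ts"

lemma steps_append: "steps k x (ts @ us) \<longleftrightarrow> steps k x ts \<and> steps k (last (skel x ts)) us"
  by (induction ts arbitrary: x) auto

lemma steps_nonempty: "steps k x ts \<Longrightarrow> t \<in> set ts \<Longrightarrow> t \<noteq> []"
proof (induction ts arbitrary: x)
  case (Cons u ts)
  then show ?case using Cons.IH[of "last u"] by (auto simp: is_step_def)
qed simp

lemma last_skel: "steps k x ts \<Longrightarrow> last (skel x ts) = last (x # concat ts)"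
  by (induction ts arbitrary: x) (auto simp: is_step_def)

lemma steps_nth: "steps k x ts \<Longrightarrow> i < length ts \<Longrightarrow> is_step k (skel x ts ! i) (ts ! i)"
  by (induction ts arbitrary: x i) (auto simp: nth_Cons split: nat.splits)

lemma skel_nth_conv: "i \<le> length ts \<Longrightarrow> skel x ts ! i = last (skel x (take i ts))"
  by (induction ts arbitrary: x i) (auto simp: nth_Cons split: nat.splits)

lemma nth_length_last: "(x # a @ b) ! length a = last (x # a)"
  by (cases a rule: rev_cases) (auto simp: nth_append)

text \<open>The next hitting time after a prefix that ends at \<open>c\<close> is the end of the
  following step.\<close>

lemma next_hit:
  assumes "is_step k c t" "c = last (x # pre)" "w = x # pre @ t @ post"
  shows "Inf (enat ` {j. length pre < j \<and> j \<le> path_length w \<and> w ! j \<in> gasket_vertices k - {w ! length pre}})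
    = enat (length pre + length t)"
proof -
  have wc: "w ! length pre = c"
    by (simp only: assms(2,3) nth_length_last)
  have t: "t \<noteq> []" using assms(1) by (simp add: is_step_def)
  have wt: "w ! (length pre + Suc r) = t ! r" if "r < length t" for r
    using that assms(3) by (simp add: nth_append)
  let ?S = "{j. length pre < j \<and> j \<le> path_length w \<and> w ! j \<in> gasket_vertices k - {w ! length pre}}"
  have mem: "length pre + length t \<in> ?S"
  proof -
    have "w ! (length pre + length t) = last t"
      using wt[of "length t - 1"] t by (simp add: last_conv_nth)
    then show ?thesis unfolding wc using t assms(1,3) by (simp add: path_length_def is_step_def)
  qed
  have low: "length pre + length t \<le> j" if "j \<in> ?S" for j
  proof (rule ccontr)
    assume "\<not> ?thesis"
    then obtain r where r: "j = length pre + Suc r" "Suc r < length t"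
      using \<open>j \<in> ?S\<close> by (metis (no_types, lifting) add_Suc_right less_imp_Suc_add mem_Collect_eq nat_add_left_cancel_less not_le)
    then have "w ! j = butlast t ! r" "butlast t ! r \<in> set (butlast t)"
      using wt[of r] nth_mem[of r "butlast t"] by (simp_all add: nth_butlast)
    then show False using \<open>j \<in> ?S\<close> assms(1) wc by (auto simp: is_step_def)
  qed
  show ?thesis
    by (rule antisym; intro Inf_lower Inf_greatest) (use mem low in auto)
qed

lemma hit_steps:
  assumes "steps k x ts" "i \<le> length ts"
  shows "hit k (x # concat ts) i = enat (length (concat (take i ts)))"
  using assms(2)
proof (induction i)
  case 0
  then show ?case by (simp add: zero_enat_def)
next
  case (Suc i)
  let ?pre = "concat (take i ts)"
  have w: "x # concat ts = x # ?pre @ ts ! i @ concat (drop (Suc i) ts)"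
    using Suc.prems by (subst id_take_nth_drop[of i ts]) auto
  have c: "is_step k (last (x # ?pre)) (ts ! i)"
    using steps_nth[OF assms(1), of i] Suc.prems assms(1) skel_nth_conv[of i ts x]
      last_skel[of k x "take i ts"] steps_append[of k x "take i ts" "drop i ts"]
    by auto
  have "concat (take (Suc i) ts) = ?pre @ ts ! i"
    using Suc.prems by (simp add: take_Suc_conv_app_nth)
  then show ?case
    using Suc next_hit[OF c refl w] by simp
qed

lemma hit_steps_end:
  assumes "steps k x ts"
  shows "hit k (x # concat ts) (Suc (length ts)) = \<infinity>"
proof -
  have "{j. length (concat ts) < j \<and> j \<le> path_length (x # concat ts) \<and> P j} = {}" for P
    by (auto simp: path_length_def)
  then have "hit k (x # concat ts) (Suc (length ts)) = Inf (enat ` {})"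
    using hit_steps[OF assms order.refl] by (simp only: hit.simps enat.case take_all[OF order.refl])
  then show ?thesis by (simp add: top_enat_def)
qed

lemma num_hits_steps:
  assumes "steps k x ts"
  shows "num_hits k (x # concat ts) = length ts"
  unfolding num_hits_def
proof (rule Least_equality)
  fix m assume *: "hit k (x # concat ts) (Suc m) = \<infinity>"
  show "length ts \<le> m"
  proof (rule ccontr)
    assume "\<not> length ts \<le> m"
    then have "Suc m \<le> length ts" by simp
    then show False using * hit_steps[OF assms, of "Suc m"] by simp
  qed
qed (rule hit_steps_end[OF assms])

lemma hit_time_steps:
  "steps k x ts \<Longrightarrow> i \<le> length ts \<Longrightarrow> hit_time k (x # concat ts) i = length (concat (take i ts))"
  by (simp add: hit_time_def hit_steps)

lemma concat_nth_last:
  assumes "steps k x ts" "i \<le> length ts"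
  shows "(x # concat ts) ! length (concat (take i ts)) = skel x ts ! i"
proof -
  have "x # concat ts = x # concat (take i ts) @ concat (drop i ts)"
    by (metis append_take_drop_id concat_append)
  then have "(x # concat ts) ! length (concat (take i ts)) = last (x # concat (take i ts))"
    by (simp only: nth_length_last)
  also have "\<dots> = last (skel x (take i ts))"
    using assms(1) last_skel[of k x "take i ts"] steps_append[of k x "take i ts" "drop i ts"] by simp
  finally show ?thesis using assms(2) by (simp add: skel_nth_conv)
qed

lemma hit_point_steps:
  "steps k x ts \<Longrightarrow> i \<le> length ts \<Longrightarrow> hit_point k (x # concat ts) i = skel x ts ! i"
  by (simp add: hit_point_def hit_time_steps concat_nth_last)

lemma segment_steps:
  assumes "steps k x ts" "i \<le> j" "j \<le> length ts"
  shows "segment (x # concat ts) (length (concat (take i ts))) (length (concat (take j ts)))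
    = (skel x ts ! i) # concat (take (j - i) (drop i ts))"
proof -
  let ?a = "concat (take i ts)" and ?b = "concat (take (j - i) (drop i ts))" and ?d = "concat (drop j ts)"
  have e: "concat (take j ts) = ?a @ ?b" "x # concat ts = x # ?a @ ?b @ ?d"
    using assms(2,3) by (metis append_take_drop_id concat_append drop_drop le_add_diff_inverse2 take_add add.commute)+
  have "drop (length ?a) (x # ?a @ ?b @ ?d) = last (x # ?a) # ?b @ ?d"
    by (cases ?a rule: rev_cases) (simp_all del: concat_eq_Nil_conv)
  moreover have "last (x # ?a) = skel x ts ! i"
    using assms last_skel[of k x "take i ts"] steps_append[of k x "take i ts" "drop i ts"]
      skel_nth_conv[of i ts x] by simp
  ultimately show ?thesis unfolding segment_def e by simp
qed

text \<open>A path whose last point is a vertex of scale \<open>k\<close>, visited only once, can be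
  cut into steps.\<close>

lemma steps_exist:
  assumes "t \<noteq> []" "last t \<in> gasket_vertices k" "last t \<notin> insert x (set (butlast t))"
  shows "\<exists>ts. steps k x ts \<and> concat ts = t"
  using assms
proof (induction "length t" arbitrary: t x rule: less_induct)
  case less
  let ?P = "\<lambda>p. p \<in> gasket_vertices k - {x}"
  have "last t \<in> set t" "?P (last t)" using less.prems by auto
  then obtain a p b where t: "t = a @ p # b" "?P p" "\<forall>q\<in>set a. \<not> ?P q"
    using split_list_first_prop[of t ?P] by blast
  have s: "is_step k x (a @ [p])" using t by (auto simp: is_step_def)
  show ?case
  proof (cases "b = []")
    case True
    then show ?thesis using s t by (intro exI[of _ "[a @ [p]]"]) simp
  next
    case False
    then have "\<exists>ts. steps k p ts \<and> concat ts = b"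
      using less.prems t by (intro less.hyps) (auto simp: butlast_append)
    then obtain ts where "steps k p ts" "concat ts = b" by blast
    then show ?thesis using s t by (intro exI[of _ "(a @ [p]) # ts"]) simp
  qed
qed

lemma is_step_prefix:
  assumes "is_step k x t" "is_step k x u" "t @ a = u @ b"
  shows "t = u"
proof -
  have *: "\<not> length t < length u" if t: "is_step k x t" "is_step k x u" "t @ a = u @ b" for t u a b
  proof
    assume l: "length t < length u"
    then have "t = take (length t) (butlast u)"
      using t(3) by (metis append_eq_append_conv_if append_take_drop_id butlast_conv_take diff_Suc_1 less_imp_le less_Suc_eq_le min.absorb1 take_take Suc_pred length_greater_0_conv list.size(3) not_less_zero)
    then have "last t \<in> set (butlast u)" using t(1) by (metis in_set_takeD is_step_def last_in_set)
    then show False using t by (auto simp: is_step_def)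
  qed
  from *[OF assms] *[OF assms(2,1) assms(3)[symmetric]] have "length t = length u" by simp
  with assms(3) show ?thesis by simp
qed

lemma steps_unique:
  "steps k x ts \<Longrightarrow> steps k x us \<Longrightarrow> concat ts = concat us \<Longrightarrow> ts = us"
proof (induction ts arbitrary: x us)
  case Nil
  then show ?case by (cases us) (auto simp: is_step_def)
next
  case (Cons t ts)
  then obtain u us' where us: "us = u # us'" by (cases us) (auto simp: is_step_def)
  with Cons.prems have "t = u" using is_step_prefix[of k x t u "concat ts" "concat us'"] by simp
  moreover have "ts = us'"
    using Cons.IH[of "last t" us'] Cons.prems us \<open>t = u\<close> by simp
  ultimately show ?case using us by simp
qed

section \<open>Chronological loop erasure of a list of steps\<close>

text \<open>The steps after the last visit of the coarse path to \<open>x\<close>.\<close>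

definition after :: "point \<Rightarrow> path list \<Rightarrow> path list" where
  "after x ts = rev (takeWhile (\<lambda>t. last t \<noteq> x) (rev ts))"

lemma length_after: "length (after x ts) \<le> length ts"
  by (simp add: after_def) (metis length_rev length_takeWhile_le)

text \<open>Chronological loop erasure of the coarse path, in the form that keeps the last departure
  from each surviving point, with the fine structure of the surviving steps.\<close>

function erase_loops :: "point \<Rightarrow> path list \<Rightarrow> path list" where
  "erase_loops x ts = (case after x ts of [] \<Rightarrow> [] | t # us \<Rightarrow> t # erase_loops (last t) us)"
  by pat_completeness auto
termination
proof (relation "Wellfounded.measure (length \<circ> snd)")
  fix x ts t us assume "after x ts = t # us"
  then show "((last t, us), x, ts) \<in> Wellfounded.measure (length \<circ> snd)"
    using length_after[of x ts] by simp
qed simp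

declare erase_loops.simps [simp del]

lemma after_avoids: "t \<in> set (after x ts) \<Longrightarrow> last t \<noteq> x"
  by (auto simp: after_def dest: set_takeWhileD)

lemma after_split:
  obtains pre where "ts = pre @ after x ts" "pre = [] \<or> last (last pre) = x"
proof -
  let ?P = "\<lambda>t. last t \<noteq> x"
  have "ts = rev (dropWhile ?P (rev ts)) @ after x ts"
    unfolding after_def by (metis rev_append rev_rev_ident takeWhile_dropWhile_id)
  moreover have "dropWhile ?P (rev ts) = [] \<or> last (hd (dropWhile ?P (rev ts))) = x"
    using hd_dropWhile[of ?P "rev ts"] by blast
  ultimately show ?thesis using that by (auto simp: last_rev)
qed

lemma after_eq:
  assumes "pre = [] \<or> last (last pre) = x" "\<forall>t\<in>set us. last t \<noteq> x"
  shows "after x (pre @ us) = us"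
  using assms by (cases pre rule: rev_cases) (auto simp: after_def takeWhile_append takeWhile_eq_all_conv[THEN iffD2])

lemma erase_loops_eq_Nil_iff: "erase_loops x ts = [] \<longleftrightarrow> after x ts = []"
  by (subst erase_loops.simps) (simp split: list.split)

lemma erase_loops_Cons: "after x ts = t # us \<Longrightarrow> erase_loops x ts = t # erase_loops (last t) us"
  by (subst erase_loops.simps) simp

text \<open>The induction follows the last departures: \<open>pre\<close> is the loop part at
  \<open>x\<close> and \<open>t\<close> the step by which \<open>x\<close> is left for good.\<close>

lemma erase_loops_induct [case_names Nil Cons]:
  assumes "\<And>x ts. ts = [] \<or> last (last ts) = x \<Longrightarrow> after x ts = [] \<Longrightarrow> erase_loops x ts = [] \<Longrightarrow> P x ts"
    and "\<And>x pre t us. pre = [] \<or> last (last pre) = x \<Longrightarrow> \<forall>u\<in>set (t # us). last u \<noteq> x \<Longrightarrow>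
      after x (pre @ t # us) = t # us \<Longrightarrow>
      erase_loops x (pre @ t # us) = t # erase_loops (last t) us \<Longrightarrow> P (last t) us \<Longrightarrow> P x (pre @ t # us)"
  shows "P x ts"
proof (induction "length ts" arbitrary: x ts rule: less_induct)
  case less
  obtain pre where pre: "ts = pre @ after x ts" "pre = [] \<or> last (last pre) = x" by (rule after_split)
  show ?case
  proof (cases "after x ts")
    case Nil
    then show ?thesis using pre assms(1)[of ts x] by (simp add: erase_loops_eq_Nil_iff)
  next
    case (Cons t us)
    then have ts: "ts = pre @ t # us" using pre by simp
    have "P x (pre @ t # us)"
    proof (rule assms(2)[OF pre(2)])
      show "\<forall>u\<in>set (t # us). last u \<noteq> x" using after_avoids[of _ x ts] Cons by metis
      show "after x (pre @ t # us) = t # us" using Cons ts by simp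
      then show "erase_loops x (pre @ t # us) = t # erase_loops (last t) us" by (rule erase_loops_Cons)
      show "P (last t) us" by (rule less) (simp add: ts)
    qed
    then show ?thesis unfolding ts .
  qed
qed

lemma set_erase_loops: "set (erase_loops x ts) \<subseteq> set ts"
  by (induction x ts rule: erase_loops_induct) auto

lemma distinct_skel_erase_loops: "distinct (skel x (erase_loops x ts))"
proof (induction x ts rule: erase_loops_induct)
  case (Cons x pre t us)
  have "last u \<noteq> x" if "u \<in> set (erase_loops (last t) us)" for u
  proof -
    have "u \<in> set (t # us)" using that set_erase_loops[of "last t" us] by auto
    then show ?thesis using Cons(2) by blast
  qed
  then show ?case using Cons(2,4,5) by auto
qed simp

lemma last_skel_erase_loops: "last (skel x (erase_loops x ts)) = last (skel x ts)"
proof (induction x ts rule: erase_loops_induct)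
  case (Nil x ts)
  then show ?case by (cases ts rule: rev_cases) auto
next
  case (Cons x pre t us)
  then show ?case by (simp split: if_splits)
qed

lemma steps_erase_loops: "steps k x ts \<Longrightarrow> steps k x (erase_loops x ts)"
proof (induction x ts rule: erase_loops_induct)
  case (Cons x pre t us)
  have "last (skel x pre) = x" using Cons(1) by (cases pre rule: rev_cases) auto
  then show ?case using Cons by (simp add: steps_append del: last.simps)
qed simp

definition walk :: "point \<Rightarrow> path list \<Rightarrow> bool" where
  "walk x ts \<longleftrightarrow> successively (adj 0) (x # concat ts)"

lemma walk_Nil [simp]: "walk x []"
  by (simp add: walk_def)

lemma walk_Cons: "t \<noteq> [] \<Longrightarrow> walk x (t # ts) \<longleftrightarrow> successively (adj 0) (x # t) \<and> walk (last t) ts"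
proof (cases "concat ts")
  case Nil
  then show ?thesis by (simp only: walk_def concat.simps append_Nil2 successively.simps simp_thms)
next
  case (Cons p l)
  assume t: "t \<noteq> []"
  have "x # concat (t # ts) = (x # t) @ p # l" "last t # concat ts = last t # p # l"
    using Cons by simp_all
  then show ?thesis unfolding walk_def
    by (simp only: successively_append_iff) (use t in \<open>auto\<close>)
qed

lemma walk_append:
  assumes "steps k x (ts @ us)"
  shows "walk x (ts @ us) \<longleftrightarrow> walk x ts \<and> walk (last (skel x ts)) us"
  using assms
proof (induction ts arbitrary: x)
  case (Cons t ts)
  have "t \<noteq> []" using Cons.prems by (simp add: is_step_def)
  then show ?case using Cons.IH[of "last t"] Cons.prems by (simp add: walk_Cons)
qed simp

lemma walk_erase_loops: "steps k x ts \<Longrightarrow> walk x ts \<Longrightarrow> walk x (erase_loops x ts)"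
proof (induction x ts rule: erase_loops_induct)
  case (Cons x pre t us)
  have "last (skel x pre) = x" using Cons(1) by (cases pre rule: rev_cases) auto
  moreover have "t \<noteq> []" using Cons(6) by (simp add: steps_append is_step_def)
  ultimately show ?case using Cons walk_append[OF Cons(6)]
    by (simp add: walk_Cons steps_append del: last.simps)
qed simp

section \<open>Loop erasure of a path at one scale\<close>

text \<open>The last visit times \<open>\<tau>\<^sub>i\<close> on an abstract coarse path, with the
  final value repeated.\<close>

fun tau :: "point list \<Rightarrow> nat \<Rightarrow> nat" where
  "tau c 0 = Max {j. j < length c \<and> c ! j = c ! 0}"
| "tau c (Suc i) = (if tau c i < length c - 1 then Max {j. j < length c \<and> c ! j = c ! Suc (tau c i)} else length c - 1)"

lemma last_visit_steps:
  assumes "steps k x ts"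
  shows "last_visit k (x # concat ts) i = tau (skel x ts) i"
proof -
  have S: "{j. j \<le> length ts \<and> hit_point k (x # concat ts) j = v} = {j. j < length (skel x ts) \<and> skel x ts ! j = v}" for v
    using hit_point_steps[OF assms] by (auto simp: less_Suc_eq_le)
  show ?thesis
  proof (induction i)
    case 0
    show ?case using S hit_point_steps[OF assms, of 0] by (simp add: num_hits_steps[OF assms])
  next
    case (Suc i)
    have "Suc (tau (skel x ts) i) \<le> length ts" if "tau (skel x ts) i < length ts" using that by simp
    then show ?case using Suc S hit_point_steps[OF assms, of "Suc (tau (skel x ts) i)"]
      by (simp add: num_hits_steps[OF assms] del: nth_Cons_Suc)
  qed
qed

lemma Max_append:
  assumes "v \<in> set c'"
  shows "Max {j. j < length (a @ c') \<and> (a @ c') ! j = v} = length a + Max {j. j < length c' \<and> c' ! j = v}"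
proof -
  let ?S = "{j. j < length c' \<and> c' ! j = v}"
  have fin: "finite ?S" "?S \<noteq> {}" using assms by (auto simp: in_set_conv_nth)
  note M = Max_in[OF fin]
  show ?thesis
  proof (rule Max_eqI)
    fix j assume "j \<in> {j. j < length (a @ c') \<and> (a @ c') ! j = v}"
    then have "j - length a \<in> ?S" if "\<not> j < length a" using that by (auto simp: nth_append)
    then show "j \<le> length a + Max ?S"
    proof (cases "j < length a")
      case False
      with \<open>\<not> j < length a \<Longrightarrow> j - length a \<in> ?S\<close> have "j - length a \<le> Max ?S" by (intro Max_ge fin(1))
      then show ?thesis by linarith
    qed simp
  qed (use M in \<open>auto simp: nth_append\<close>)
qed

lemma tau_bound: "c \<noteq> [] \<Longrightarrow> tau c i \<le> length c - 1"
proof (cases i)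
  case 0
  assume "c \<noteq> []"
  then have "Max {j. j < length c \<and> c ! j = c ! 0} \<in> {j. j < length c \<and> c ! j = c ! 0}"
    by (intro Max_in) auto
  then show ?thesis using 0 by auto
next
  case (Suc i)
  have "Max {j. j < length c \<and> c ! j = c ! Suc (tau c i)} \<in> {j. j < length c \<and> c ! j = c ! Suc (tau c i)}"
    if "tau c i < length c - 1"
    using that by (intro Max_in) (auto intro!: exI[of _ "Suc (tau c i)"])
  then show ?thesis using Suc by auto
qed

text \<open>After the last visit to the starting point the remaining times are those of the
  remaining coarse path. This matches the recursion of \<open>erase_loops\<close>.\<close>

lemma tau_append:
  assumes "length a = Suc (tau (a @ c') 0)" "c' \<noteq> []"
  shows "tau (a @ c') (Suc i) = length a + tau c' i"
proof (induction i)
  case 0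
  have "tau (a @ c') 0 < length (a @ c') - 1" "(a @ c') ! Suc (tau (a @ c') 0) = c' ! 0"
    unfolding assms(1)[symmetric] using assms by (cases c'; simp add: nth_append del: tau.simps)+
  then show ?case using Max_append[of "c' ! 0" c' a] assms(2) by (simp del: tau.simps(1) add: tau.simps(1)[of c'])
next
  case (Suc i)
  show ?case
  proof (cases "tau c' i < length c' - 1")
    case True
    then have "(a @ c') ! Suc (tau (a @ c') (Suc i)) = c' ! Suc (tau c' i)" "c' ! Suc (tau c' i) \<in> set c'"
      unfolding Suc by (auto simp: nth_append)
    then show ?thesis
      using True Max_append[of "c' ! Suc (tau c' i)" c' a] by (simp add: Suc tau.simps(2)[of _ "Suc i"] del: tau.simps(2)) (simp)
  next
    case False
    moreover have "length (a @ c') - 1 = length a + (length c' - 1)" using assms(2) by (cases c') auto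
    ultimately show ?thesis
      by (simp only: tau.simps(2)[of _ "Suc i"] tau.simps(2)[of c' i] Suc add_less_cancel_left if_False)
  qed
qed

lemma erase_loops_eq_map_tau:
  "(\<exists>i. tau (skel x ts) i = length ts) \<and>
   erase_loops x ts = map (\<lambda>i. ts ! tau (skel x ts) i) [0..<(LEAST i. tau (skel x ts) i = length ts)]"
proof (induction x ts rule: erase_loops_induct)
  case (Nil x ts)
  have "skel x ts ! length ts = x" using Nil(1) by (cases ts rule: rev_cases) (auto simp: nth_append)
  then have "Max {j. j < length (skel x ts) \<and> skel x ts ! j = x} = length ts"
    by (intro Max_eqI) auto
  then have "tau (skel x ts) 0 = length ts" by simp
  moreover from this have "(LEAST i. tau (skel x ts) i = length ts) = 0" by (intro Least_equality) auto
  ultimately show ?case using Nil(3) by (intro conjI exI[of _ 0]) (simp_all del: tau.simps)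
next
  case (Cons x pre t us)
  let ?ts = "pre @ t # us" let ?c = "skel x ?ts" let ?c' = "skel (last t) us"
  have split: "?c = skel x pre @ ?c'" by simp
  have last: "skel x pre ! length pre = x" using Cons(1) by (cases pre rule: rev_cases) (auto simp: nth_append)
  have x: "x \<notin> set ?c'" using Cons(2) by auto
  define A where "A = skel x pre"
  have A: "?c = A @ ?c'" "length A = Suc (length pre)" "A ! length pre = x"
    using last by (simp_all add: A_def)
  have "j \<le> length pre" if "j < length ?c" "?c ! j = x" for j
  proof (rule ccontr)
    assume "\<not> j \<le> length pre"
    then have "?c ! j = ?c' ! (j - length A)" "j - length A < length ?c'"
      using that(1) unfolding A(1) by (auto simp: nth_append A(2))
    then show False using x that(2) nth_mem by metis
  qed
  moreover have "?c ! length pre = x" unfolding A(1) nth_append A(2) using A(3) by simp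
  ultimately have "Max {j. j < length ?c \<and> ?c ! j = x} = length pre"
    by (intro Max_eqI) (auto simp del: nth_Cons_Suc)
  then have tau0: "tau ?c 0 = length pre" by simp
  have tauS: "tau ?c (Suc i) = Suc (length pre) + tau ?c' i" for i
    using tau_append[of "skel x pre" ?c' i] tau0 split by simp
  from Cons(5) obtain n where n: "tau ?c' n = length us" by blast
  then have n': "tau ?c (Suc n) = length ?ts" using tauS by simp
  have L: "(LEAST i. tau ?c i = length ?ts) = Suc (LEAST i. tau ?c' i = length us)"
    using Least_Suc[of "\<lambda>i. tau ?c i = length ?ts" "Suc n"] n' tau0 tauS by simp
  have "erase_loops x ?ts = t # map (\<lambda>i. us ! tau ?c' i) [0..<(LEAST i. tau ?c' i = length us)]"
    using Cons(4,5) by simp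
  also have "\<dots> = map (\<lambda>i. ?ts ! tau ?c i) [0..<Suc (LEAST i. tau ?c' i = length us)]"
  proof -
    have "?ts ! tau ?c 0 = t" by (simp only: tau0 nth_append_length)
    moreover have "?ts ! tau ?c (Suc i) = us ! tau ?c' i" for i
      unfolding tauS by (simp only: nth_append) simp
    ultimately show ?thesis
      unfolding upt_conv_Cons[OF zero_less_Suc] list.map map_Suc_upt[symmetric] map_map comp_def by (simp only:)
  qed
  finally show ?case unfolding L by (intro conjI exI[of _ "Suc n"] n')
qed

text \<open>With this lemma the operation \<open>erase\<close> disappears from the rest of the
  argument.\<close>

lemma erase_steps:
  assumes "steps k x ts"
  shows "erase k (x # concat ts) = x # concat (erase_loops x ts)"
proof -
  let ?c = "skel x ts"
  let ?n = "LEAST i. tau ?c i = length ts"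
  have bound: "tau ?c i < length ts" if "i < ?n" for i
    using not_less_Least[OF that] tau_bound[of ?c i] by simp
  have seg: "tl (segment (x # concat ts) (hit_time k (x # concat ts) (tau ?c i)) (hit_time k (x # concat ts) (Suc (tau ?c i))))
      = ts ! tau ?c i" if "i < ?n" for i
    using segment_steps[OF assms, of "tau ?c i" "Suc (tau ?c i)"] bound[OF that]
    by (simp add: hit_time_steps[OF assms] take_Suc_conv_app_nth hd_drop_conv_nth take_Suc del: tau.simps nth_Cons_Suc)
  have "map (\<lambda>i. tl (segment (x # concat ts) (hit_time k (x # concat ts) (tau ?c i)) (hit_time k (x # concat ts) (Suc (tau ?c i)))))
      [0..<?n] = map (\<lambda>i. ts ! tau ?c i) [0..<?n]"
    by (intro map_cong refl seg) simp
  then have "erase k (x # concat ts) = x # concat (map (\<lambda>i. ts ! tau ?c i) [0..<?n])"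
    unfolding erase_def join_paths_def last_visit_steps[OF assms] num_hits_steps[OF assms] map_map comp_def
    by (simp only: nth_Cons_0)
  then show ?thesis using erase_loops_eq_map_tau[of x ts] by simp
qed

section \<open>Exit times and runs of steps inside one triangle\<close>

text \<open>The exit indices read off from the coarse path alone.\<close>

fun exits :: "nat \<Rightarrow> point list \<Rightarrow> nat \<Rightarrow> nat" where
  "exits k c 0 = 0"
| "exits k c (Suc i) = (let J = exits k c i; D = triangle_through k (c ! J) (c ! Suc J);
      Q = (\<lambda>j. Suc j < length c \<and> J < j \<and> c ! Suc j \<notin> D)
    in if \<exists>j. Q j then LEAST j. Q j else length c - 1)"

lemma exits_bound: "c \<noteq> [] \<Longrightarrow> exits k c i \<le> length c - 1"
proof (cases i)
  case (Suc n)
  let ?J = "exits k c n"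
  let ?Q = "\<lambda>j. Suc j < length c \<and> ?J < j \<and> c ! Suc j \<notin> triangle_through k (c ! ?J) (c ! Suc ?J)"
  have "exits k c i = (if \<exists>j. ?Q j then LEAST j. ?Q j else length c - 1)" by (simp only: exits.simps Let_def Suc)
  moreover have "(LEAST j. ?Q j) \<le> length c - 1" if "\<exists>j. ?Q j" using LeastI_ex[OF that] by linarith
  ultimately show ?thesis by simp
qed simp

lemma length_concat_take_mono:
  assumes "steps k x ts" "i \<le> length ts" "j \<le> length ts"
  shows "length (concat (take i ts)) < length (concat (take j ts)) \<longleftrightarrow> i < j"
proof -
  have *: "length (concat (take i ts)) < length (concat (take j ts))" if "i < j" "j \<le> length ts" for i j
  proof -
    have "take j ts = take i ts @ ts ! i # drop (Suc i) (take j ts)"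
      using that id_take_nth_drop[of i "take j ts"] by simp
    moreover have "ts ! i \<noteq> []" using steps_nonempty[OF assms(1)] that by simp
    ultimately show ?thesis by (metis append_Nil2 concat.simps(2) concat_append length_append less_add_same_cancel1 length_greater_0_conv append_is_Nil_conv)
  qed
  show ?thesis using *[of i j] *[of j i] assms by (cases i j rule: linorder_cases) auto
qed

lemma exit_index_steps:
  assumes "steps k x ts"
  shows "exit_index k (x # concat ts) i = exits k (skel x ts) i"
proof (induction i)
  case (Suc i)
  let ?w = "x # concat ts" let ?c = "skel x ts" let ?J = "exits k ?c i"
  have J: "?J \<le> length ts" using exits_bound[of ?c k i] by simp
  have Q: "j < num_hits k ?w \<and> hit_time k ?w j > hit_time k ?w ?J \<and> hit_point k ?w (Suc j) \<notin>
          triangle_through k (hit_point k ?w ?J) (hit_point k ?w (Suc ?J))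
      \<longleftrightarrow> Suc j < length ?c \<and> ?J < j \<and> ?c ! Suc j \<notin> triangle_through k (?c ! ?J) (?c ! Suc ?J)" for j
  proof (cases "j < length ts \<and> ?J < j")
    case True
    then show ?thesis using assms J
      by (simp add: num_hits_steps hit_time_steps hit_point_steps length_concat_take_mono del: exits.simps nth_Cons_Suc)
  next
    case False
    then show ?thesis using assms J
      by (auto simp: num_hits_steps hit_time_steps length_concat_take_mono)
  qed
  have N: "num_hits k ?w = length ?c - 1" using num_hits_steps[OF assms] by simp
  show ?case unfolding exit_index.simps exits.simps Let_def Suc Q by (simp only: N)
qed simp

text \<open>Exit indices after an exit are those of the remaining coarse path, so they can be
  computed run by run.\<close>

lemma exits_append:
  assumes "exits k (a @ c) (Suc 0) = length a" "c \<noteq> []"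
  shows "exits k (a @ c) (Suc i) = length a + exits k c i"
proof (induction i)
  case 0
  then show ?case using assms by simp
next
  case (Suc i)
  let ?J = "exits k c i"
  let ?Q = "\<lambda>J c D j. Suc j < length c \<and> J < j \<and> c ! Suc j \<notin> D"
  have s: "(a @ c) ! (length a + j) = c ! j" for j by (simp add: nth_append)
  define D where "D = triangle_through k (c ! ?J) (c ! Suc ?J)"
  have D: "D = triangle_through k ((a @ c) ! (length a + ?J)) ((a @ c) ! Suc (length a + ?J))"
    unfolding D_def using s[of ?J] s[of "Suc ?J"] by simp
  have Q: "?Q (length a + ?J) (a @ c) D (length a + j) \<longleftrightarrow> ?Q ?J c D j" for j
    using s[of "Suc j"] by auto
  have Q': "?Q (length a + ?J) (a @ c) D j \<Longrightarrow> \<exists>j'. j = length a + j' \<and> ?Q ?J c D j'" for j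
    using Q[of "j - length a"] by (intro exI[of _ "j - length a"]) auto
  have "(if \<exists>j. ?Q (length a + ?J) (a @ c) D j then LEAST j. ?Q (length a + ?J) (a @ c) D j else length (a @ c) - 1)
     = length a + (if \<exists>j. ?Q ?J c D j then LEAST j. ?Q ?J c D j else length c - 1)"
  proof (cases "\<exists>j. ?Q ?J c D j")
    case True
    then have 1: "?Q ?J c D (LEAST j. ?Q ?J c D j)" by (rule LeastI_ex)
    have "(LEAST j. ?Q (length a + ?J) (a @ c) D j) = length a + (LEAST j. ?Q ?J c D j)"
    proof (rule Least_equality)
      show "?Q (length a + ?J) (a @ c) D (length a + (LEAST j. ?Q ?J c D j))" using 1 Q by blast
      fix y assume "?Q (length a + ?J) (a @ c) D y"
      from Q'[OF this] obtain j' where "y = length a + j'" "?Q ?J c D j'" by blast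
      then show "length a + (LEAST j. ?Q ?J c D j) \<le> y" using Least_le[of "?Q ?J c D" j'] by simp
    qed
    moreover have "\<exists>j. ?Q (length a + ?J) (a @ c) D j" using True Q by blast
    ultimately show ?thesis by (simp only: if_P[OF True] if_P)
  next
    case False
    then have "\<not> (\<exists>j. ?Q (length a + ?J) (a @ c) D j)" using Q' by blast
    moreover have "length (a @ c) - 1 = length a + (length c - 1)" using assms(2) by (cases c) auto
    ultimately show ?thesis by (simp only: if_not_P[OF False] if_not_P if_False)
  qed
  then show ?case unfolding exits.simps(2)[of k _ "Suc i"] Suc Let_def exits.simps(2)[of k c i] D_def[symmetric] D[symmetric] .
qed

text \<open>\<open>g\<close> consists of the steps up to the first exit time and \<open>r\<close> of
  the others: the steps in \<open>g\<close> end in the triangle of the first of them, and the first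
  step of \<open>r\<close>, if there is one, does not.\<close>

definition first_run :: "nat \<Rightarrow> point \<Rightarrow> path list \<Rightarrow> path list \<Rightarrow> bool" where
  "first_run k x g r \<longleftrightarrow> g \<noteq> [] \<and> (\<forall>t\<in>set g. last t \<in> triangle_through k x (last (hd g))) \<and>
     (r = [] \<or> last (hd r) \<notin> triangle_through k x (last (hd g)))"

lemma exits_first_run:
  assumes "first_run k x g r"
  shows "exits k (skel x (g @ r)) (Suc 0) = length g"
proof -
  let ?c = "skel x (g @ r)"
  define D where "D = triangle_through k x (last (hd g))"
  have g: "g \<noteq> []" "\<forall>t\<in>set g. last t \<in> D" "r = [] \<or> last (hd r) \<notin> D"
    using assms by (auto simp: first_run_def D_def)
  have c: "?c ! Suc j = last ((g @ r) ! j)" if "j < length (g @ r)" for j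
    using that by (simp only: nth_Cons_Suc nth_map)
  have D': "D = triangle_through k (?c ! 0) (?c ! Suc 0)"
    using c[of 0] g(1) by (simp add: D_def hd_conv_nth nth_append)
  let ?Q = "\<lambda>j. Suc j < length ?c \<and> 0 < j \<and> ?c ! Suc j \<notin> D"
  have low: "length g \<le> j" if "?Q j" for j
    using that c[of j] g(2) by (cases "j < length g") (auto simp: nth_append)
  have E: "exits k ?c (Suc 0) = (if \<exists>j. ?Q j then LEAST j. ?Q j else length ?c - 1)"
    by (simp only: exits.simps Let_def D')
  show ?thesis
  proof (cases "r = []")
    case True
    have "\<not> ?Q j" for j :: nat
    proof
      assume "?Q j"
      with low[OF this] True show False by simp
    qed
    then have "\<not> (\<exists>j. ?Q j)" by blast
    then show ?thesis unfolding E if_not_P[OF \<open>\<not> (\<exists>j. ?Q j)\<close>] using True by simp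
  next
    case False
    then have "?Q (length g)" using g c[of "length g"] by (auto simp: nth_append hd_conv_nth)
    moreover from this have "(LEAST j. ?Q j) = length g" using low by (intro Least_equality)
    ultimately show ?thesis unfolding E by metis
  qed
qed

lemma stopped_first_run:
  assumes "steps k x (g @ r)" "first_run k x g r"
  shows "stopped k (x # concat (g @ r)) = x # concat g"
  using segment_steps[OF assms(1), of 0 "length g"] exits_first_run[OF assms(2)]
  by (simp add: stopped_def exit_time_def exit_index_steps[OF assms(1)] hit_time_steps[OF assms(1)] del: exits.simps concat_append exit_index.simps)

lemma first_run_exists:
  assumes "ts \<noteq> []" "last (hd ts) \<in> triangle_through k x (last (hd ts))"
  obtains g r where "ts = g @ r" "first_run k x g r"
proof -
  let ?P = "\<lambda>t. last t \<in> triangle_through k x (last (hd ts))"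
  have "hd (takeWhile ?P ts) = hd ts" "takeWhile ?P ts \<noteq> []"
    using assms by (cases ts; simp)+
  then have "first_run k x (takeWhile ?P ts) (dropWhile ?P ts)"
    unfolding first_run_def using hd_dropWhile[of ?P ts] by (auto dest: set_takeWhileD)
  then show ?thesis using that[of "takeWhile ?P ts" "dropWhile ?P ts"] by simp
qed

lemma exits_after_run:
  assumes "first_run k x g r" "y = last (skel x g)"
  shows "exits k (skel x (g @ r)) (Suc i) = length g + exits k (skel y r) i"
proof -
  obtain a where a: "skel x g = a @ [y]" using assms(2) by (metis append_butlast_last_id list.distinct(1))
  then have la: "length a = length g" by (metis length_Cons length_append_singleton length_map nat.inject)
  have S: "skel x (g @ r) = a @ skel y r" using a by (metis append.assoc append_Cons append_Nil map_append)
  have "exits k (a @ skel y r) (Suc 0) = length a" using exits_first_run[OF assms(1)] unfolding S la .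
  from exits_append[OF this, of i] show ?thesis unfolding S la by simp
qed

lemma exits_mono_Suc: "c \<noteq> [] \<Longrightarrow> exits k c i \<le> exits k c (Suc i)"
proof -
  assume c: "c \<noteq> []"
  let ?J = "exits k c i"
  let ?Q = "\<lambda>j. Suc j < length c \<and> ?J < j \<and> c ! Suc j \<notin> triangle_through k (c ! ?J) (c ! Suc ?J)"
  have "exits k c (Suc i) = (if \<exists>j. ?Q j then LEAST j. ?Q j else length c - 1)" by (simp only: exits.simps Let_def)
  moreover have "?J \<le> (LEAST j. ?Q j)" if "\<exists>j. ?Q j" using LeastI_ex[OF that] by linarith
  ultimately show ?thesis using exits_bound[OF c, of k i] by simp
qed

lemma num_exits_steps:
  assumes "steps k x ts"
  shows "num_exits k (x # concat ts) = (LEAST i. exits k (skel x ts) i = length ts)"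
  unfolding num_exits_def exit_index_steps[OF assms] num_hits_steps[OF assms] ..

lemma erase_Cons: "erase k (x # w) = x # tl (erase k (x # w))"
  by (simp add: erase_def join_paths_def)

text \<open>Erasure at one scale peels off the first run: it is erased on its own and what follows
  is treated as a path starting at its end.\<close>

lemma erase_level_run:
  assumes st: "steps (Suc k) x (g @ r)" and fr: "first_run (Suc k) x g r" and y: "y = last (skel x g)"
    and reach: "\<exists>i. exits (Suc k) (skel y r) i = length r"
  shows "erase_level k (x # concat (g @ r)) = erase k (x # concat g) @ tl (erase_level k (y # concat r))"
proof -
  let ?w = "x # concat (g @ r)" and ?w' = "y # concat r"
  let ?E = "exits (Suc k) (skel x (g @ r))" and ?E' = "exits (Suc k) (skel y r)"
  have st': "steps (Suc k) y r" using st by (simp add: steps_append y del: last.simps)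
  have S: "segment (z # concat ts) (exit_time (Suc k) (z # concat ts) i) (exit_time (Suc k) (z # concat ts) (Suc i))
      = (skel z ts ! exits (Suc k) (skel z ts) i)
        # concat (take (exits (Suc k) (skel z ts) (Suc i) - exits (Suc k) (skel z ts) i) (drop (exits (Suc k) (skel z ts) i) ts))"
    if ts: "steps (Suc k) z ts" for z ts i
  proof -
    have b: "exits (Suc k) (skel z ts) j \<le> length ts" for j using exits_bound[of "skel z ts" "Suc k" j] by simp
    show ?thesis
      unfolding exit_time_def exit_index_steps[OF ts] hit_time_steps[OF ts b]
      by (rule segment_steps[OF ts exits_mono_Suc b]) simp
  qed
  have E: "?E 0 = 0" "?E (Suc i) = length g + ?E' i" for i
    using exits_after_run[OF fr y] by (simp_all only: exits.simps(1))
  have nth: "skel x (g @ r) ! (length g + i) = skel y r ! i" if "i \<le> length r" for i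
    using skel_nth_conv[of "length g + i" "g @ r" x] skel_nth_conv[of i r y] that by (simp add: y)
  have b': "?E' i \<le> length r" for i using exits_bound[of "skel y r" "Suc k" i] by simp
  let ?F = "\<lambda>i. erase k (segment ?w (exit_time (Suc k) ?w i) (exit_time (Suc k) ?w (Suc i)))"
  let ?F' = "\<lambda>i. erase k (segment ?w' (exit_time (Suc k) ?w' i) (exit_time (Suc k) ?w' (Suc i)))"
  have F0: "?F 0 = erase k (x # concat g)"
    unfolding S[OF st] E exits.simps(1)[of "Suc k" "skel y r"] by simp
  have FS: "?F (Suc i) = ?F' i" for i
    unfolding S[OF st] S[OF st'] E nth[OF b'] by simp
  from reach obtain n where n: "?E' n = length r" by blast
  have "num_exits (Suc k) ?w = Suc (num_exits (Suc k) ?w')"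
  proof -
    have g: "g \<noteq> []" using fr by (simp add: first_run_def)
    have "(LEAST i. ?E i = length (g @ r)) = Suc (LEAST i. ?E (Suc i) = length (g @ r))"
      by (rule Least_Suc[of _ "Suc n"]) (use E n g in simp_all)
    also have "\<dots> = Suc (LEAST i. ?E' i = length r)" unfolding E by simp
    finally show ?thesis unfolding num_exits_steps[OF st] num_exits_steps[OF st'] .
  qed
  then have "erase_level k ?w = x # tl (?F 0) @ concat (map (\<lambda>i. tl (?F (Suc i))) [0..<num_exits (Suc k) ?w'])"
    unfolding erase_level_def join_paths_def
    by (simp only: upt_conv_Cons[OF zero_less_Suc] list.map map_Suc_upt[symmetric] map_map comp_def concat.simps nth_Cons_0)
  also have "\<dots> = ?F 0 @ tl (erase_level k ?w')"
    unfolding FS F0 erase_level_def[of k ?w'] join_paths_def map_map comp_def list.sel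
    by (subst (2) erase_Cons) simp
  finally show ?thesis unfolding F0 .
qed

lemma erase_level_single: "erase_level k [y] = [y]"
proof -
  have "num_exits (Suc k) (y # concat []) = 0"
    unfolding num_exits_steps[OF steps.simps(1)[THEN iffD2, OF TrueI]] by (rule Least_equality) simp_all
  then show ?thesis by (simp add: erase_level_def join_paths_def)
qed

section \<open>Self-avoiding coarse paths are erased triangle by triangle\<close>

lemma corners_in_tri: "p \<in> corners k v \<Longrightarrow> p \<in> tri k v"
  using corners_subset_tri by blast

text \<open>A path that is outside triangle \<open>v\<close>, hence in another triangle
  \<open>v'\<close> that touches \<open>v\<close> only in \<open>p\<close>, and that never returns
  to \<open>p\<close>, cannot reach a vertex of scale \<open>k\<close>: all corners of
  \<open>v'\<close> other than \<open>p\<close> are forbidden by the assumption that only corners of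
  \<open>v\<close> are met.\<close>

lemma other_cell_traps:
  assumes "j \<le> k" "v \<in> cells k" "v' \<in> cells k" "v \<noteq> v'" "p \<in> tri k v" "p \<in> tri k v'"
  shows "q \<in> tri k v' \<Longrightarrow> q \<notin> gasket_vertices k \<Longrightarrow> successively (adj j) (q # c) \<Longrightarrow> p \<notin> set c \<Longrightarrow>
    set c \<inter> gasket_vertices k \<subseteq> corners k v \<Longrightarrow> last (q # c) \<notin> gasket_vertices k"
proof (induction c arbitrary: q)
  case (Cons r c)
  have "adj j q r" using Cons.prems by simp
  then obtain u where u: "u \<in> cells k" "q \<in> tri k u" "r \<in> tri k u" using adj_in_tri[OF assms(1)] by blast
  have "u = v'"
    using tri_Int_tri(1)[OF u(1) assms(3) _ u(2) Cons.prems(1)] gasket_verticesI[OF u(1)] Cons.prems(2) by blast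
  then have r: "r \<in> tri k v'" using u by simp
  have "r \<notin> gasket_vertices k"
  proof
    assume "r \<in> gasket_vertices k"
    then have "r \<in> tri k v" using Cons.prems(5) by (auto intro: corners_in_tri)
    then have "r = p" using tri_Int_tri(3)[OF assms(2,3,4,5,6)] r by blast
    then show False using Cons.prems(4) by simp
  qed
  then show ?case using Cons.IH[of r] Cons.prems r by simp
qed simp

text \<open>The geometric core of locality. If the path left \<open>v\<close>, it would do so
  through a corner \<open>p\<close>; as it is self-avoiding it cannot come back through
  \<open>p\<close>, and \<open>other_cell_traps\<close> keeps it away from its own end
  point.\<close>

lemma stays_in_cell:
  assumes "j \<le> k" "v \<in> cells k"
  shows "p \<in> tri k v \<Longrightarrow> successively (adj j) (p # c) \<Longrightarrow> distinct (p # c) \<Longrightarrow>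
    set (p # c) \<inter> gasket_vertices k \<subseteq> corners k v \<Longrightarrow> last (p # c) \<in> corners k v \<Longrightarrow> set (p # c) \<subseteq> tri k v"
proof (induction c arbitrary: p)
  case (Cons q c)
  have "adj j p q" using Cons.prems by simp
  then obtain u where u: "u \<in> cells k" "p \<in> tri k u" "q \<in> tri k u" using adj_in_tri[OF assms(1)] by blast
  have "q \<in> tri k v"
  proof (rule ccontr)
    assume q: "q \<notin> tri k v"
    then have "v \<noteq> u" using u by blast
    moreover have "q \<notin> gasket_vertices k" using q Cons.prems(4) by (auto intro: corners_in_tri)
    ultimately have "last (q # c) \<notin> gasket_vertices k"
      using other_cell_traps[OF assms(1,2) u(1) _ Cons.prems(1) u(2,3), of c] Cons.prems by (simp del: last.simps) blast
    moreover have "last (q # c) \<in> gasket_vertices k" using Cons.prems(5) gasket_verticesI[OF assms(2)] by simp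
    ultimately show False by blast
  qed
  moreover have "set (q # c) \<subseteq> tri k v" by (rule Cons.IH[OF calculation]) (use Cons.prems in auto)
  ultimately show ?case using Cons.prems(1) by simp
qed simp

text \<open>Until the next vertex other than \<open>x\<close> is hit, the path stays in the
  triangles that have \<open>x\<close> as a corner. The starting point is generalised from
  \<open>x\<close> to a point \<open>q\<close> of one of these triangles for the induction.\<close>

lemma first_hit_adj:
  assumes "x \<in> gasket_vertices k"
  shows "q = x \<or> (q \<notin> gasket_vertices k \<and> (\<exists>v\<in>cells k. q \<in> tri k v \<and> x \<in> corners k v)) \<Longrightarrow>
    successively (adj 0) (q # t) \<Longrightarrow> is_step k x t \<Longrightarrow> adj k x (last t)"
proof (induction t arbitrary: q)
  case (Cons r t)
  have "adj 0 q r" using Cons.prems by simp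
  then obtain u where u: "u \<in> cells k" "q \<in> tri k u" "r \<in> tri k u" using adj_in_tri[of 0 k q r] by auto
  have xu: "x \<in> corners k u"
    using Cons.prems(1)
  proof
    assume "q = x" then show ?thesis using gasket_vertices_tri[OF u(1) _ assms] u(2) by simp
  next
    assume q: "q \<notin> gasket_vertices k \<and> (\<exists>v\<in>cells k. q \<in> tri k v \<and> x \<in> corners k v)"
    then obtain v where v: "v \<in> cells k" "q \<in> tri k v" "x \<in> corners k v" by blast
    have "u = v"
      using tri_Int_tri(1)[OF u(1) v(1) _ u(2) v(2)] gasket_verticesI[OF u(1)] q by blast
    then show ?thesis using v by simp
  qed
  show ?case
  proof (cases "t = []")
    case True
    then have "r \<in> gasket_vertices k" "r \<noteq> x" using Cons.prems(3) by (auto simp: is_step_def)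
    then have "r \<in> corners k u" using gasket_vertices_tri[OF u(1,3)] by simp
    then show ?thesis using True xu u(1) \<open>r \<noteq> x\<close> by (auto simp: adj_iff)
  next
    case False
    then have "r = x \<or> r \<notin> gasket_vertices k" "is_step k x t" using Cons.prems(3) by (auto simp: is_step_def)
    then show ?thesis using Cons.IH[of r] Cons.prems(2) u xu False by auto
  qed
qed (simp add: is_step_def)

lemma step_adj: "x \<in> gasket_vertices k \<Longrightarrow> successively (adj 0) (x # t) \<Longrightarrow> is_step k x t \<Longrightarrow> adj k x (last t)"
  by (rule first_hit_adj) auto

lemma steps_vertex: "steps k x ts \<Longrightarrow> set ts \<noteq> {} \<Longrightarrow> last (skel x ts) \<in> gasket_vertices k"
proof (induction ts arbitrary: x)
  case (Cons t ts)
  then show ?case using Cons.IH[of "last t"] by (cases ts) (auto simp: is_step_def)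
qed simp

lemma steps_skel_adj:
  "x \<in> gasket_vertices k \<Longrightarrow> steps k x ts \<Longrightarrow> walk x ts \<Longrightarrow> successively (adj k) (skel x ts)"
proof (induction ts arbitrary: x)
  case (Cons t ts)
  then have t: "is_step k x t" "t \<noteq> []" by (auto simp: is_step_def)
  then have "adj k x (last t)" using Cons.prems step_adj[of x k t] by (simp add: walk_Cons)
  then show ?case using Cons.IH[of "last t"] Cons.prems t adj_vertices by (auto simp: walk_Cons)
qed simp

lemma steps_vertices: "steps k x ts \<Longrightarrow> set (concat ts) \<inter> gasket_vertices k \<subseteq> set (skel x ts)"
proof (induction ts arbitrary: x)
  case (Cons t ts)
  have t: "is_step k x t" "steps k (last t) ts" using Cons.prems by auto
  then have "set t = insert (last t) (set (butlast t))"
    by (metis append_butlast_last_id is_step_def list.simps(15) rotate1.simps(2) set_rotate1)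
  then show ?case using Cons.IH[OF t(2)] t(1) by (auto simp: is_step_def)
qed simp

lemma skel_subset: "steps k x ts \<Longrightarrow> set (map last ts) \<subseteq> set (concat ts)"
proof
  fix p assume "steps k x ts" "p \<in> set (map last ts)"
  then obtain t where "t \<in> set ts" "p = last t" by auto
  moreover have "t \<noteq> []" using steps_nonempty[OF \<open>steps k x ts\<close> \<open>t \<in> set ts\<close>] .
  ultimately have "t \<in> set ts" "p \<in> set t" by simp_all
  then show "p \<in> set (concat ts)" unfolding set_concat by blast
qed

lemma steps_refine: "steps (Suc k) x ts \<Longrightarrow> \<exists>us. steps k x us \<and> concat us = concat ts"
proof (induction ts arbitrary: x)
  case Nil
  show ?case by (intro exI[of _ "[]"]) simp
next
  case (Cons t ts)
  have t: "is_step (Suc k) x t" "steps (Suc k) (last t) ts" using Cons.prems by auto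
  then have "last t \<in> gasket_vertices k" using gasket_vertices_Suc by (auto simp: is_step_def)
  then obtain us where us: "steps k x us" "concat us = t"
    using steps_exist[of t k x] t(1) by (auto simp: is_step_def)
  obtain us' where us': "steps k (last t) us'" "concat us' = concat ts" using Cons.IH[OF t(2)] by blast
  have "last (skel x us) = last t" using last_skel[OF us(1)] us(2) t(1) by (simp add: is_step_def)
  then show ?case using us us' by (intro exI[of _ "us @ us'"]) (simp add: steps_append del: last.simps)
qed

text \<open>A path whose coarse path of scale \<open>k\<close> is self-avoiding. All results of
  erasure are of this kind, and for such paths the cuts at exit times are respected by the later
  erasures.\<close>

definition good :: "nat \<Rightarrow> point \<Rightarrow> path list \<Rightarrow> bool" where
  "good k x ts \<longleftrightarrow> x \<in> gasket_vertices k \<and> steps k x ts \<and> walk x ts \<and> distinct (skel x ts)"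

lemma steps_end_vertex: "x \<in> gasket_vertices k \<Longrightarrow> steps k x ts \<Longrightarrow> last (skel x ts) \<in> gasket_vertices k"
  using steps_vertex[of k x ts] by (cases ts) auto

lemma good_append:
  assumes "good k x (g @ r)"
  shows "good k x g" "good k (last (skel x g)) r"
proof -
  have s: "steps k x (g @ r)" and x: "x \<in> gasket_vertices k" using assms by (auto simp: good_def)
  have d: "distinct (skel x g @ map last r)" using assms by (simp add: good_def)
  have g: "steps k x g" "steps k (last (skel x g)) r" using s by (simp_all add: steps_append del: last.simps)
  show "good k x g" using assms walk_append[OF s] g d by (auto simp: good_def)
  have "last (skel x g) \<in> set (skel x g)" by (rule last_in_set) simp
  then have "last (skel x g) \<notin> set (map last r)" using d unfolding distinct_append by blast
  then have "distinct (skel (last (skel x g)) r)" using d unfolding distinct_append by simp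
  then show "good k (last (skel x g)) r"
    using assms walk_append[OF s] g steps_end_vertex[OF x g(1)] by (simp add: good_def del: last.simps)
qed

lemma good_Cons_adj: "good k x (t # ts) \<Longrightarrow> adj k x (last t)"
  using steps_skel_adj[of x k "t # ts"] by (simp add: good_def del: steps.simps)

lemma good_nonempty_end: "good k x ts \<Longrightarrow> ts \<noteq> [] \<Longrightarrow> last (skel x ts) \<noteq> x"
  by (cases ts rule: rev_cases) (auto simp: good_def)

lemma triangle_through_vertices:
  "v \<in> cells k \<Longrightarrow> p \<in> gasket_vertices k \<Longrightarrow> p \<in> tri k v \<longleftrightarrow> p \<in> corners k v"
  using gasket_vertices_tri corners_subset_tri by blast

lemma first_run_cell:
  assumes "good k x (g @ r)" "first_run k x g r"
  obtains v where "v \<in> cells k" "set (skel x g) \<subseteq> corners k v" "r = [] \<or> last (hd r) \<notin> tri k v"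
    "triangle_through k x (last (hd g)) = tri k v"
proof -
  obtain t g' where g: "g = t # g'" using assms(2) by (cases g) (auto simp: first_run_def)
  have "adj k x (last t)" using good_Cons_adj[of k x t "g' @ r"] assms(1) g by simp
  then obtain v where v: "v \<in> cells k" "x \<in> corners k v" "last t \<in> corners k v" "x \<noteq> last t" by (auto simp: adj_iff)
  have D: "triangle_through k x (last (hd g)) = tri k v" using triangle_through_eq[OF v] g by simp
  have "last u \<in> corners k v" if "u \<in> set g" for u
  proof -
    have "last u \<in> tri k v" using assms(2) that unfolding first_run_def D by blast
    moreover have "last u \<in> gasket_vertices k"
    proof -
      have "u \<in> set (g @ r)" using that by simp
      then obtain i where i: "i < length (g @ r)" "(g @ r) ! i = u"
        unfolding in_set_conv_nth by blast
      show ?thesis using steps_nth[of k x "g @ r" i] assms(1) i by (simp add: good_def is_step_def)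
    qed
    ultimately show ?thesis using triangle_through_vertices[OF v(1)] by blast
  qed
  then have "set (skel x g) \<subseteq> corners k v" using v(2) by auto
  moreover have "r = [] \<or> last (hd r) \<notin> tri k v" using assms(2) unfolding first_run_def D by blast
  ultimately show ?thesis using that v(1) D by blast
qed

lemma first_run_of_good:
  assumes "good k x ts" "ts \<noteq> []"
  obtains g r where "ts = g @ r" "first_run k x g r"
proof -
  obtain t ts' where ts: "ts = t # ts'" using assms(2) by (cases ts) auto
  then obtain v where v: "v \<in> cells k" "x \<in> corners k v" "last t \<in> corners k v" "x \<noteq> last t"
    using good_Cons_adj[of k x t ts'] assms(1) unfolding adj_iff by blast
  have "last (hd ts) \<in> triangle_through k x (last (hd ts))"
    using triangle_through_eq[OF v] v(3) ts by (auto intro: corners_in_tri)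
  from first_run_exists[OF assms(2) this] that show ?thesis by blast
qed

lemma exits_reach_end: "good k x ts \<Longrightarrow> \<exists>i. exits k (skel x ts) i = length ts"
proof (induction "length ts" arbitrary: x ts rule: less_induct)
  case less
  show ?case
  proof (cases "ts = []")
    case True
    then show ?thesis by (intro exI[of _ 0]) simp
  next
    case False
    then obtain g r where gr: "ts = g @ r" "first_run k x g r" using first_run_of_good less.prems by blast
    have "good k (last (skel x g)) r" using good_append less.prems gr(1) by blast
    moreover have "length r < length ts" using gr by (auto simp: first_run_def)
    ultimately obtain i where "exits k (skel (last (skel x g)) r) i = length r" using less.hyps by blast
    then have "exits k (skel x ts) (Suc i) = length ts"
      unfolding gr(1) using exits_after_run[OF gr(2) refl] by (simp del: exits.simps last.simps map_append)
    then show ?thesis by blast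
  qed
qed

lemma good_erase_level_run:
  assumes "good (Suc k) x (g @ r)" "first_run (Suc k) x g r"
  shows "erase_level k (x # concat (g @ r)) = erase k (x # concat g) @ tl (erase_level k (last (skel x g) # concat r))"
  using erase_level_run[OF _ assms(2) refl exits_reach_end] good_append(2)[OF assms(1)] assms(1)
  by (simp add: good_def del: last.simps)

text \<open>What one erasure does to a self-avoiding coarse path \<open>ts\<close>, in the form
  needed to pass to the next scale. The result \<open>us\<close> is a self-avoiding list of steps of
  scale \<open>k\<close> with the same end points, each point of its coarse path lies in a triangle
  that \<open>ts\<close> crosses in a single step, and \<open>us\<close> starts into the triangle
  into which \<open>ts\<close> starts. The last two conditions are what makes consecutive pieces lie
  in different triangles.\<close>

definition erased_to :: "nat \<Rightarrow> point \<Rightarrow> path list \<Rightarrow> path list \<Rightarrow> bool" where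
  "erased_to k x ts us \<longleftrightarrow> erase_level k (x # concat ts) = x # concat us \<and> good k x us \<and>
     last (skel x us) = last (skel x ts) \<and> set (concat us) \<subseteq> set (concat ts) \<and>
     (\<forall>p\<in>set (map last us). \<exists>v\<in>cells (Suc k). p \<in> tri (Suc k) v \<and>
        (\<exists>i<length ts. skel x ts ! i \<in> corners (Suc k) v \<and> skel x ts ! Suc i \<in> corners (Suc k) v)) \<and>
     (ts \<noteq> [] \<longrightarrow> us \<noteq> [] \<and>
       (\<forall>v\<in>cells (Suc k). x \<in> corners (Suc k) v \<and> last (hd ts) \<in> corners (Suc k) v \<longrightarrow> last (hd us) \<in> tri (Suc k) v))"

lemma erased_to_Nil: "x \<in> gasket_vertices (Suc k) \<Longrightarrow> erased_to k x [] []"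
  using gasket_vertices_Suc by (auto simp: erased_to_def good_def erase_level_single)

text \<open>A single run is erased as a whole, and \<open>stays_in_cell\<close> confines the result
  to the triangle of the run.\<close>

lemma erased_to_single_run:
  assumes "good (Suc k) x g" "first_run (Suc k) x g []"
  shows "\<exists>us. erased_to k x g us"
proof -
  have g: "g \<noteq> []" using assms(2) by (simp add: first_run_def)
  have st: "steps (Suc k) x g" using assms(1) by (simp add: good_def)
  obtain v where v: "v \<in> cells (Suc k)" "set (skel x g) \<subseteq> corners (Suc k) v"
    by (rule first_run_cell[of "Suc k" x g "[]"]) (use assms in simp_all)
  obtain ts where ts: "steps k x ts" "concat ts = concat g" using steps_refine[OF st] by blast
  define us where "us = erase_loops x ts"
  have xk: "x \<in> gasket_vertices k" using assms(1) gasket_vertices_Suc by (auto simp: good_def)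
  have w: "walk x ts" using assms(1) ts(2) by (simp add: good_def walk_def)
  have gd: "good k x us"
    unfolding good_def us_def using xk steps_erase_loops[OF ts(1)] walk_erase_loops[OF ts(1) w] distinct_skel_erase_loops by blast
  have er: "erase_level k (x # concat g) = x # concat us"
    using good_erase_level_run[of k x g "[]"] assms erase_steps[OF ts(1)]
    by (simp add: ts(2) us_def erase_level_single)
  have lst: "last (skel x us) = last (skel x g)"
    unfolding us_def last_skel_erase_loops last_skel[OF ts(1)] ts(2) last_skel[OF st] ..
  have sub: "set (concat us) \<subseteq> set (concat g)"
    using set_erase_loops[of x ts] ts(2) by (auto simp: us_def simp flip: ts(2))
  have ne: "us \<noteq> []"
  proof
    assume "us = []"
    then show False using lst good_nonempty_end[OF assms(1) g] by simp
  qed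
  have stus: "steps k x us" using gd by (simp add: good_def)
  have "set (skel x us) \<subseteq> set (x # concat g)" using skel_subset[OF stus] sub by auto
  moreover have "x \<in> gasket_vertices (Suc k)" using assms(1) by (simp add: good_def)
  ultimately have vs: "set (skel x us) \<inter> gasket_vertices (Suc k) \<subseteq> corners (Suc k) v"
    using steps_vertices[OF st] v(2) by auto
  have "last (skel x g) \<in> set (skel x g)" by (rule last_in_set) simp
  then have "last (skel x us) \<in> corners (Suc k) v" using lst v(2) by auto
  moreover have "x \<in> tri (Suc k) v" using v(2) by (auto intro: corners_in_tri)
  moreover have "successively (adj k) (skel x us)" "distinct (skel x us)"
    using gd steps_skel_adj[OF xk stus] by (auto simp: good_def)
  ultimately have tr: "set (skel x us) \<subseteq> tri (Suc k) v"
    using stays_in_cell[of k "Suc k" v x "map last us"] v(1) vs by simp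
  have c01: "skel x g ! 0 \<in> corners (Suc k) v" "skel x g ! Suc 0 \<in> corners (Suc k) v" "0 < length g"
    using v(2) g by (cases g; simp)+
  have hd: "last (hd us) \<in> tri (Suc k) v" using tr ne by (cases us) auto
  have uniq: "v' = v" if "v' \<in> cells (Suc k)" "x \<in> corners (Suc k) v'" "last (hd g) \<in> corners (Suc k) v'" for v'
  proof -
    have "x \<noteq> last (hd g)" using assms(1) g by (cases g) (auto simp: good_def is_step_def)
    then show ?thesis
      using corners_inj[OF that(1) v(1) that(2,3)] c01 g by (cases g) auto
  qed
  have "erased_to k x g us" unfolding erased_to_def
  proof (intro conjI ballI impI)
    fix p assume "p \<in> set (map last us)"
    then have "p \<in> tri (Suc k) v" using tr by auto
    then show "\<exists>v\<in>cells (Suc k). p \<in> tri (Suc k) v \<and>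
        (\<exists>i<length g. skel x g ! i \<in> corners (Suc k) v \<and> skel x g ! Suc i \<in> corners (Suc k) v)"
      using v(1) c01 by blast
  qed (use er gd lst sub ne hd uniq in auto)
  then show ?thesis by blast
qed

text \<open>No triangle of scale \<open>k\<close> contains both the last step of \<open>g\<close>
  and the first step of \<open>r\<close>, so any path through this point has an exit time here at
  the latest.\<close>

definition breaks :: "nat \<Rightarrow> point \<Rightarrow> path list \<Rightarrow> path list \<Rightarrow> bool" where
  "breaks k x g r \<longleftrightarrow> \<not> (\<exists>v\<in>cells k. last (skel x (butlast g)) \<in> corners k v \<and> last (skel x g) \<in> corners k v \<and>
     last (hd r) \<in> corners k v)"

lemma good_skel_vertices: "good k x ts \<Longrightarrow> set (skel x ts) \<subseteq> gasket_vertices k"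
proof
  fix p assume g: "good k x ts" and "p \<in> set (skel x ts)"
  then consider "p = x" | i where "i < length ts" "p = last (ts ! i)" by (auto simp: in_set_conv_nth)
  then show "p \<in> gasket_vertices k"
    using g steps_nth[of k x ts] by cases (auto simp: good_def is_step_def)
qed

text \<open>The pieces of two consecutive runs lie in different triangles of scale
  \<open>k + 1\<close>. So they meet only in the common end point \<open>y\<close>, which makes the
  concatenation self-avoiding, and \<open>y\<close> is a cut for the triangles of scale
  \<open>k\<close> as well.\<close>

lemma erased_to_join:
  assumes good: "good (Suc k) x (g @ r)" and fr: "first_run (Suc k) x g r" and y: "y = last (skel x g)"
    and eg: "erased_to k x g usg" and er: "erased_to k y r usr"
  shows "erased_to k x (g @ r) (usg @ usr) \<and> (r \<noteq> [] \<longrightarrow> breaks k x usg usr)"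
proof -
  note gg = good_append[OF good, folded y]
  have g: "g \<noteq> []" using fr by (simp add: first_run_def)
  obtain v0 where v0: "v0 \<in> cells (Suc k)" "set (skel x g) \<subseteq> corners (Suc k) v0" "r = [] \<or> last (hd r) \<notin> tri (Suc k) v0"
    by (rule first_run_cell[OF good fr])
  have yg: "y \<in> set (skel x g)" unfolding y by (rule last_in_set) simp
  have xy: "x \<noteq> y" using good_nonempty_end[OF gg(1) g] y by simp
  have dist: "distinct (skel x g @ map last r)" using good by (simp add: good_def)
  have dusg: "good k x usg" and dusr: "good k y usr" using eg er by (auto simp: erased_to_def)
  have lusg: "last (skel x usg) = y" using eg y by (simp add: erased_to_def)
  have usg: "usg \<noteq> []" using eg g by (simp add: erased_to_def)
  \<comment> \<open>If a step of \<open>r\<close> crossed \<open>v0\<close> away from \<open>y\<close>,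
    then \<open>x\<close>, \<open>y\<close> and the two end points of the step would be four different
    corners of \<open>v0\<close>.\<close>
  have other: "\<exists>v1\<in>cells (Suc k). v1 \<noteq> v0 \<and> p \<in> tri (Suc k) v1" if pr: "p \<in> set (map last usr)" for p
  proof -
    obtain v1 i where v1: "v1 \<in> cells (Suc k)" "p \<in> tri (Suc k) v1" "i < length r"
      "skel y r ! i \<in> corners (Suc k) v1" "skel y r ! Suc i \<in> corners (Suc k) v1"
      using er pr unfolding erased_to_def by blast
    have "v1 \<noteq> v0"
    proof
      assume e: "v1 = v0"
      show False
      proof (cases i)
        case 0
        then have "last (hd r) \<in> corners (Suc k) v0" using v1 e by (cases r) auto
        then show False using v0(3) v1(3) by (auto intro: corners_in_tri)
      next
        case (Suc i')
        define c c' where "c = map last r ! i'" and "c' = map last r ! Suc i'"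
        have "c \<in> set (map last r)" "c' \<in> set (map last r)"
          unfolding c_def c'_def using v1(3) Suc by (intro nth_mem; simp)+
        moreover have "distinct (map last r)" using dist unfolding distinct_append by blast
        then have "c \<noteq> c'"
          unfolding c_def c'_def using v1(3) Suc by (subst nth_eq_iff_index_eq) simp_all
        moreover have "set (skel x g) \<inter> set (map last r) = {}" using dist unfolding distinct_append by blast
        moreover have "x \<in> set (skel x g)" by simp
        ultimately have "x \<noteq> c" "x \<noteq> c'" "y \<noteq> c" "y \<noteq> c'" "c \<noteq> c'" using yg by blast+
        then have "card {x, y, c, c'} = 4" using xy by simp
        moreover have "{x, y, c, c'} \<subseteq> corners (Suc k) v0"
        proof -
          have "x \<in> corners (Suc k) v0" "y \<in> corners (Suc k) v0" using v0(2) yg by auto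
          then show ?thesis using v1(4,5) e Suc by (simp add: c_def c'_def)
        qed
        ultimately show False using card_mono[of "corners (Suc k) v0" "{x, y, c, c'}"] by (simp add: card_corners)
      qed
    qed
    then show ?thesis using v1 by blast
  qed
  have inside: "set (skel x usg) \<subseteq> tri (Suc k) v0"
  proof
    fix p assume "p \<in> set (skel x usg)"
    then consider "p = x" | "p \<in> set (map last usg)" by auto
    then show "p \<in> tri (Suc k) v0"
    proof cases
      case 1 then show ?thesis using v0(2) by (auto intro: corners_in_tri)
    next
      case 2
      then obtain v i where v: "v \<in> cells (Suc k)" "p \<in> tri (Suc k) v" "i < length g"
        "skel x g ! i \<in> corners (Suc k) v" "skel x g ! Suc i \<in> corners (Suc k) v"
        using eg unfolding erased_to_def by blast
      have m: "skel x g ! i \<in> set (skel x g)" "skel x g ! Suc i \<in> set (skel x g)"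
        using v(3) by (intro nth_mem; simp)+
      have "distinct (skel x g)" using dist by simp
      then have "skel x g ! i \<noteq> skel x g ! Suc i" using v(3) by (subst nth_eq_iff_index_eq) auto
      then have "v = v0" using corners_inj[OF v(1) v0(1) v(4,5)] m v0(2) by blast
      then show ?thesis using v by simp
    qed
  qed
  have disj: "set (skel x usg) \<inter> set (map last usr) = {}"
  proof (rule ccontr)
    assume "\<not> ?thesis"
    then obtain p where p: "p \<in> set (skel x usg)" "p \<in> set (map last usr)" by blast
    obtain v1 where v1: "v1 \<in> cells (Suc k)" "v1 \<noteq> v0" "p \<in> tri (Suc k) v1" using other p by blast
    have "p \<in> corners (Suc k) v0" using tri_Int_tri(2)[OF v1(1) v0(1) v1(2,3)] inside p by blast
    then have pG: "p \<in> gasket_vertices (Suc k)" using gasket_verticesI[OF v0(1)] by blast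
    have sg: "steps k x usg" "steps k y usr" "steps (Suc k) x g" "steps (Suc k) y r"
      using dusg dusr gg by (auto simp: good_def)
    have "p \<in> set (x # concat g)" using p(1) skel_subset[OF sg(1)] eg unfolding erased_to_def by auto
    then have 1: "p \<in> set (skel x g)" using steps_vertices[OF sg(3)] pG by auto
    have "p \<in> set (concat r)" using p(2) skel_subset[OF sg(2)] er unfolding erased_to_def by blast
    then have "p \<in> set (skel y r)" using steps_vertices[OF sg(4)] pG by auto
    moreover have "p \<noteq> y" using p(2) dusr by (auto simp: good_def)
    ultimately have "p \<in> set (map last r)" by simp
    then show False using 1 dist by auto
  qed
  have G: "good k x (usg @ usr)"
  proof -
    have s: "steps k x (usg @ usr)" using dusg dusr by (simp add: good_def steps_append lusg del: last.simps)
    show ?thesis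
      using s walk_append[OF s] dusg dusr disj unfolding good_def lusg by auto
  qed
  have lr: "last (skel x (g @ r)) = last (skel y r)" "last (skel x (usg @ usr)) = last (skel y usr)"
    using y lusg by auto
  have nth: "skel x (g @ r) ! i = skel x g ! i" if "i \<le> length g" for i
    using skel_nth_conv[of i "g @ r" x] skel_nth_conv[of i g x] that by simp
  have nth': "skel x (g @ r) ! (length g + i) = skel y r ! i" if "i \<le> length r" for i
    using skel_nth_conv[of "length g + i" "g @ r" x] skel_nth_conv[of i r y] that by (simp add: y)
  have "erased_to k x (g @ r) (usg @ usr)" unfolding erased_to_def
  proof (intro conjI ballI impI)
    have "erase_level k (x # concat g) = erase k (x # concat g)"
      using good_erase_level_run[of k x g "[]"] gg(1) fr by (simp add: first_run_def erase_level_single)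
    then show "erase_level k (x # concat (g @ r)) = x # concat (usg @ usr)"
      using good_erase_level_run[OF good fr, folded y] eg er by (simp add: erased_to_def)
    show "last (skel x (usg @ usr)) = last (skel x (g @ r))" unfolding lr using er by (simp add: erased_to_def)
    show "set (concat (usg @ usr)) \<subseteq> set (concat (g @ r))" using eg er unfolding erased_to_def by auto
    show "usg @ usr \<noteq> []" using usg by simp
  next
    fix p assume "p \<in> set (map last (usg @ usr))"
    then consider "p \<in> set (map last usg)" | "p \<in> set (map last usr)" by auto
    then show "\<exists>v\<in>cells (Suc k). p \<in> tri (Suc k) v \<and>
        (\<exists>i<length (g @ r). skel x (g @ r) ! i \<in> corners (Suc k) v \<and> skel x (g @ r) ! Suc i \<in> corners (Suc k) v)"
    proof cases
      case 1
      then obtain v i where "v \<in> cells (Suc k)" "p \<in> tri (Suc k) v" "i < length g"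
        "skel x g ! i \<in> corners (Suc k) v" "skel x g ! Suc i \<in> corners (Suc k) v"
        using eg unfolding erased_to_def by blast
      then show ?thesis using nth[of i] nth[of "Suc i"] by (intro bexI[of _ v] conjI exI[of _ i]) auto
    next
      case 2
      then obtain v i where "v \<in> cells (Suc k)" "p \<in> tri (Suc k) v" "i < length r"
        "skel y r ! i \<in> corners (Suc k) v" "skel y r ! Suc i \<in> corners (Suc k) v"
        using er unfolding erased_to_def by blast
      then show ?thesis using nth'[of i] nth'[of "Suc i"] by (intro bexI[of _ v] conjI exI[of _ "length g + i"]) auto
    qed
  next
    fix v assume "v \<in> cells (Suc k)" "x \<in> corners (Suc k) v \<and> last (hd (g @ r)) \<in> corners (Suc k) v"
    then show "last (hd (usg @ usr)) \<in> tri (Suc k) v" using eg g usg unfolding erased_to_def by auto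
  qed (rule G)
  \<comment> \<open>A triangle of scale \<open>k\<close> around \<open>y\<close> with a step on either
    side lies in a triangle \<open>V\<close> of scale \<open>k + 1\<close>. The step before
    \<open>y\<close> forces \<open>V = v0\<close>, while the step after \<open>y\<close> goes into
    another triangle \<open>v1\<close>.\<close>
  moreover have "breaks k x usg usr" if r: "r \<noteq> []"
    unfolding breaks_def
  proof (rule notI, elim bexE conjE)
    fix v assume v: "v \<in> cells k" "last (skel x (butlast usg)) \<in> corners k v" "last (skel x usg) \<in> corners k v"
      "last (hd usr) \<in> corners k v"
    obtain V where V: "V \<in> cells (Suc k)" "tri k v \<subseteq> tri (Suc k) V" using parent_cell[OF v(1)] by blast
    have usr: "usr \<noteq> []" using er r by (simp add: erased_to_def)
    let ?a = "last (skel x (butlast usg))" and ?q = "last (hd usr)"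
    have in_V: "?a \<in> tri (Suc k) V" "y \<in> tri (Suc k) V" "?q \<in> tri (Suc k) V"
      using v(2-4) lusg V(2) corners_subset_tri[of k v] by auto
    have "skel x usg = skel x (butlast usg) @ [y]" using usg lusg by (cases usg rule: rev_cases) auto
    then have "?a \<in> set (skel x usg)" "?a \<noteq> y" "y \<in> set (skel x usg)"
      using dusg last_in_set[of "skel x (butlast usg)"] unfolding good_def by auto
    then have "V = v0" using tri_Int_tri(3)[OF V(1) v0(1) _ in_V(1) _ in_V(2)] inside by blast
    have "adj (Suc k) y (last (hd r))" using good_Cons_adj[of "Suc k" y "hd r" "tl r"] gg(2) r by simp
    then obtain v1 where v1: "v1 \<in> cells (Suc k)" "y \<in> corners (Suc k) v1" "last (hd r) \<in> corners (Suc k) v1"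
      by (auto simp: adj_iff)
    have "v1 \<noteq> v0" using v0(3) r v1(3) corners_subset_tri by blast
    moreover have "?q \<in> tri (Suc k) v1" using er r v1 unfolding erased_to_def by blast
    moreover have "y \<in> tri (Suc k) v1" using v1(2) corners_subset_tri by blast
    ultimately have "?q = y"
      using tri_Int_tri(3)[OF v1(1) v0(1), of y ?q] in_V \<open>V = v0\<close> by blast
    then show False using dusr usr by (cases usr) (auto simp: good_def is_step_def)
  qed
  ultimately show ?thesis by blast
qed

lemma erased_to_exists: "good (Suc k) x ts \<Longrightarrow> \<exists>us. erased_to k x ts us"
proof (induction "length ts" arbitrary: x ts rule: less_induct)
  case less
  show ?case
  proof (cases "ts = []")
    case True
    moreover have "x \<in> gasket_vertices (Suc k)" using less.prems unfolding good_def by blast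
    ultimately show ?thesis using erased_to_Nil by blast
  next
    case False
    then obtain g r where gr: "ts = g @ r" "first_run (Suc k) x g r" using first_run_of_good less.prems by blast
    have gd: "good (Suc k) x g" "good (Suc k) (last (skel x g)) r" using good_append less.prems gr(1) by blast+
    have "first_run (Suc k) x g []" using gr(2) by (simp add: first_run_def)
    then obtain usg where usg: "erased_to k x g usg" using erased_to_single_run[OF gd(1)] by blast
    have "length r < length ts" using gr by (auto simp: first_run_def)
    then obtain usr where "erased_to k (last (skel x g)) r usr" using less.hyps gd(2) by blast
    then show ?thesis using erased_to_join[OF _ gr(2) refl usg] less.prems gr(1) by blast
  qed
qed

section \<open>Locality of the whole loop erasure\<close>

lemma loop_erasure_single: "loop_erasure k [y] = [y]"
  by (induction k) (simp_all add: erase_level_single)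

lemma is_step_0:
  assumes "successively (adj 0) (x # t)" "is_step 0 x t" "x \<in> gasket_vertices 0"
  shows "t = [last t]"
proof (cases t)
  case (Cons q t')
  have "t' = []"
  proof (rule ccontr)
    assume "t' \<noteq> []"
    then have "q \<in> set (butlast t)" using Cons by simp
    moreover have "adj 0 x q" using assms(1) Cons by simp
    ultimately show False using assms(2) adj_vertices[of 0 x q] by (auto simp: is_step_def adj_iff)
  qed
  then show ?thesis using Cons by simp
qed (use assms(2) in \<open>simp add: is_step_def\<close>)

lemma steps_0:
  "x \<in> gasket_vertices 0 \<Longrightarrow> steps 0 x ts \<Longrightarrow> walk x ts \<Longrightarrow> concat ts = map last ts"
proof (induction ts arbitrary: x)
  case (Cons t ts)
  have t: "is_step 0 x t" "t \<noteq> []" "last t \<in> gasket_vertices 0" using Cons.prems by (auto simp: is_step_def)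
  then have "t = [last t]" using is_step_0[of x t] Cons.prems by (simp add: walk_Cons)
  moreover have "concat ts = map last ts" using Cons.IH[of "last t"] Cons.prems t by (simp add: walk_Cons)
  ultimately show ?case by (metis append_Cons append_Nil concat.simps(2) list.simps(9))
qed simp

definition proper :: "path \<Rightarrow> point \<Rightarrow> point \<Rightarrow> bool" where
  "proper R x y \<longleftrightarrow> R \<noteq> [] \<and> hd R = x \<and> last R = y \<and> successively (adj 0) R \<and> distinct R"

text \<open>Every erasure removes points and keeps the end points; at scale 0 a self-avoiding coarse
  path is the path itself.\<close>

lemma loop_erasure_proper:
  "good k x ts \<Longrightarrow> proper (loop_erasure k (x # concat ts)) x (last (skel x ts)) \<and>
     set (loop_erasure k (x # concat ts)) \<subseteq> set (x # concat ts)"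
proof (induction k arbitrary: x ts)
  case 0
  then have "concat ts = map last ts" using steps_0[of x ts] unfolding good_def by blast
  then show ?case using 0 last_skel[of 0 x ts] by (auto simp: good_def proper_def walk_def)
next
  case (Suc k)
  then obtain us where us: "erased_to k x ts us" using erased_to_exists by blast
  then have e: "loop_erasure (Suc k) (x # concat ts) = loop_erasure k (x # concat us)" "good k x us"
    "last (skel x us) = last (skel x ts)" "set (concat us) \<subseteq> set (concat ts)"
    by (simp_all add: erased_to_def)
  have "set (x # concat us) \<subseteq> set (x # concat ts)" unfolding list.set(2) using e(4) by blast
  then show ?case unfolding e(1) e(3)[symmetric] using Suc.IH[OF e(2)] by blast
qed

text \<open>Locality of the whole erasure of level \<open>k\<close> with respect to the first run,
  stated as a predicate because the induction passes through
  \<open>loop_erasure_breaks\<close>.\<close>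

definition splits_runs :: "nat \<Rightarrow> bool" where
  "splits_runs k \<longleftrightarrow> (\<forall>x g r. good k x (g @ r) \<longrightarrow> first_run k x g r \<longrightarrow>
     loop_erasure k (x # concat (g @ r)) =
       loop_erasure k (x # concat g) @ tl (loop_erasure k (last (skel x g) # concat r)))"

text \<open>A list of steps may be cut at every point where \<open>breaks\<close> holds, even if
  many exit times precede it: peel off the first runs one by one. None of them can extend beyond the
  cut.\<close>

lemma loop_erasure_breaks:
  assumes "splits_runs k"
  shows "good k x (g @ r) \<Longrightarrow> g \<noteq> [] \<Longrightarrow> r \<noteq> [] \<Longrightarrow> breaks k x g r \<Longrightarrow>
    loop_erasure k (x # concat (g @ r)) = loop_erasure k (x # concat g) @ tl (loop_erasure k (last (skel x g) # concat r))"
proof (induction "length g" arbitrary: x g rule: less_induct)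
  case less
  obtain g1 r1 where g1: "g @ r = g1 @ r1" "first_run k x g1 r1"
    by (rule first_run_of_good[OF less.prems(1)]) (use less.prems in simp)
  obtain v where v: "v \<in> cells k" "set (skel x g1) \<subseteq> corners k v"
    using less.prems(1) unfolding g1(1) by (rule first_run_cell[OF _ g1(2)])
  have g1n: "g1 \<noteq> []" using g1(2) by (simp add: first_run_def)
  \<comment> \<open>The first run of the whole list ends before the cut, since its vertices are corners
    of one triangle.\<close>
  have "length g1 \<le> length g"
  proof (rule ccontr)
    assume "\<not> ?thesis"
    then obtain h where h: "g1 = g @ h" "r = h @ r1" "h \<noteq> []"
      using g1(1) by (auto simp: append_eq_append_conv2)
    have "last (skel x (butlast g)) \<in> set (skel x g1)"
      using last_in_set[of "skel x (butlast g)"] h(1) by (auto dest: in_set_butlastD)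
    moreover have "last (skel x g) \<in> set (skel x g1)"
      using last_in_set[of "skel x g"] h(1) by auto
    moreover have "last (hd r) \<in> set (skel x g1)" using h by (cases h) auto
    ultimately show False using less.prems(4) v unfolding breaks_def by blast
  qed
  then obtain g2 where g2: "g = g1 @ g2" "r1 = g2 @ r"
    using g1(1) by (auto simp: append_eq_append_conv2)
  let ?y = "last (skel x g1)"
  note ga = good_append[OF less.prems(1)] and gb = good_append(2)[OF less.prems(1)[unfolded g1(1)]]
  have run: "loop_erasure k (x # concat (g1 @ r1)) = loop_erasure k (x # concat g1) @ tl (loop_erasure k (?y # concat r1))"
    using assms g1(2) less.prems(1) unfolding g1(1) splits_runs_def by blast
  show ?case
  proof (cases "g2 = []")
    case True
    then show ?thesis using run g2 by simp
  next
    case False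
    have lg: "last (skel x g) = last (skel ?y g2)" "last (skel x (butlast g)) = last (skel ?y (butlast g2))"
      using g2(1) False by (auto simp: butlast_append)
    have "loop_erasure k (?y # concat (g2 @ r)) = loop_erasure k (?y # concat g2) @ tl (loop_erasure k (last (skel ?y g2) # concat r))"
      by (rule less.hyps)
        (use less.prems g2 gb False g1n lg in \<open>auto simp: breaks_def simp del: last.simps\<close>)
    moreover have "first_run k x g1 g2" using g1(2) g2(2) False by (simp add: first_run_def)
    then have "loop_erasure k (x # concat g) = loop_erasure k (x # concat g1) @ tl (loop_erasure k (?y # concat g2))"
      using assms ga(1) unfolding g2(1) splits_runs_def by blast
    moreover have y: "loop_erasure k (?y # concat g2) \<noteq> []"
      using loop_erasure_proper[of k ?y g2] good_append(1)[OF gb[unfolded g2(2)]] by (simp add: proper_def)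
    moreover have "loop_erasure k (x # concat (g @ r)) = loop_erasure k (x # concat g1) @ tl (loop_erasure k (?y # concat (g2 @ r)))"
      using run unfolding g1(1)[symmetric] unfolding g2(2) .
    ultimately show ?thesis unfolding lg(1) by (simp only: tl_append2[OF y] append_assoc)
  qed
qed

text \<open>Erase once at the scale below: the two parts become lists \<open>ug\<close> and
  \<open>ur\<close> to which \<open>erased_to_join\<close> and the induction hypothesis
  apply.\<close>

lemma splits_runs: "splits_runs k"
proof (induction k)
  case 0
  show ?case by (simp add: splits_runs_def)
next
  case (Suc k)
  show ?case unfolding splits_runs_def
  proof (intro allI impI)
    fix x g r assume good: "good (Suc k) x (g @ r)" and fr: "first_run (Suc k) x g r"
    let ?y = "last (skel x g)"
    show "loop_erasure (Suc k) (x # concat (g @ r)) =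
       loop_erasure (Suc k) (x # concat g) @ tl (loop_erasure (Suc k) (?y # concat r))"
    proof (cases "r = []")
      case True
      then show ?thesis using loop_erasure_single[of "Suc k" ?y] by simp
    next
      case False
      obtain ug ur where u: "erased_to k x g ug" "erased_to k ?y r ur"
        using erased_to_exists good_append[OF good] by blast
      note j = erased_to_join[OF good fr refl u]
      have ne: "ug \<noteq> []" "ur \<noteq> []" using u fr False by (auto simp: erased_to_def first_run_def)
      have "good k x (ug @ ur)" "breaks k x ug ur" "last (skel x ug) = ?y"
        using j False u by (auto simp: erased_to_def simp del: last.simps)
      from loop_erasure_breaks[OF Suc this(1) ne this(2)] this(3)
      show ?thesis using j u by (simp add: erased_to_def)
    qed
  qed
qed

lemma loop_erasure_run:
  "good k x (g @ r) \<Longrightarrow> first_run k x g r \<Longrightarrow>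
   loop_erasure k (x # concat (g @ r)) = loop_erasure k (x # concat g) @ tl (loop_erasure k (last (skel x g) # concat r))"
  using splits_runs unfolding splits_runs_def by blast

text \<open>The erased path is again a list of coarse steps, between vertices that the original
  coarse path visits.\<close>

lemma loop_erasure_steps:
  assumes "good k x ts"
  obtains us where "steps k x us" "loop_erasure k (x # concat ts) = x # concat us"
    "set (map last us) \<subseteq> set (map last ts)" "last (skel x us) = last (skel x ts)" "distinct (skel x us)"
    "ts \<noteq> [] \<longrightarrow> us \<noteq> []"
proof -
  let ?R = "loop_erasure k (x # concat ts)"
  have R: "proper ?R x (last (skel x ts))" "set ?R \<subseteq> set (x # concat ts)"
    using loop_erasure_proper[OF assms] by auto
  have x: "x \<in> gasket_vertices k" and st: "steps k x ts" using assms by (auto simp: good_def)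
  from R(1) obtain t where t: "?R = x # t" by (cases ?R) (auto simp: proper_def)
  show ?thesis
  proof (cases "ts = []")
    case True
    then show ?thesis using that[of "[]"] by (simp add: loop_erasure_single)
  next
    case False
    then have ne: "last (skel x ts) \<noteq> x" using good_nonempty_end[OF assms] by simp
    then have tn: "t \<noteq> []" using R(1) t by (auto simp: proper_def)
    have lt: "last t = last (skel x ts)" using R(1) t tn by (simp add: proper_def)
    have d: "distinct (x # t)" using R(1) t by (simp add: proper_def)
    have "distinct (butlast t @ [last t])" using d tn by simp
    then have "last t \<notin> set (butlast t)" by simp
    then have "\<exists>us. steps k x us \<and> concat us = t"
      using steps_exist[OF tn, of k x] steps_end_vertex[OF x st] ne lt by simp
    then obtain us where us: "steps k x us" "concat us = t" by blast
    have sub: "set (map last us) \<subseteq> set t" using skel_subset[OF us(1)] us(2) by simp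
    have "set (map last us) \<subseteq> gasket_vertices k"
    proof
      fix p assume "p \<in> set (map last us)"
      then obtain i where "i < length us" "p = last (us ! i)" by (auto simp: in_set_conv_nth)
      then show "p \<in> gasket_vertices k" using steps_nth[OF us(1)] by (auto simp: is_step_def)
    qed
    then have "set (map last us) \<subseteq> set (skel x ts)"
    proof (intro subsetI)
      fix p assume p: "set (map last us) \<subseteq> gasket_vertices k" "p \<in> set (map last us)"
      then have "p = x \<or> p \<in> set (concat ts)" using sub R(2) t by auto
      then show "p \<in> set (skel x ts)" using p steps_vertices[OF st] by auto
    qed
    moreover have "x \<notin> set (map last us)" using sub d by auto
    ultimately have 1: "set (map last us) \<subseteq> set (map last ts)" by auto
    have dd: "distinct (concat us) \<Longrightarrow> (\<And>u. u \<in> set us \<Longrightarrow> u \<noteq> []) \<Longrightarrow> distinct (map last us)" for us :: "path list"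
    proof (induction us)
      case (Cons u us)
      have "last u \<notin> last ` set us"
      proof
        assume "last u \<in> last ` set us"
        then obtain u' where u': "u' \<in> set us" "last u = last u'" by blast
        then have "last u \<in> set (concat us)" using Cons.prems(2)[of u'] UN_I[OF u'(1), of "last u'" set] by simp
        moreover have "last u \<in> set u" using Cons.prems(2)[of u] by simp
        ultimately show False using Cons.prems(1) by auto
      qed
      then show ?case using Cons by simp
    qed simp
    have "distinct (map last us)" using dd[of us] us d steps_nonempty[OF us(1)] by simp
    then have 2: "distinct (skel x us)" using \<open>x \<notin> set (map last us)\<close> by simp
    have "last (skel x us) = last (skel x ts)" using last_skel[OF us(1)] us(2) lt tn by simp
    moreover have "us \<noteq> []" using us(2) tn by auto
    ultimately show ?thesis using that[of us] us t 1 2 by blast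
  qed
qed

lemma first_runI:
  assumes "v \<in> cells k" "x \<in> corners k v" "g \<noteq> []" "x \<notin> set (map last g)" "set (map last g) \<subseteq> corners k v"
    "r = [] \<or> last (hd r) \<notin> tri k v"
  shows "first_run k x g r"
proof -
  have h: "last (hd g) \<in> set (map last g)" using assms(3) by simp
  have "triangle_through k x (last (hd g)) = tri k v"
    by (rule triangle_through_eq[OF assms(1,2)]) (use h assms(4,5) in auto)
  moreover have "last t \<in> tri k v" if "t \<in> set g" for t
    using that assms(5) by (intro corners_in_tri) auto
  ultimately show ?thesis using assms(3,6) unfolding first_run_def by simp
qed

text \<open>The erased first run is a run of steps in the same triangle, and the erased remainder
  starts with a step that leaves this triangle; so the first exit of the erased path is the end of
  the erased first run.\<close>

lemma stopped_loop_erasure: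
  assumes good: "good k x (g @ r)" and fr: "first_run k x g r"
  shows "stopped k (loop_erasure k (x # concat (g @ r))) = loop_erasure k (x # concat g)"
proof -
  let ?y = "last (skel x g)"
  note gg = good_append[OF good]
  obtain v where v: "v \<in> cells k" "set (skel x g) \<subseteq> corners k v" "r = [] \<or> last (hd r) \<notin> tri k v"
    by (rule first_run_cell[OF good fr])
  have g: "g \<noteq> []" using fr by (simp add: first_run_def)
  obtain a where a: "steps k x a" "loop_erasure k (x # concat g) = x # concat a"
    "set (map last a) \<subseteq> set (map last g)" "last (skel x a) = ?y" "distinct (skel x a)" "g \<noteq> [] \<longrightarrow> a \<noteq> []"
    by (rule loop_erasure_steps[OF gg(1)])
  \<comment> \<open>The erased remainder starts inside the triangle \<open>v2\<close> of its own first
    run, which is not \<open>v\<close>; as \<open>v2\<close> meets \<open>v\<close> only in the starting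
    point, the first step leads out of \<open>v\<close>.\<close>
  obtain b where b: "steps k ?y b" "loop_erasure k (?y # concat r) = ?y # concat b" "r = [] \<Longrightarrow> b = []"
    "r \<noteq> [] \<Longrightarrow> last (hd b) \<notin> tri k v"
  proof (cases "r = []")
    case True
    then show ?thesis using that[of "[]"] by (simp add: loop_erasure_single)
  next
    case False
    obtain g2 r2 where r: "r = g2 @ r2" and fr2: "first_run k ?y g2 r2"
      by (rule first_run_of_good[OF gg(2) False])
    note gr = gg(2)[unfolded r]
    obtain v2 where v2: "v2 \<in> cells k" "set (skel ?y g2) \<subseteq> corners k v2"
      by (rule first_run_cell[OF gr fr2])
    have g2: "g2 \<noteq> []" using fr2 by (simp add: first_run_def)
    obtain c where c: "steps k ?y c" "loop_erasure k (?y # concat g2) = ?y # concat c"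
      "set (map last c) \<subseteq> set (map last g2)" "last (skel ?y c) = last (skel ?y g2)" "distinct (skel ?y c)" "g2 \<noteq> [] \<longrightarrow> c \<noteq> []"
      by (rule loop_erasure_steps[OF good_append(1)[OF gr]])
    let ?z = "last (skel ?y g2)"
    obtain d where d: "steps k ?z d" "loop_erasure k (?z # concat r2) = ?z # concat d"
      by (rule loop_erasure_steps[OF good_append(2)[OF gr]])
    have cn: "c \<noteq> []" using c(6) g2 by simp
    have st: "steps k ?y (c @ d)" using c(1,4) d(1) by (simp add: steps_append del: last.simps)
    have "loop_erasure k (?y # concat r) = ?y # concat (c @ d)"
      using loop_erasure_run[OF gr fr2] c(2) d(2) r by simp
    moreover have "last (hd (c @ d)) \<notin> tri k v"
    proof
      assume *: "last (hd (c @ d)) \<in> tri k v"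
      let ?q = "last (hd c)"
      have q: "?q \<in> set (map last c)" using cn by simp
      have "?q \<noteq> ?y" using c(5) q by auto
      have "?q \<in> tri k v2" using q c(3) v2(2) by (auto intro: corners_in_tri)
      have "?y \<in> set (skel x g)" by (rule last_in_set) simp
      then have "?y \<in> tri k v" using v(2) corners_in_tri by blast
      have "?y \<in> tri k v2" using v2(2) by (auto intro: corners_in_tri)
      have "last (hd g2) \<in> tri k v2" using v2(2) g2 by (cases g2) (auto intro: corners_in_tri)
      then have "v2 \<noteq> v" using v(3) r g2 by auto
      then show False
        using tri_Int_tri(3)[OF v2(1) v(1) _ \<open>?y \<in> tri k v2\<close> \<open>?y \<in> tri k v\<close> \<open>?q \<in> tri k v2\<close>] * cn \<open>?q \<noteq> ?y\<close> by simp
    qed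
    ultimately show ?thesis using that[of "c @ d"] st False by simp
  qed
  have an: "a \<noteq> []" using a(6) g by simp
  have L: "loop_erasure k (x # concat (g @ r)) = x # concat (a @ b)"
    using loop_erasure_run[OF good fr] a(2) b(2) by simp
  have st: "steps k x (a @ b)" using a(1,4) b(1) by (simp add: steps_append del: last.simps)
  have "first_run k x a b"
  proof (rule first_runI[OF v(1)])
    show "x \<in> corners k v" using v(2) by simp
    show "x \<notin> set (map last a)" using a(5) by simp
    show "set (map last a) \<subseteq> corners k v" using a(3) v(2) by auto
    show "b = [] \<or> last (hd b) \<notin> tri k v" using b(3,4) by blast
  qed (rule an)
  from stopped_first_run[OF st this] show ?thesis unfolding L a(2) .
qed

section \<open>Midpoints of a triangle and its neighbourhood\<close>

definition mid :: "point \<Rightarrow> point \<Rightarrow> point" where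
  "mid p q = (1 / 2) *\<^sub>R (p + q)"

lemma mid_commute: "mid p q = mid q p"
  by (simp add: mid_def add.commute)

lemma mid_same [simp]: "mid p p = p"
  by (simp add: mid_def flip: scaleR_2)

lemma mid_inject [simp]: "mid p q = mid p r \<longleftrightarrow> q = r"
  by (simp add: mid_def)

lemma mid_pt: "mid (pt a b) (pt c d) = pt ((a + c) / 2) ((b + d) / 2)"
  by (simp add: mid_def pt_add pt_scale)

lemma pt_in_tri: "pt s t \<in> tri k (pt a b) \<longleftrightarrow> a \<le> s \<and> b \<le> t \<and> s + t \<le> a + b + 2 ^ k"
  by (auto simp: tri_pt)

lemma mid_not_vertex:
  assumes "v \<in> cells (Suc k)" "p \<in> corners (Suc k) v" "q \<in> corners (Suc k) v" "p \<noteq> q"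
  shows "mid p q \<in> tri (Suc k) v" "mid p q \<notin> gasket_vertices (Suc k)"
proof -
  obtain a b where v: "v = pt a b" using assms(1) by (auto simp: cells_def)
  have c: "p \<in> {pt a b, pt (a + 2 * 2 ^ k) b, pt a (b + 2 * 2 ^ k)}" "q \<in> {pt a b, pt (a + 2 * 2 ^ k) b, pt a (b + 2 * 2 ^ k)}"
    using assms(2,3) unfolding v corners_pt by simp_all
  have h: "(2::real) ^ k > 0" by simp
  show t: "mid p q \<in> tri (Suc k) v"
    using c h unfolding v by (auto simp: mid_pt pt_in_tri field_simps)
  have "mid p q \<notin> corners (Suc k) v"
    using c h assms(4) unfolding v corners_pt by (auto simp: mid_pt)
  then show "mid p q \<notin> gasket_vertices (Suc k)" using gasket_vertices_tri[OF assms(1) t] by blast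
qed

lemma midpoint_coords:
  fixes a h :: real
  shows "(a + (a + 2 * h)) / 2 = a + h" "(a + 2 * h + a) / 2 = a + h" "(a + a) / 2 = a"
    "a + h + h = a + 2 * h"
  by (simp_all add: field_simps)

lemma subcell_at:
  assumes "v \<in> cells (Suc k)" "c \<in> corners (Suc k) v"
  shows "\<exists>u\<in>cells k. corners k u = mid c ` corners (Suc k) v"
proof -
  obtain a b where v: "v = pt a b" using assms(1) by (auto simp: cells_def)
  note s = subcells[OF assms(1)]
  consider "c = v" | "c = v + apex (Suc k)" | "c = v + corner (Suc k)"
    using assms(2) by (auto simp: corners_def)
  then show ?thesis
  proof cases
    case 1
    have "corners k v = mid c ` corners (Suc k) v"
      unfolding 1 v corners_pt power_Suc
      by (simp only: mid_pt midpoint_coords image_insert image_empty)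
    then show ?thesis using s by blast
  next
    case 2
    have "corners k (v + apex k) = mid c ` corners (Suc k) v"
      unfolding 2 v apex_eq_pt pt_add corners_pt power_Suc
      by (simp only: mid_pt midpoint_coords image_insert image_empty add_0_right)
    then show ?thesis using s by blast
  next
    case 3
    have "corners k (v + corner k) = mid c ` corners (Suc k) v"
      unfolding 3 v corner_eq_pt pt_add corners_pt power_Suc
      by (simp only: mid_pt midpoint_coords image_insert image_empty add_0_right)
    then show ?thesis using s by blast
  qed
qed

lemma adj_two_cells:
  assumes "u \<in> cells k" "v \<in> cells k" "u \<noteq> v" "p \<in> corners k u" "p \<in> corners k v"
  shows "{q. adj k p q} = (corners k u \<union> corners k v) - {p}"
proof -
  obtain a b where ab: "{w \<in> cells k. p \<in> corners k w} = {a, b}"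
    by (rule two_cells[of p k]) (use assms gasket_verticesI in blast)
  moreover have "u \<in> {a, b}" "v \<in> {a, b}" unfolding ab[symmetric] using assms by blast+
  ultimately have "{w \<in> cells k. p \<in> corners k w} = {u, v}" using assms(3) by blast
  then have only: "w = u \<or> w = v" if "w \<in> cells k" "p \<in> corners k w" for w using that by blast
  have "adj k p q \<longleftrightarrow> q \<in> (corners k u \<union> corners k v) - {p}" for q
  proof
    assume "adj k p q"
    then obtain w where "w \<in> cells k" "p \<in> corners k w" "q \<in> corners k w" "p \<noteq> q" unfolding adj_iff by blast
    with only[of w] show "q \<in> (corners k u \<union> corners k v) - {p}" by auto
  next
    assume "q \<in> (corners k u \<union> corners k v) - {p}"
    then show "adj k p q" unfolding adj_iff using assms by auto
  qed
  then show ?thesis by blast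
qed

text \<open>The three corners of a triangle of side \<open>2 ^ (k + 1)\<close> in some order. Its
  midpoints are the vertices of scale \<open>k\<close> in this triangle that are not
  corners.\<close>

definition frame :: "nat \<Rightarrow> point \<Rightarrow> point \<Rightarrow> point \<Rightarrow> bool" where
  "frame k c d e \<longleftrightarrow> distinct [c, d, e] \<and> (\<exists>v\<in>cells (Suc k). corners (Suc k) v = {c, d, e})"

lemma frame_perm: "frame k c d e \<Longrightarrow> frame k d c e" "frame k c d e \<Longrightarrow> frame k c e d"
  by (auto simp: frame_def insert_commute)

lemma frame_vertices:
  assumes "frame k c d e"
  shows "{c, d, e} \<subseteq> gasket_vertices (Suc k)" "mid c d \<notin> gasket_vertices (Suc k)" "mid c e \<notin> gasket_vertices (Suc k)" "mid d e \<notin> gasket_vertices (Suc k)"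
proof -
  obtain v where v: "v \<in> cells (Suc k)" "corners (Suc k) v = {c, d, e}" "distinct [c, d, e]" using assms by (auto simp: frame_def)
  show "{c, d, e} \<subseteq> gasket_vertices (Suc k)" unfolding v(2)[symmetric] using gasket_verticesI[OF v(1)] by blast
  show "mid c d \<notin> gasket_vertices (Suc k)" "mid c e \<notin> gasket_vertices (Suc k)" "mid d e \<notin> gasket_vertices (Suc k)"
    using mid_not_vertex(2)[OF v(1)] v(2,3) by auto
qed

lemma frame_distinct:
  assumes "frame k c d e"
  shows "distinct [c, d, e, mid c d, mid c e, mid d e]"
proof -
  have "mid c d \<noteq> mid d e" "mid c e \<noteq> mid d e" "mid c d \<noteq> mid c e"
    using assms mid_inject[of d c e] mid_inject[of e c d] by (auto simp: frame_def mid_commute)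
  then show ?thesis using frame_vertices[OF assms] assms by (auto simp: frame_def)
qed

lemma nbr_mid:
  assumes "frame k c d e"
  shows "{z. adj k (mid c d) z} = {c, d, mid c e, mid d e}"
proof -
  obtain v where v: "v \<in> cells (Suc k)" "corners (Suc k) v = {c, d, e}" using assms by (auto simp: frame_def)
  obtain u where u: "u \<in> cells k" "corners k u = mid c ` {c, d, e}" using subcell_at[OF v(1), of c] v(2) by auto
  obtain w where w: "w \<in> cells k" "corners k w = mid d ` {c, d, e}" using subcell_at[OF v(1), of d] v(2) by auto
  note dist = frame_distinct[OF assms]
  have U: "corners k u = {c, mid c d, mid c e}" "corners k w = {mid c d, d, mid d e}"
    unfolding u(2) w(2) by (simp_all add: mid_commute)
  then have "c \<in> corners k u" "c \<notin> corners k w" using dist by auto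
  then have "u \<noteq> w" by blast
  then have "{z. adj k (mid c d) z} = ({c, mid c d, mid c e} \<union> {mid c d, d, mid d e}) - {mid c d}"
    using adj_two_cells[OF u(1) w(1), of "mid c d"] unfolding U by simp
  also have "\<dots> = {c, d, mid c e, mid d e}"
  proof -
    have "mid c d \<notin> {c, d, mid c e, mid d e}" using dist by auto
    then show ?thesis by blast
  qed
  finally show ?thesis .
qed

text \<open>At a corner, the four neighbours are midpoints of the sides of the two triangles that
  meet there.\<close>

lemma nbr_corner:
  assumes "frame k c d e" "frame k c d' e'" "{d, e} \<noteq> {d', e'}"
  shows "{z. adj k c z} = {mid c d, mid c e, mid c d', mid c e'}" "distinct [mid c d, mid c e, mid c d', mid c e']"
proof -
  obtain v where v: "v \<in> cells (Suc k)" "corners (Suc k) v = {c, d, e}" using assms(1) by (auto simp: frame_def)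
  obtain v' where v': "v' \<in> cells (Suc k)" "corners (Suc k) v' = {c, d', e'}" using assms(2) by (auto simp: frame_def)
  have "{c, d, e} - {c} = {d, e}" "{c, d', e'} - {c} = {d', e'}" using assms(1,2) unfolding frame_def by auto
  then have "v \<noteq> v'" using v v' assms(3) by metis
  obtain u where u: "u \<in> cells k" "corners k u = mid c ` {c, d, e}" using subcell_at[OF v(1), of c] v(2) by auto
  obtain w where w: "w \<in> cells k" "corners k w = mid c ` {c, d', e'}" using subcell_at[OF v'(1), of c] v'(2) by auto
  have U: "corners k u = {c, mid c d, mid c e}" "corners k w = {c, mid c d', mid c e'}"
    unfolding u(2) w(2) by simp_all
  have in_v: "mid c d \<in> tri (Suc k) v" "mid c e \<in> tri (Suc k) v" "mid c d' \<in> tri (Suc k) v'" "mid c e' \<in> tri (Suc k) v'"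
    using mid_not_vertex(1)[OF v(1)] mid_not_vertex(1)[OF v'(1)] v v' assms by (auto simp: frame_def)
  have nv: "mid c d \<notin> gasket_vertices (Suc k)" "mid c e \<notin> gasket_vertices (Suc k)"
    using frame_vertices[OF assms(1)] by simp_all
  have sep: "p \<notin> tri (Suc k) v'" if "p \<in> tri (Suc k) v" "p \<notin> gasket_vertices (Suc k)" for p
    using tri_Int_tri(1)[OF v(1) v'(1) \<open>v \<noteq> v'\<close>] that gasket_verticesI[OF v(1)] by blast
  have ne: "mid c d \<noteq> mid c d'" "mid c d \<noteq> mid c e'" "mid c e \<noteq> mid c d'" "mid c e \<noteq> mid c e'"
    using sep[OF in_v(1) nv(1)] sep[OF in_v(2) nv(2)] in_v(3,4) by auto
  then show "distinct [mid c d, mid c e, mid c d', mid c e']"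
    using frame_distinct[OF assms(1)] frame_distinct[OF assms(2)] by auto
  have "mid c d \<noteq> c" using frame_distinct[OF assms(1)] by auto
  then have "mid c d \<in> corners k u" "mid c d \<notin> corners k w"
    unfolding U using ne by (simp_all del: mid_inject)
  then have "u \<noteq> w" by blast
  then have "{z. adj k c z} = ({c, mid c d, mid c e} \<union> {c, mid c d', mid c e'}) - {c}"
    using adj_two_cells[OF u(1) w(1), of c] unfolding U by simp
  also have "\<dots> = {mid c d, mid c e, mid c d', mid c e'}"
  proof -
    have "c \<notin> {mid c d, mid c e, mid c d', mid c e'}"
      using frame_distinct[OF assms(1)] frame_distinct[OF assms(2)] by auto
    then show ?thesis by blast
  qed
  finally show "{z. adj k c z} = {mid c d, mid c e, mid c d', mid c e'}" .
qed

lemma frame_exists: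
  assumes "v \<in> cells (Suc k)" "c \<in> corners (Suc k) v"
  obtains d e where "frame k c d e" "corners (Suc k) v = {c, d, e}"
proof -
  have "card (corners (Suc k) v) = 3" by (rule card_corners)
  then have "card (corners (Suc k) v - {c}) = 2" using assms(2) by simp
  then obtain d e where "corners (Suc k) v - {c} = {d, e}" "d \<noteq> e" by (auto simp: card_2_iff)
  then have "corners (Suc k) v = {c, d, e}" "distinct [c, d, e]" using assms(2) by auto
  then show ?thesis using that[of d e] assms(1) unfolding frame_def by blast
qed

lemma other_frame:
  assumes "frame k c d e"
  obtains d' e' where "frame k c d' e'" "{d, e} \<noteq> {d', e'}" "{d', e'} \<inter> {d, e} = {}"
proof -
  obtain v where v: "v \<in> cells (Suc k)" "corners (Suc k) v = {c, d, e}" using assms by (auto simp: frame_def)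
  obtain a b where ab: "a \<noteq> b" "{w \<in> cells (Suc k). c \<in> corners (Suc k) w} = {a, b}"
    by (rule two_cells[of c "Suc k"]) (use frame_vertices(1)[OF assms] in auto)
  have "v \<in> {a, b}" unfolding ab(2)[symmetric] using v by auto
  then obtain v' where v': "v' \<in> cells (Suc k)" "c \<in> corners (Suc k) v'" "v' \<noteq> v"
  proof -
    define v' where "v' = (if v = a then b else a)"
    have "v' \<in> {w \<in> cells (Suc k). c \<in> corners (Suc k) w}" unfolding ab(2) v'_def by simp
    moreover have "v' \<noteq> v" using \<open>v \<in> {a, b}\<close> ab(1) unfolding v'_def by auto
    ultimately show thesis using that[of v'] by blast
  qed
  obtain d' e' where f: "frame k c d' e'" "corners (Suc k) v' = {c, d', e'}" by (rule frame_exists[OF v'(1,2)])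
  have "p \<notin> corners (Suc k) v'" if "p \<in> {d, e}" for p
    using corners_inj[OF v'(1) v(1), of c p] v' v that assms by (auto simp: frame_def)
  then have "{d', e'} \<inter> {d, e} = {}" using f(2) by auto
  then show ?thesis using that[OF f(1)] by auto
qed

section \<open>Masses of sets of walks\<close>

text \<open>Every step along an edge counts \<open>1 / 4\<close>, as for simple random walk.\<close>

definition weight :: "path list \<Rightarrow> ennreal" where
  "weight ts = ennreal ((1 / 4) ^ length (concat ts))"

lemma weight_append: "weight (ts @ us) = weight ts * weight us"
  by (simp add: weight_def power_add ennreal_mult)

definition weights :: "path list measure" where
  "weights = density (count_space UNIV) weight"

abbreviation mass :: "path list set \<Rightarrow> ennreal" where
  "mass \<equiv> emeasure weights"

lemma sets_weights [simp]: "A \<in> sets weights"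
  by (simp add: weights_def)

lemma mass_eq: "mass A = (\<integral>\<^sup>+ts. weight ts \<partial>count_space A)"
  by (simp add: weights_def emeasure_density nn_integral_count_space_indicator)

lemma mass_single: "mass {ts} = weight ts"
  by (simp add: mass_eq nn_integral_count_space_finite)

lemma mass_Un: "A \<inter> B = {} \<Longrightarrow> mass (A \<union> B) = mass A + mass B"
  by (rule plus_emeasure[symmetric]) auto

definition conc :: "path list set \<Rightarrow> path list set \<Rightarrow> path list set" where
  "conc A B = {a @ b | a b. a \<in> A \<and> b \<in> B}"

lemma concI: "a \<in> A \<Longrightarrow> b \<in> B \<Longrightarrow> a @ b \<in> conc A B"
  by (auto simp: conc_def)

text \<open>The factorisation is unique by assumption, and weights are multiplicative.\<close>

lemma mass_conc:
  assumes "\<And>a b a' b'. a \<in> A \<Longrightarrow> a' \<in> A \<Longrightarrow> b \<in> B \<Longrightarrow> b' \<in> B \<Longrightarrow> a @ b = a' @ b' \<Longrightarrow> a = a'"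
  shows "mass (conc A B) = mass A * mass B"
proof -
  have c: "conc A B = (\<lambda>(a, b). a @ b) ` (A \<times> B)" by (auto simp: conc_def)
  have inj: "inj_on (\<lambda>(a, b). a @ b) (A \<times> B)" using assms by (auto simp: inj_on_def)
  have "mass (conc A B) = (\<integral>\<^sup>+z. weight (fst z) * weight (snd z) \<partial>count_space (A \<times> B))"
    unfolding mass_eq c nn_integral_bij_count_space[OF inj_on_imp_bij_betw[OF inj], symmetric]
    by (simp add: case_prod_unfold weight_append)
  also have "\<dots> = (\<integral>\<^sup>+z. weight (fst z) * indicator A (fst z) * (weight (snd z) * indicator B (snd z)) \<partial>count_space UNIV)"
    by (subst nn_integral_count_space_indicator) (auto intro!: nn_integral_cong split: split_indicator)
  also have "\<dots> = (\<integral>\<^sup>+a. \<integral>\<^sup>+b. weight a * indicator A a * (weight b * indicator B b) \<partial>count_space UNIV \<partial>count_space UNIV)"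
    by (subst nn_integral_fst_count_space[symmetric]) simp
  also have "\<dots> = (\<integral>\<^sup>+a. weight a * indicator A a * mass B \<partial>count_space UNIV)"
    by (subst nn_integral_cmult) (auto simp: mass_eq nn_integral_count_space_indicator)
  also have "\<dots> = mass A * mass B"
    by (subst nn_integral_multc) (auto simp: mass_eq nn_integral_count_space_indicator)
  finally show ?thesis .
qed

text \<open>Walks from \<open>x\<close> to \<open>y\<close> on the grid of scale \<open>k\<close>,
  described by their steps, all of whose intermediate vertices lie in \<open>I\<close>. When
  \<open>y \<notin> I\<close> the mass is the probability of reaching \<open>y\<close> before any
  other vertex outside \<open>I\<close>.\<close>

definition lang :: "nat \<Rightarrow> point set \<Rightarrow> point \<Rightarrow> point \<Rightarrow> path list set" where
  "lang k I x y = {ts. steps k x ts \<and> walk x ts \<and> ts \<noteq> [] \<and> last (last ts) = y \<and> last ` set (butlast ts) \<subseteq> I}"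

lemma lang_Cons:
  "t # ts \<in> lang k I x y \<longleftrightarrow> is_step k x t \<and> successively (adj 0) (x # t) \<and>
     (ts = [] \<and> last t = y \<or> last t \<in> I \<and> ts \<in> lang k I (last t) y)"
  by (cases "t = []") (auto simp: lang_def walk_Cons is_step_def)

lemma lang_last: "ts \<in> lang k I x y \<Longrightarrow> last (last ts) = y" "ts \<in> lang k I x y \<Longrightarrow> ts \<noteq> []"
  by (auto simp: lang_def)

definition nlang :: "nat \<Rightarrow> point set \<Rightarrow> point \<Rightarrow> point \<Rightarrow> nat \<Rightarrow> path list set" where
  "nlang k I x y n = {ts \<in> lang k I x y. length ts = Suc n}"

abbreviation one_step :: "nat \<Rightarrow> point \<Rightarrow> point \<Rightarrow> path list set" where
  "one_step k \<equiv> lang k {}"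

lemma one_step_iff: "ts \<in> one_step k x y \<longleftrightarrow> (\<exists>t. ts = [t] \<and> is_step k x t \<and> successively (adj 0) (x # t) \<and> last t = y)"
  by (cases ts) (auto simp: lang_Cons, simp add: lang_def)

lemma nlang_0: "nlang k I x y 0 = one_step k x y"
proof -
  have "ts \<in> nlang k I x y 0 \<longleftrightarrow> ts \<in> one_step k x y" for ts
    by (cases ts; cases "tl ts") (auto simp: nlang_def lang_Cons one_step_iff, auto simp: lang_def)
  then show ?thesis by blast
qed

lemma nlang_Suc:
  assumes "x \<in> gasket_vertices k"
  shows "nlang k I x y (Suc n) = (\<Union>z\<in>{z. adj k x z} \<inter> I. conc (one_step k x z) (nlang k I z y n))"
proof (intro equalityI subsetI)
  fix ts assume "ts \<in> nlang k I x y (Suc n)"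
  then obtain t us where ts: "ts = t # us" "t # us \<in> lang k I x y" "length us = Suc n"
    unfolding nlang_def by (cases ts) auto
  then have "is_step k x t" "successively (adj 0) (x # t)" "last t \<in> I" "us \<in> nlang k I (last t) y n"
    by (auto simp: lang_Cons nlang_def)
  moreover from this have "adj k x (last t)" using step_adj[OF assms] by blast
  ultimately show "ts \<in> (\<Union>z\<in>{z. adj k x z} \<inter> I. conc (one_step k x z) (nlang k I z y n))"
  proof (intro UN_I[of "last t"])
    have "[t] \<in> one_step k x (last t)"
      unfolding one_step_iff using \<open>is_step k x t\<close> \<open>successively (adj 0) (x # t)\<close> by blast
    from concI[OF this \<open>us \<in> nlang k I (last t) y n\<close>]
    show "ts \<in> conc (one_step k x (last t)) (nlang k I (last t) y n)" by (simp add: ts(1))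
  qed simp
next
  fix ts assume "ts \<in> (\<Union>z\<in>{z. adj k x z} \<inter> I. conc (one_step k x z) (nlang k I z y n))"
  then obtain z as bs where *: "z \<in> I" "as \<in> one_step k x z" "bs \<in> nlang k I z y n" "ts = as @ bs"
    unfolding conc_def by blast
  then obtain t where "as = [t]" "is_step k x t" "successively (adj 0) (x # t)" "last t = z"
    unfolding one_step_iff by blast
  then show "ts \<in> nlang k I x y (Suc n)" using * by (auto simp: nlang_def lang_Cons)
qed

text \<open>Each step of scale \<open>k\<close> has the mass of a single edge.\<close>

definition decimates :: "nat \<Rightarrow> bool" where
  "decimates k \<longleftrightarrow> (\<forall>x z. adj k x z \<longrightarrow> mass (one_step k x z) = ennreal (1 / 4))"

lemma mass_one_step_not_adj: "x \<in> gasket_vertices k \<Longrightarrow> \<not> adj k x z \<Longrightarrow> one_step k x z = {}"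
  using step_adj[of x k] by (auto simp: one_step_iff)

lemma adj_in_cells:
  assumes "{w \<in> cells k. p \<in> corners k w} = {u, v}" "adj k p q"
  shows "q \<in> corners k u \<union> corners k v"
proof -
  obtain w where w: "w \<in> cells k" "p \<in> corners k w" "q \<in> corners k w" using assms(2) unfolding adj_iff by blast
  then have "w \<in> {u, v}" unfolding assms(1)[symmetric] by simp
  then show ?thesis using w(3) by blast
qed

lemma finite_nbr [simp]: "finite {z. adj k x z}"
proof (cases "x \<in> gasket_vertices k")
  case True
  then obtain u v where "{w \<in> cells k. x \<in> corners k w} = {u, v}" by (rule two_cells)
  then have "{z. adj k x z} \<subseteq> corners k u \<union> corners k v" using adj_in_cells by blast
  then show ?thesis by (rule finite_subset) simp
next
  case False
  then have "{z. adj k x z} = {}" using adj_vertices by blast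
  then show ?thesis by (simp only: finite.emptyI)
qed

lemma card_nbr: "card {z. adj k x z} \<le> 4"
proof (cases "x \<in> gasket_vertices k")
  case True
  then obtain u v where uv: "{w \<in> cells k. x \<in> corners k w} = {u, v}" by (rule two_cells)
  then have "x \<in> corners k u" "x \<in> corners k v" by blast+
  then have "card (corners k u - {x}) = 2" "card (corners k v - {x}) = 2" using card_corners by simp_all
  moreover have "{z. adj k x z} \<subseteq> (corners k u - {x}) \<union> (corners k v - {x})" 
    using adj_in_cells[OF uv] unfolding adj_iff by blast
  then have "card {z. adj k x z} \<le> card ((corners k u - {x}) \<union> (corners k v - {x}))" by (intro card_mono) auto
  ultimately show ?thesis using card_Un_le[of "corners k u - {x}" "corners k v - {x}"] by linarith
next
  case False
  then have "{z. adj k x z} = {}" using adj_vertices by blast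
  then show ?thesis by (simp only: card.empty)
qed

lemma mass_UN:
  assumes "finite S" "\<And>z z'. z \<in> S \<Longrightarrow> z' \<in> S \<Longrightarrow> z \<noteq> z' \<Longrightarrow> A z \<inter> A z' = {}"
  shows "mass (\<Union>z\<in>S. A z) = (\<Sum>z\<in>S. mass (A z))"
  by (rule sum_emeasure[symmetric]) (use assms in \<open>auto simp: disjoint_family_on_def\<close>)

lemma mass_nlang_Suc:
  assumes "decimates k" "x \<in> gasket_vertices k"
  shows "mass (nlang k I x y (Suc n)) = (\<Sum>z\<in>{z. adj k x z} \<inter> I. ennreal (1 / 4) * mass (nlang k I z y n))"
proof -
  have "mass (nlang k I x y (Suc n)) = (\<Sum>z\<in>{z. adj k x z} \<inter> I. mass (conc (one_step k x z) (nlang k I z y n)))"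
    unfolding nlang_Suc[OF assms(2)]
    by (rule mass_UN) (auto simp: conc_def one_step_iff)
  also have "\<dots> = (\<Sum>z\<in>{z. adj k x z} \<inter> I. ennreal (1 / 4) * mass (nlang k I z y n))"
  proof (rule sum.cong[OF refl])
    fix z assume z: "z \<in> {z. adj k x z} \<inter> I"
    have "mass (conc (one_step k x z) (nlang k I z y n)) = mass (one_step k x z) * mass (nlang k I z y n)"
    proof (rule mass_conc)
      fix a b a' b' assume "a \<in> one_step k x z" "a' \<in> one_step k x z" "a @ b = a' @ b'"
      moreover from this obtain t t' where "a = [t]" "a' = [t']" unfolding one_step_iff by blast
      ultimately show "a = a'" by simp
    qed
    then show "mass (conc (one_step k x z) (nlang k I z y n)) = ennreal (1 / 4) * mass (nlang k I z y n)"
      using z assms(1) by (simp add: decimates_def)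
  qed
  finally show ?thesis .
qed

lemma mass_nlang_0:
  assumes "decimates k" "x \<in> gasket_vertices k"
  shows "mass (nlang k I x y 0) = (if adj k x y then ennreal (1 / 4) else 0)"
  using assms mass_one_step_not_adj[OF assms(2)] by (simp add: nlang_0 decimates_def)

lemma mass_lang_suminf: "mass (lang k I x y) = (\<Sum>n. mass (nlang k I x y n))"
proof -
  have "lang k I x y = (\<Union>n. nlang k I x y n)"
  proof (intro equalityI subsetI)
    fix ts assume ts: "ts \<in> lang k I x y"
    then obtain n where "length ts = Suc n" using lang_last(2)[OF ts] by (cases ts) auto
    then have "ts \<in> nlang k I x y n" using ts by (simp add: nlang_def)
    then show "ts \<in> (\<Union>n. nlang k I x y n)" by blast
  qed (auto simp: nlang_def)
  moreover have "(\<Sum>n. mass (nlang k I x y n)) = mass (\<Union>n. nlang k I x y n)"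
    by (rule suminf_emeasure) (auto simp: disjoint_family_on_def nlang_def)
  ultimately show ?thesis by simp
qed

text \<open>First step analysis; it becomes the mean value property once the masses are known to be
  finite.\<close>

lemma mass_lang_first_step:
  assumes "decimates k" "x \<in> gasket_vertices k"
  shows "mass (lang k I x y) = (if adj k x y then ennreal (1 / 4) else 0) +
    (\<Sum>z\<in>{z. adj k x z} \<inter> I. ennreal (1 / 4) * mass (lang k I z y))"
proof -
  have "mass (lang k I x y) = mass (nlang k I x y 0) + (\<Sum>n. mass (nlang k I x y (Suc n)))"
    unfolding mass_lang_suminf by (subst suminf_offset[of _ 1]) auto
  also have "(\<Sum>n. mass (nlang k I x y (Suc n))) = (\<Sum>z\<in>{z. adj k x z} \<inter> I. \<Sum>n. ennreal (1 / 4) * mass (nlang k I z y n))"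
    unfolding mass_nlang_Suc[OF assms] by (rule suminf_sum) auto
  finally show ?thesis unfolding mass_nlang_0[OF assms] mass_lang_suminf by simp
qed

text \<open>Hitting masses are finite, so linear systems for them can be solved in the reals.
  Partial sums over the number of steps are bounded by induction, as there are at most four
  neighbours of mass \<open>1 / 4\<close> each.\<close>

lemma mass_lang_le_1:
  assumes "decimates k" "x \<in> gasket_vertices k" "y \<notin> I"
  shows "mass (lang k I x y) \<le> 1"
proof -
  have "(\<Sum>i<n. mass (nlang k I x y i)) \<le> 1" for n
    using assms(2)
  proof (induction n arbitrary: x)
    case (Suc n)
    let ?N = "{z. adj k x z}"
    have "(\<Sum>i<Suc n. mass (nlang k I x y i)) = mass (nlang k I x y 0) + (\<Sum>i<n. mass (nlang k I x y (Suc i)))"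
      by (rule sum.lessThan_Suc_shift)
    also have "(\<Sum>i<n. mass (nlang k I x y (Suc i))) = (\<Sum>z\<in>?N \<inter> I. ennreal (1 / 4) * (\<Sum>i<n. mass (nlang k I z y i)))"
      unfolding mass_nlang_Suc[OF assms(1) Suc.prems] sum_distrib_left by (rule sum.swap)
    also have "\<dots> \<le> (\<Sum>z\<in>?N \<inter> I. ennreal (1 / 4) * 1)"
      by (intro sum_mono mult_left_mono Suc.IH) (auto dest: adj_vertices)
    also have "mass (nlang k I x y 0) + \<dots> = (\<Sum>z\<in>?N \<inter> {y}. ennreal (1 / 4)) + (\<Sum>z\<in>?N \<inter> I. ennreal (1 / 4))"
      unfolding mass_nlang_0[OF assms(1) Suc.prems] by simp
    also have "\<dots> = (\<Sum>z\<in>(?N \<inter> {y}) \<union> (?N \<inter> I). ennreal (1 / 4))"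
      by (rule sum.union_disjoint[symmetric]) (use assms(3) in auto)
    also have "\<dots> \<le> (\<Sum>z\<in>?N. ennreal (1 / 4))" by (intro sum_mono2) auto
    also have "\<dots> = ennreal (card ?N * (1 / 4))" by (simp add: ennreal_of_nat_eq_real_of_nat flip: ennreal_mult)
    also have "\<dots> \<le> 1" using card_nbr[of k x] by (auto intro!: ennreal_leI simp flip: ennreal_1)
    finally show ?case by (simp add: add_left_mono)
  qed simp
  then show ?thesis unfolding mass_lang_suminf suminf_eq_SUP by (rule SUP_least)
qed

section \<open>Decompositions at the last visit\<close>

lemma lang_split:
  assumes "pre \<noteq> []" "us \<noteq> []"
  shows "pre @ us \<in> lang k I x y \<longleftrightarrow>
    pre \<in> lang k I x (last (last pre)) \<and> last (last pre) \<in> I \<and> us \<in> lang k I (last (last pre)) y"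
  using assms(1)
proof (induction pre arbitrary: x)
  case (Cons t pre)
  show ?case
  proof (cases "pre = []")
    case True
    then show ?thesis using assms(2) by (simp add: lang_Cons)
  next
    case False
    then show ?thesis using Cons.IH[OF False, of "last t"] by (simp add: lang_Cons)
  qed
qed simp

lemma lang_mono: "I \<subseteq> I' \<Longrightarrow> lang k I x y \<subseteq> lang k I' x y"
  unfolding lang_def by blast

text \<open>Cut at the last visit to \<open>m\<close>.\<close>

lemma lang_last_visit:
  assumes "m \<in> I" "m \<noteq> y"
  shows "lang k I x y = lang k (I - {m}) x y \<union> conc (lang k I x m) (lang k (I - {m}) m y)"
    and "lang k (I - {m}) x y \<inter> conc (lang k I x m) (lang k (I - {m}) m y) = {}"
proof -
  show "lang k (I - {m}) x y \<inter> conc (lang k I x m) (lang k (I - {m}) m y) = {}"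
  proof (intro equals0I, elim IntE)
    fix ts assume 1: "ts \<in> lang k (I - {m}) x y" and "ts \<in> conc (lang k I x m) (lang k (I - {m}) m y)"
    then obtain a b where ab: "ts = a @ b" "a \<in> lang k I x m" "b \<in> lang k (I - {m}) m y"
      unfolding conc_def by blast
    then have "last (last a) \<in> I - {m}" using 1 lang_split[of a b k "I - {m}" x y] lang_last(2) by blast
    then show False using lang_last(1)[OF ab(2)] by simp
  qed
  show "lang k I x y = lang k (I - {m}) x y \<union> conc (lang k I x m) (lang k (I - {m}) m y)"
  proof (intro equalityI subsetI)
    fix ts assume ts: "ts \<in> lang k I x y"
    obtain pre where pre: "ts = pre @ after m ts" "pre = [] \<or> last (last pre) = m" by (rule after_split)
    have ne: "after m ts \<noteq> []"
    proof
      assume "after m ts = []"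
      then show False using pre lang_last[OF ts] assms(2) by auto
    qed
    have av: "last ` set (butlast (after m ts)) \<subseteq> - {m}"
      using after_avoids[of _ m ts] by (auto dest: in_set_butlastD)
    show "ts \<in> lang k (I - {m}) x y \<union> conc (lang k I x m) (lang k (I - {m}) m y)"
    proof (cases "pre = []")
      case True
      then have "ts = after m ts" using pre by simp
      then have "last ` set (butlast ts) \<subseteq> - {m}" using av by simp
      then show ?thesis using ts unfolding lang_def by blast
    next
      case False
      then have "pre \<in> lang k I x m" "after m ts \<in> lang k I m y"
        using lang_split[OF False ne] ts pre by metis+
      moreover from this(2) av have "after m ts \<in> lang k (I - {m}) m y" unfolding lang_def by blast
      ultimately show ?thesis using concI[of pre _ "after m ts"] pre(1) by auto
    qed
  next
    fix ts assume "ts \<in> lang k (I - {m}) x y \<union> conc (lang k I x m) (lang k (I - {m}) m y)"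
    then show "ts \<in> lang k I x y"
    proof
      assume "ts \<in> lang k (I - {m}) x y" then show ?thesis using lang_mono[of "I - {m}" I] by blast
    next
      assume "ts \<in> conc (lang k I x m) (lang k (I - {m}) m y)"
      then obtain a b where ab: "ts = a @ b" "a \<in> lang k I x m" "b \<in> lang k (I - {m}) m y"
        unfolding conc_def by blast
      then have "b \<in> lang k I m y" using lang_mono[of "I - {m}" I] by blast
      then show ?thesis unfolding ab(1)
        using ab lang_split[of a b k I x y] lang_last[OF ab(2)] lang_last(2)[OF ab(3)] assms(1) by simp
    qed
  qed
qed

lemma conc_after_unique:
  fixes a b :: "path list"
  assumes "a = [] \<or> last (last a) = m" "a' = [] \<or> last (last a') = m"
    "\<forall>t\<in>set b. last t \<noteq> m" "\<forall>t\<in>set b'. last t \<noteq> m" "a @ b = a' @ b'"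
  shows "a = a'"
  using after_eq[OF assms(1,3)] after_eq[OF assms(2,4)] assms(5) by auto

lemma lang_avoids:
  assumes "ts \<in> lang k I x y" "m \<notin> I" "m \<noteq> y"
  shows "\<forall>t\<in>set ts. last t \<noteq> m"
proof
  fix t assume "t \<in> set ts"
  moreover have "ts = butlast ts @ [last ts]" using lang_last(2)[OF assms(1)] by simp
  ultimately have "t \<in> set (butlast ts) \<or> t = last ts" by (metis UnE append_Nil in_set_conv_decomp list.set(1) set_ConsD set_append empty_iff)
  then show "last t \<noteq> m" using assms unfolding lang_def by auto
qed

lemma mass_last_visit:
  assumes "m \<in> I" "m \<noteq> y"
  shows "mass (lang k I x y) = mass (lang k (I - {m}) x y) + mass (lang k I x m) * mass (lang k (I - {m}) m y)"
proof -
  have "mass (conc (lang k I x m) (lang k (I - {m}) m y)) = mass (lang k I x m) * mass (lang k (I - {m}) m y)"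
  proof (rule mass_conc)
    fix a b a' b' assume *: "a \<in> lang k I x m" "a' \<in> lang k I x m" "b \<in> lang k (I - {m}) m y" "b' \<in> lang k (I - {m}) m y"
      "a @ b = a' @ b'"
    show "a = a'"
      by (rule conc_after_unique[of a m a' b b'])
        (use *(5) lang_last(1)[OF *(1)] lang_last(1)[OF *(2)] lang_avoids[OF *(3), of m] lang_avoids[OF *(4), of m] assms(2) in auto)
  qed
  then show ?thesis using lang_last_visit[OF assms, of k x] by (simp add: mass_Un)
qed

text \<open>The empty list stands for the walk that does not move.\<close>

definition loops :: "nat \<Rightarrow> point set \<Rightarrow> point \<Rightarrow> path list set" where
  "loops k I x = insert [] (lang k I x x)"

lemma mass_loops: "mass (loops k I x) = 1 + mass (lang k I x x)"
proof -
  have "loops k I x = {[]} \<union> lang k I x x" "{[]} \<inter> lang k I x x = {}"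
    by (auto simp: loops_def lang_def)
  then have "mass (loops k I x) = mass {[]} + mass (lang k I x x)" by (simp only: mass_Un)
  then show ?thesis by (simp add: mass_single weight_def)
qed

lemma mass_from_loops:
  assumes "m \<in> I" "m \<noteq> y"
  shows "mass (lang k I m y) = mass (loops k I m) * mass (lang k (I - {m}) m y)"
  using mass_last_visit[OF assms, of k m] by (simp add: mass_loops distrib_right)

section \<open>Coarse steps as fine walks\<close>

definition off_grid :: "nat \<Rightarrow> point set" where
  "off_grid k = - gasket_vertices (Suc k)"

text \<open>Vertices of scale \<open>k + 1\<close> are also vertices of scale \<open>k\<close>, so a
  path meets them only at the ends of its steps of scale \<open>k\<close>.\<close>

lemma coarse_step_iff:
  assumes "steps k x ts" "ts \<noteq> []" "y \<in> gasket_vertices (Suc k)" "y \<noteq> x" "last (last ts) = y"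
  shows "is_step (Suc k) x (concat ts) \<longleftrightarrow> last ` set (butlast ts) \<subseteq> off_grid k \<union> {x}"
proof -
  obtain as t where ts: "ts = as @ [t]" using assms(2) by (cases ts rule: rev_cases) auto
  have st: "steps k x as" "is_step k (last (skel x as)) t" using assms(1) unfolding ts steps_append by simp_all
  have t: "t \<noteq> []" "last t = y" using st(2) assms(5) ts by (auto simp: is_step_def)
  have bl: "butlast (concat ts) = concat as @ butlast t" using t(1) by (simp add: ts butlast_append)
  have l: "last (concat ts) = y" "concat ts \<noteq> []" using t by (simp_all add: ts)
  have sub: "gasket_vertices (Suc k) \<subseteq> gasket_vertices k" by (rule gasket_vertices_Suc)
  have "set (butlast (concat ts)) \<inter> gasket_vertices (Suc k) \<subseteq> {x} \<longleftrightarrow> last ` set as \<subseteq> off_grid k \<union> {x}"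
  proof
    assume *: "set (butlast (concat ts)) \<inter> gasket_vertices (Suc k) \<subseteq> {x}"
    have "last ` set as \<subseteq> set (concat as)" using skel_subset[OF st(1)] by simp
    then show "last ` set as \<subseteq> off_grid k \<union> {x}" using * unfolding bl off_grid_def by auto
  next
    assume *: "last ` set as \<subseteq> off_grid k \<union> {x}"
    have 1: "set (concat as) \<inter> gasket_vertices (Suc k) \<subseteq> {x}"
      using steps_vertices[OF st(1)] sub * unfolding off_grid_def by auto
    have "last (skel x as) \<in> set (skel x as)" by (rule last_in_set) simp
    then have "last (skel x as) \<in> off_grid k \<union> {x}" using * by auto
    moreover have "set (butlast t) \<inter> gasket_vertices (Suc k) \<subseteq> {last (skel x as)}"
      using st(2) sub unfolding is_step_def by blast
    ultimately have "set (butlast t) \<inter> gasket_vertices (Suc k) \<subseteq> {x}" unfolding off_grid_def by blast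
    with 1 show "set (butlast (concat ts)) \<inter> gasket_vertices (Suc k) \<subseteq> {x}" unfolding bl by auto
  qed
  then show ?thesis using l assms(3,4) by (simp add: is_step_def ts)
qed

lemma coarse_step_lang:
  assumes "y \<in> gasket_vertices (Suc k)" "y \<noteq> x"
  shows "bij_betw (\<lambda>ts. [concat ts]) (lang k (off_grid k \<union> {x}) x y) (one_step (Suc k) x y)"
  unfolding bij_betw_def
proof (intro conjI equalityI subsetI inj_onI)
  fix ts us assume "ts \<in> lang k (off_grid k \<union> {x}) x y" "us \<in> lang k (off_grid k \<union> {x}) x y" "[concat ts] = [concat us]"
  then show "ts = us" using steps_unique[of k x ts us] by (simp add: lang_def)
next
  fix l assume "l \<in> (\<lambda>ts. [concat ts]) ` lang k (off_grid k \<union> {x}) x y"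
  then obtain ts where l: "l = [concat ts]" "ts \<in> lang k (off_grid k \<union> {x}) x y" by blast
  then have ts: "steps k x ts" "walk x ts" "ts \<noteq> []" "last (last ts) = y" "last ` set (butlast ts) \<subseteq> off_grid k \<union> {x}"
    by (auto simp: lang_def)
  have "last (x # concat ts) = y" using last_skel[OF ts(1)] ts(3,4) by (simp add: last_map)
  moreover have "is_step (Suc k) x (concat ts)" using coarse_step_iff[OF ts(1,3) assms ts(4)] ts(5) by simp
  ultimately show "l \<in> one_step (Suc k) x y"
    unfolding one_step_iff l(1) using ts(2) by (auto simp: walk_def is_step_def)
next
  fix l assume "l \<in> one_step (Suc k) x y"
  then obtain t where t: "l = [t]" "is_step (Suc k) x t" "successively (adj 0) (x # t)" "last t = y"
    unfolding one_step_iff by blast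
  have "steps (Suc k) x [t]" using t(2) by simp
  then obtain ts where ts: "steps k x ts" "concat ts = t" using steps_refine[of k x "[t]"] by auto
  have tn: "ts \<noteq> []" using ts(2) t(2) by (auto simp: is_step_def)
  have "last (x # concat ts) = y" using ts(2) t(2,4) by (simp add: is_step_def)
  then have "last (last ts) = y" using last_skel[OF ts(1)] tn by (simp add: last_map)
  moreover from coarse_step_iff[OF ts(1) tn assms this] have "last ` set (butlast ts) \<subseteq> off_grid k \<union> {x}"
    using ts(2) t(2) by simp
  ultimately have "ts \<in> lang k (off_grid k \<union> {x}) x y" using ts t(3) tn by (simp add: lang_def walk_def)
  then show "l \<in> (\<lambda>ts. [concat ts]) ` lang k (off_grid k \<union> {x}) x y" using t(1) ts(2) by blast
qed

lemma mass_coarse_step: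
  assumes "y \<in> gasket_vertices (Suc k)" "y \<noteq> x"
  shows "mass (one_step (Suc k) x y) = mass (lang k (off_grid k \<union> {x}) x y)"
  unfolding mass_eq nn_integral_bij_count_space[OF coarse_step_lang[OF assms], symmetric]
  by (simp add: weight_def[abs_def])

section \<open>Harmonic potentials and decimation invariance\<close>

text \<open>The probability that simple random walk on the grid of scale \<open>k\<close>, started
  at \<open>x\<close>, reaches \<open>y\<close> through vertices of \<open>I\<close>.\<close>

definition hitting :: "nat \<Rightarrow> point set \<Rightarrow> point \<Rightarrow> point \<Rightarrow> real" where
  "hitting k I x y = enn2real (mass (lang k I x y))"

text \<open>Hitting probabilities extended by their boundary values, so that
  \<open>hitting_step\<close> becomes the mean value property.\<close>

definition potential :: "nat \<Rightarrow> point set \<Rightarrow> point \<Rightarrow> point \<Rightarrow> real" where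
  "potential k I y z = (if z = y then 1 else if z \<in> I then hitting k I z y else 0)"

lemma mass_hitting:
  assumes "decimates k" "x \<in> gasket_vertices k" "y \<notin> I"
  shows "mass (lang k I x y) = ennreal (hitting k I x y)"
  unfolding hitting_def using mass_lang_le_1[OF assms]
  by (metis ennreal_enn2real ennreal_one_less_top order_le_less_trans)

lemma hitting_step:
  assumes "decimates k" "x \<in> gasket_vertices k" "y \<notin> I"
  shows "4 * hitting k I x y = (\<Sum>z\<in>{z. adj k x z}. potential k I y z)"
proof -
  let ?N = "{z. adj k x z}"
  have nn: "hitting k I z y \<ge> 0" for z by (simp add: hitting_def)
  have "mass (lang k I x y) = (if adj k x y then ennreal (1 / 4) else 0) + (\<Sum>z\<in>?N \<inter> I. ennreal (1 / 4 * hitting k I z y))"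
    unfolding mass_lang_first_step[OF assms(1,2)]
  proof (intro arg_cong2[of _ _ _ _ "(+)"] refl sum.cong)
    fix z assume "z \<in> ?N \<inter> I"
    then have "z \<in> gasket_vertices k" using adj_vertices by blast
    from mass_hitting[OF assms(1) this assms(3)]
    show "ennreal (1 / 4) * mass (lang k I z y) = ennreal (1 / 4 * hitting k I z y)"
      by (simp only: ennreal_mult[of "1 / 4", OF _ nn])
  qed
  also have "\<dots> = ennreal ((if adj k x y then 1 / 4 else 0) + (\<Sum>z\<in>?N \<inter> I. 1 / 4 * hitting k I z y))"
    using nn by (simp add: sum_nonneg flip: ennreal_plus)
  also have "(if adj k x y then 1 / 4 else 0) + (\<Sum>z\<in>?N \<inter> I. 1 / 4 * hitting k I z y)
      = (\<Sum>z\<in>?N. if z = y then 1 / 4 else 0) + (\<Sum>z\<in>?N. if z \<in> I then 1 / 4 * hitting k I z y else 0)"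
    by (simp only: sum.inter_restrict[OF finite_nbr]) simp
  also have "\<dots> = (\<Sum>z\<in>?N. potential k I y z / 4)"
    unfolding sum.distrib[symmetric] by (rule sum.cong) (use assms(3) in \<open>auto simp: potential_def\<close>)
  finally have "ennreal (hitting k I x y) = ennreal ((\<Sum>z\<in>?N. potential k I y z) / 4)"
    unfolding mass_hitting[OF assms] sum_divide_distrib .
  moreover have "(\<Sum>z\<in>?N. potential k I y z) \<ge> 0" using nn by (intro sum_nonneg) (simp add: potential_def)
  ultimately show ?thesis using nn by simp
qed

lemma mid_vertex: "frame k c d e \<Longrightarrow> mid c d \<in> gasket_vertices k"
proof -
  assume "frame k c d e"
  then have "adj k (mid c d) c" using nbr_mid[of k c d e] by blast
  then show ?thesis using adj_vertices by blast
qed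

lemma hitting_mid:
  assumes "decimates k" "frame k c d e" "y \<notin> I"
  shows "4 * hitting k I (mid c d) y = potential k I y c + potential k I y d + potential k I y (mid c e) + potential k I y (mid d e)"
  using hitting_step[OF assms(1) mid_vertex[OF assms(2)] assms(3)] frame_distinct[OF assms(2)]
  unfolding nbr_mid[OF assms(2)] by (simp add: algebra_simps)

lemma hitting_corner:
  assumes "decimates k" "frame k c d e" "frame k c d' e'" "{d, e} \<noteq> {d', e'}" "y \<notin> I"
  shows "4 * hitting k I c y = potential k I y (mid c d) + potential k I y (mid c e) + potential k I y (mid c d') + potential k I y (mid c e')"
proof -
  have "c \<in> gasket_vertices k" using frame_vertices(1)[OF assms(2)] gasket_vertices_Suc by blast
  from hitting_step[OF assms(1) this assms(5)] nbr_corner(2)[OF assms(2-4)]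
  show ?thesis unfolding nbr_corner(1)[OF assms(2-4)] by (simp add: algebra_simps del: mid_inject)
qed

lemma potential_in: "z \<in> I \<Longrightarrow> y \<notin> I \<Longrightarrow> potential k I y z = hitting k I z y"
  by (auto simp: potential_def)

lemma potential_out: "z \<notin> I \<Longrightarrow> z \<noteq> y \<Longrightarrow> potential k I y z = 0"
  by (auto simp: potential_def)

lemma potential_target: "potential k I y y = 1"
  by (simp add: potential_def)

text \<open>Eliminating the other two midpoints from their three mean value equations gives the 2/5
  - 2/5 - 1/5 rule for harmonic functions on the gasket.\<close>

lemma potential_mid:
  assumes "decimates k" "frame k c d e" "y \<notin> I" "mid c d \<in> I" "mid c e \<in> I" "mid d e \<in> I"
  shows "5 * potential k I y (mid c d) = 2 * potential k I y c + 2 * potential k I y d + potential k I y e"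
proof -
  note f1 = assms(2) and f2 = frame_perm(2)[OF assms(2)] and f3 = frame_perm(2)[OF frame_perm(1)[OF assms(2)]]
  have "4 * potential k I y (mid c d) = potential k I y c + potential k I y d + potential k I y (mid c e) + potential k I y (mid d e)"
    using hitting_mid[OF assms(1) f1 assms(3)] assms(3,4) by (simp add: potential_in)
  moreover have "4 * potential k I y (mid c e) = potential k I y c + potential k I y e + potential k I y (mid c d) + potential k I y (mid d e)"
    using hitting_mid[OF assms(1) f2 assms(3)] assms(3,5) by (simp add: potential_in mid_commute)
  moreover have "4 * potential k I y (mid d e) = potential k I y d + potential k I y e + potential k I y (mid c d) + potential k I y (mid c e)"
    using hitting_mid[OF assms(1) f3 assms(3)] assms(3,6) by (simp add: potential_in mid_commute)
  ultimately show ?thesis by linarith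
qed

lemma mid_off_grid:
  assumes "frame k c d e" shows "mid c d \<in> off_grid k" "mid c e \<in> off_grid k" "mid d e \<in> off_grid k"
  using frame_vertices[OF assms] by (simp_all add: off_grid_def)

lemma corner_on_grid:
  assumes "frame k c d e" shows "c \<notin> off_grid k" "d \<notin> off_grid k" "e \<notin> off_grid k"
  using frame_vertices(1)[OF assms] by (simp_all add: off_grid_def)

text \<open>By symmetry a walk from \<open>x\<close> that may return to \<open>x\<close> reaches
  each of the four neighbours of scale \<open>k + 1\<close> with probability 1/4. The computation
  sees the five harmonic equations at \<open>x\<close> and at the four midpoints next to it.\<close>

lemma hitting_through:
  assumes "decimates k" "frame k x p q"
  shows "hitting k (off_grid k \<union> {x}) x p = 1 / 4"
proof -
  let ?I = "off_grid k \<union> {x}" let ?h = "potential k ?I p"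
  obtain d e where f': "frame k x d e" "{p, q} \<noteq> {d, e}" "{d, e} \<inter> {p, q} = {}" by (rule other_frame[OF assms(2)])
  note ds = frame_distinct[OF assms(2)] frame_distinct[OF f'(1)]
  note c = corner_on_grid[OF assms(2)] corner_on_grid[OF f'(1)]
  note m = mid_off_grid[OF assms(2)] mid_off_grid[OF f'(1)]
  have y: "p \<notin> ?I" using c ds by auto
  have h: "?h q = 0" "?h d = 0" "?h e = 0"
    by (rule potential_out; use c ds f'(3) in auto)+
  have hx: "?h x = hitting k ?I x p" by (rule potential_in) (use y in auto)
  have "5 * ?h (mid x p) = 2 * ?h x + 2 * ?h p + ?h q"
    by (rule potential_mid[OF assms]) (use y m in auto)
  moreover have "5 * ?h (mid x q) = 2 * ?h x + 2 * ?h q + ?h p"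
    by (rule potential_mid[OF assms(1) frame_perm(2)[OF assms(2)]]) (use y m in \<open>auto simp: mid_commute\<close>)
  moreover have "5 * ?h (mid x d) = 2 * ?h x + 2 * ?h d + ?h e"
    by (rule potential_mid[OF assms(1) f'(1)]) (use y m in auto)
  moreover have "5 * ?h (mid x e) = 2 * ?h x + 2 * ?h e + ?h d"
    by (rule potential_mid[OF assms(1) frame_perm(2)[OF f'(1)]]) (use y m in \<open>auto simp: mid_commute\<close>)
  moreover have "4 * ?h x = ?h (mid x p) + ?h (mid x q) + ?h (mid x d) + ?h (mid x e)"
    unfolding hx by (rule hitting_corner[OF assms f'(1,2) y])
  ultimately have "4 * ?h x = 1" using h potential_target[of k ?I p] by linarith
  then show ?thesis unfolding hx by simp
qed

lemma adj_frame: "adj (Suc k) x z \<Longrightarrow> \<exists>w. frame k x z w"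
proof -
  assume "adj (Suc k) x z"
  then obtain v where v: "v \<in> cells (Suc k)" "x \<in> corners (Suc k) v" "z \<in> corners (Suc k) v" "x \<noteq> z"
    unfolding adj_iff by blast
  obtain d e where f: "frame k x d e" "corners (Suc k) v = {x, d, e}" by (rule frame_exists[OF v(1,2)])
  then have "z = d \<or> z = e" using v by auto
  then show ?thesis using f(1) frame_perm(2)[OF f(1)] by blast
qed

text \<open>Decimation: a step of scale \<open>k + 1\<close> is a walk of scale \<open>k\<close>
  that may return to its start, and \<open>hitting_through\<close> computes its mass from that of
  the steps of scale \<open>k\<close>.\<close>

lemma decimates: "decimates k"
proof (induction k)
  case 0
  show ?case unfolding decimates_def
  proof (intro allI impI)
    fix x z assume a: "adj 0 x z"
    then have x: "x \<in> gasket_vertices 0" "z \<in> gasket_vertices 0" "x \<noteq> z" using adj_vertices by (auto simp: adj_iff)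
    have "one_step 0 x z = {[[z]]}"
    proof (intro equalityI subsetI)
      fix l assume "l \<in> one_step 0 x z"
      then obtain t where t: "l = [t]" "is_step 0 x t" "successively (adj 0) (x # t)" "last t = z"
        unfolding one_step_iff by blast
      then show "l \<in> {[[z]]}" using is_step_0[OF t(3,2) x(1)] by simp
    next
      fix l assume "l \<in> {[[z]]}"
      then show "l \<in> one_step 0 x z" using a x unfolding one_step_iff by (auto simp: is_step_def)
    qed
    then show "mass (one_step 0 x z) = ennreal (1 / 4)" by (simp add: mass_single weight_def)
  qed
next
  case (Suc k)
  show ?case unfolding decimates_def
  proof (intro allI impI)
    fix x z assume a: "adj (Suc k) x z"
    then obtain w where f: "frame k x z w" using adj_frame by blast
    have x: "x \<in> gasket_vertices k" using adj_vertices[OF a] gasket_vertices_Suc by blast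
    have z: "z \<in> gasket_vertices (Suc k)" "z \<noteq> x" using a adj_vertices by (auto simp: adj_iff)
    have "mass (one_step (Suc k) x z) = mass (lang k (off_grid k \<union> {x}) x z)" by (rule mass_coarse_step[OF z])
    also have "\<dots> = ennreal (hitting k (off_grid k \<union> {x}) x z)"
      by (rule mass_hitting[OF Suc x]) (use z in \<open>simp add: off_grid_def\<close>)
    finally show "mass (one_step (Suc k) x z) = ennreal (1 / 4)" unfolding hitting_through[OF Suc f] .
  qed
qed

section \<open>Masses of walks inside one triangle\<close>

text \<open>Midpoints of different triangles are different, since triangles meet only in
  corners.\<close>

lemma frame_mids_differ:
  assumes "frame k c d e" "frame k c' d' e'" "{c, d, e} \<noteq> {c', d', e'}"
  shows "mid c d \<noteq> mid c' d'"
proof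
  assume e: "mid c d = mid c' d'"
  obtain v where v: "v \<in> cells (Suc k)" "corners (Suc k) v = {c, d, e}" using assms(1) by (auto simp: frame_def)
  obtain v' where v': "v' \<in> cells (Suc k)" "corners (Suc k) v' = {c', d', e'}" using assms(2) by (auto simp: frame_def)
  have "v \<noteq> v'" using v v' assms(3) by metis
  have "mid c d \<in> tri (Suc k) v" "mid c' d' \<in> tri (Suc k) v'"
    using mid_not_vertex(1)[OF v(1), of c d] mid_not_vertex(1)[OF v'(1), of c' d'] v v' assms by (simp_all add: frame_def)
  then have "mid c d \<in> corners (Suc k) v" using tri_Int_tri(1)[OF v(1) v'(1) \<open>v \<noteq> v'\<close>] e by simp
  then show False using frame_vertices(2)[OF assms(1)] gasket_verticesI[OF v(1)] by blast
qed

lemma hitting_off_grid: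
  assumes "frame k x p q"
  shows "hitting k (off_grid k) (mid x p) p = 2 / 5" "hitting k (off_grid k) (mid x q) p = 1 / 5"
    "hitting k (off_grid k) x p = 3 / 20"
proof -
  let ?I = "off_grid k" let ?h = "potential k ?I p"
  note dec = decimates[of k]
  obtain d e where f': "frame k x d e" "{p, q} \<noteq> {d, e}" "{d, e} \<inter> {p, q} = {}" by (rule other_frame[OF assms])
  note ds = frame_distinct[OF assms] frame_distinct[OF f'(1)]
  note c = corner_on_grid[OF assms] corner_on_grid[OF f'(1)]
  note m = mid_off_grid[OF assms] mid_off_grid[OF f'(1)]
  have h: "?h x = 0" "?h q = 0" "?h d = 0" "?h e = 0"
    by (rule potential_out; use c ds f'(3) in auto)+
  have "5 * ?h (mid x p) = 2 * ?h x + 2 * ?h p + ?h q"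
    by (rule potential_mid[OF dec assms c(2)]) (use m in auto)
  moreover have "5 * ?h (mid x q) = 2 * ?h x + 2 * ?h q + ?h p"
    by (rule potential_mid[OF dec frame_perm(2)[OF assms] c(2)]) (use m in \<open>auto simp: mid_commute\<close>)
  moreover have "5 * ?h (mid x d) = 2 * ?h x + 2 * ?h d + ?h e"
    by (rule potential_mid[OF dec f'(1) c(2)]) (use m in auto)
  moreover have "5 * ?h (mid x e) = 2 * ?h x + 2 * ?h e + ?h d"
    by (rule potential_mid[OF dec frame_perm(2)[OF f'(1)] c(2)]) (use m in \<open>auto simp: mid_commute\<close>)
  moreover have "4 * hitting k ?I x p = ?h (mid x p) + ?h (mid x q) + ?h (mid x d) + ?h (mid x e)"
    by (rule hitting_corner[OF dec assms f'(1,2) c(2)])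
  moreover have "?h (mid x p) = hitting k ?I (mid x p) p" "?h (mid x q) = hitting k ?I (mid x q) p"
    by (rule potential_in[OF _ c(2)], use m in simp)+
  ultimately have "5 * hitting k ?I (mid x p) p = 2" "5 * hitting k ?I (mid x q) p = 1" "20 * hitting k ?I x p = 3"
    using h potential_target[of k ?I p] by linarith+
  then show "hitting k (off_grid k) (mid x p) p = 2 / 5" "hitting k (off_grid k) (mid x q) p = 1 / 5"
    "hitting k (off_grid k) x p = 3 / 20" by simp_all
qed

lemma ennreal_factor:
  assumes "a * ennreal b = ennreal c" "b > 0" "c \<ge> 0"
  shows "a = ennreal (c / b)"
proof (cases a)
  case (real r)
  then have "ennreal (r * b) = ennreal c" using assms by (simp add: ennreal_mult)
  then have "r * b = c" using real assms by simp
  then have "r = c / b" using assms(2) by (simp add: field_simps)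
  then show ?thesis using real by simp
next
  case top
  then show ?thesis using assms by (simp add: ennreal_top_mult)
qed

text \<open>Cutting at the last visit to \<open>m\<close> shows that the mass of the loops at
  \<open>m\<close> is the quotient of the hitting masses with and without returns to
  \<open>m\<close>.\<close>

lemma mass_loops_eq:
  assumes "m \<in> I" "y \<notin> I" "m \<in> gasket_vertices k" "hitting k (I - {m}) m y > 0"
  shows "mass (loops k I m) = ennreal (hitting k I m y / hitting k (I - {m}) m y)"
proof (rule ennreal_factor[OF _ assms(4)])
  have "m \<noteq> y" using assms(1,2) by blast
  from mass_from_loops[OF assms(1) this, of k]
  show "mass (loops k I m) * ennreal (hitting k (I - {m}) m y) = ennreal (hitting k I m y)"
    using mass_hitting[OF decimates assms(3,2)] mass_hitting[OF decimates assms(3), of y "I - {m}"] assms(2) by simp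
  show "0 \<le> hitting k I m y" by (simp add: hitting_def)
qed

lemma mass_loops_start:
  assumes "frame k x p q"
  shows "mass (loops k (off_grid k \<union> {x}) x) = ennreal (5 / 3)"
proof -
  note c = corner_on_grid[OF assms] and ds = frame_distinct[OF assms]
  have e: "off_grid k \<union> {x} - {x} = off_grid k" using c by auto
  have "x \<in> gasket_vertices k" using frame_vertices(1)[OF assms] gasket_vertices_Suc by blast
  moreover have "p \<notin> off_grid k \<union> {x}" using c ds by auto
  \<comment> \<open>The return probability 2/5 of the walk killed at the outer corners appears as the
    Green function 5/3.\<close>
  ultimately have "mass (loops k (off_grid k \<union> {x}) x) = ennreal ((1 / 4) / (3 / 20))"
    using mass_loops_eq[of x "off_grid k \<union> {x}" p k]
    unfolding e hitting_off_grid(3)[OF assms] hitting_through[OF decimates assms] by simp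
  then show ?thesis by simp
qed

text \<open>The mass of walks that make loops at \<open>m\<close>, and from another point
  \<open>m'\<close> reach \<open>y\<close> without visiting \<open>m\<close>. It occurs when the
  loop erasure contains a step from \<open>m\<close> to \<open>m'\<close>.\<close>

lemma loops_then:
  assumes "hitting k (I - {m}) m y = b" "hitting k I m y = c" "hitting k (I - {m}) m' y = d" "b > 0" "r = c / b * d"
    and "m \<in> I" "y \<notin> I" "m \<in> gasket_vertices k" "m' \<in> gasket_vertices k"
  shows "mass (loops k I m) * mass (lang k (I - {m}) m' y) = ennreal r"
proof -
  have y: "y \<notin> I - {m}" using assms(7) by simp
  have "c \<ge> 0" "d \<ge> 0" using assms(2,3) by (auto simp: hitting_def)
  moreover have "mass (loops k I m) = ennreal (c / b)"
    using mass_loops_eq[OF assms(6,7,8)] assms(1,2,4) by simp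
  moreover have "mass (lang k (I - {m}) m' y) = ennreal d"
    using mass_hitting[OF decimates assms(9) y] assms(3) by simp
  ultimately show ?thesis using assms(4) unfolding assms(5) by (simp only: ennreal_mult divide_nonneg_pos)
qed

text \<open>Masses of the loops at one midpoint and of the walks from the other midpoint that avoid
  the first, for the two possible orders of the midpoints next to \<open>x\<close>; the target is
  the corner \<open>p\<close>.\<close>

lemma walk_mids:
  assumes "frame k x p q"
  shows "mass (loops k (off_grid k) (mid x q)) * mass (lang k (off_grid k - {mid x q}) (mid x p) p) = ennreal (2 / 5)"
    and "mass (loops k (off_grid k) (mid x p)) * mass (lang k (off_grid k - {mid x p}) (mid x q) p) = ennreal (2 / 25)"
proof -
  note dec = decimates[of k]
  note f2 = frame_perm(2)[OF assms] and f3 = frame_perm(2)[OF frame_perm(1)[OF assms]]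
  note ds = frame_distinct[OF assms] and c = corner_on_grid[OF assms] and m = mid_off_grid[OF assms]
  note v = mid_vertex[OF assms] mid_vertex[OF f2] mid_vertex[OF f3]
  {
    let ?m = "mid x q" let ?I = "off_grid k - {?m}" let ?h = "potential k ?I p"
    have y: "p \<notin> ?I" using c by simp
    have h: "?h x = 0" "?h q = 0" "?h ?m = 0" by (rule potential_out; use c ds in auto)+
    have i: "?h (mid x p) = hitting k ?I (mid x p) p" "?h (mid p q) = hitting k ?I (mid p q) p"
      by (rule potential_in[OF _ y]; use m ds in auto)+
    have "4 * ?h (mid x p) = ?h x + ?h p + ?h ?m + ?h (mid p q)"
      unfolding i(1) by (rule hitting_mid[OF dec assms y])
    moreover have "4 * ?h (mid p q) = ?h p + ?h q + ?h (mid p x) + ?h (mid q x)"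
      unfolding i(2) by (rule hitting_mid[OF dec f3 y])
    moreover have "4 * hitting k ?I ?m p = ?h x + ?h q + ?h (mid x p) + ?h (mid q p)"
      by (rule hitting_mid[OF dec f2 y])
    ultimately have "3 * hitting k ?I (mid x p) p = 1" "6 * hitting k ?I ?m p = 1"
      using h potential_target[of k ?I p] unfolding mid_commute[of p x] mid_commute[of q x] mid_commute[of q p] i by linarith+
    then have vals: "hitting k ?I (mid x p) p = 1 / 3" "hitting k ?I ?m p = 1 / 6" by simp_all
    show "mass (loops k (off_grid k) ?m) * mass (lang k ?I (mid x p) p) = ennreal (2 / 5)"
      by (rule loops_then[OF vals(2) hitting_off_grid(2)[OF assms] vals(1)]) (use m v c in simp_all)
  }
  {
    let ?m = "mid x p" let ?I = "off_grid k - {?m}" let ?h = "potential k ?I p"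
    have y: "p \<notin> ?I" using c by simp
    have h: "?h x = 0" "?h q = 0" "?h ?m = 0" by (rule potential_out; use c ds in auto)+
    have i: "?h (mid x q) = hitting k ?I (mid x q) p" "?h (mid p q) = hitting k ?I (mid p q) p"
      by (rule potential_in[OF _ y]; use m ds in auto)+
    have "4 * ?h (mid x q) = ?h x + ?h q + ?h ?m + ?h (mid q p)"
      unfolding i(1) by (rule hitting_mid[OF dec f2 y])
    moreover have "4 * ?h (mid p q) = ?h p + ?h q + ?h (mid p x) + ?h (mid q x)"
      unfolding i(2) by (rule hitting_mid[OF dec f3 y])
    moreover have "4 * hitting k ?I ?m p = ?h x + ?h p + ?h (mid x q) + ?h (mid p q)"
      by (rule hitting_mid[OF dec assms y])
    ultimately have "15 * hitting k ?I (mid x q) p = 1" "3 * hitting k ?I ?m p = 1"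
      using h potential_target[of k ?I p] unfolding mid_commute[of p x] mid_commute[of q x] mid_commute[of q p] i by linarith+
    then have vals: "hitting k ?I (mid x q) p = 1 / 15" "hitting k ?I ?m p = 1 / 3" by simp_all
    show "mass (loops k (off_grid k) ?m) * mass (lang k ?I (mid x q) p) = ennreal (2 / 25)"
      by (rule loops_then[OF vals(2) hitting_off_grid(1)[OF assms] vals(1)]) (use m v c in simp_all)
  }
qed

text \<open>The same Dirichlet problem when the walk may also pass through the corner
  \<open>q\<close>.\<close>

lemma hitting_via:
  assumes "frame k x p q"
  shows "hitting k (off_grid k \<union> {q}) (mid x p) p = 9 / 20" "hitting k (off_grid k \<union> {q}) (mid x q) p = 3 / 10"
proof -
  let ?J = "off_grid k \<union> {q}" let ?h = "potential k ?J p"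
  note dec = decimates[of k]
  note f2 = frame_perm(2)[OF assms] and f3 = frame_perm(2)[OF frame_perm(1)[OF assms]]
  have fq: "frame k q p x" using frame_perm(1)[OF f3] frame_perm(1)[OF frame_perm(2)[OF f2]] by (metis frame_perm assms)
  note ds = frame_distinct[OF assms] and c = corner_on_grid[OF assms] and m = mid_off_grid[OF assms]
  have y: "p \<notin> ?J" using c ds by auto
  have hx: "?h x = 0" by (rule potential_out; use c ds in auto)
  have hq: "?h q = 1 / 4"
    using potential_in[of q ?J p k] y hitting_through[OF dec fq] by simp
  have "5 * ?h (mid x p) = 2 * ?h x + 2 * ?h p + ?h q"
    by (rule potential_mid[OF dec assms y]) (use m in auto)
  moreover have "5 * ?h (mid x q) = 2 * ?h x + 2 * ?h q + ?h p"
    by (rule potential_mid[OF dec f2 y]) (use m in \<open>auto simp: mid_commute\<close>)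
  moreover have "?h (mid x p) = hitting k ?J (mid x p) p" "?h (mid x q) = hitting k ?J (mid x q) p"
    by (rule potential_in[OF _ y], use m in simp)+
  ultimately have "20 * hitting k ?J (mid x p) p = 9" "10 * hitting k ?J (mid x q) p = 3"
    using hx hq potential_target[of k ?J p] by linarith+
  then show "hitting k ?J (mid x p) p = 9 / 20" "hitting k ?J (mid x q) p = 3 / 10" by simp_all
qed

text \<open>The analogue of \<open>walk_mids\<close> for walks that may pass through
  \<open>q\<close>, which adds the excursions from \<open>q\<close> into the neighbouring triangle
  to the linear system.\<close>

lemma walk_mids_via:
  assumes "frame k x p q"
  shows "mass (loops k (off_grid k \<union> {q}) (mid x q)) * mass (lang k (off_grid k \<union> {q} - {mid x q}) (mid x p) p) = ennreal (1 / 2)"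
    and "mass (loops k (off_grid k \<union> {q}) (mid x p)) * mass (lang k (off_grid k \<union> {q} - {mid x p}) (mid x q) p) = ennreal (7 / 50)"
proof -
  note dec = decimates[of k]
  note f2 = frame_perm(2)[OF assms] and f3 = frame_perm(2)[OF frame_perm(1)[OF assms]]
  have fq: "frame k q x p" using frame_perm(1)[OF f2] .
  have fqp: "frame k q p x" using frame_perm(2)[OF fq] .
  obtain d e where fo: "frame k q d e" "{x, p} \<noteq> {d, e}" "{d, e} \<inter> {x, p} = {}" by (rule other_frame[OF fq])
  note fo2 = frame_perm(2)[OF fo(1)] and fo3 = frame_perm(2)[OF frame_perm(1)[OF fo(1)]]
  note ds = frame_distinct[OF assms] frame_distinct[OF fo(1)]
  note c = corner_on_grid[OF assms] corner_on_grid[OF fo(1)] and m = mid_off_grid[OF assms]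
  note mo = mid_off_grid[OF fo(1)]
  note v = mid_vertex[OF assms] mid_vertex[OF f2] mid_vertex[OF f3]
  have sep: "mid q d \<noteq> m" "mid q e \<noteq> m" "mid d e \<noteq> m" if m: "m = mid x q \<or> m = mid x p" for m
  proof -
    have s: "{q, d, e} \<noteq> {x, q, p}" "{q, e, d} \<noteq> {x, q, p}" "{d, e, q} \<noteq> {x, q, p}"
      "{q, d, e} \<noteq> {x, p, q}" "{q, e, d} \<noteq> {x, p, q}" "{d, e, q} \<noteq> {x, p, q}"
      using fo(3) ds by auto
    show "mid q d \<noteq> m" using m frame_mids_differ[OF fo(1) f2 s(1)] frame_mids_differ[OF fo(1) assms s(4)] by auto
    show "mid q e \<noteq> m" using m frame_mids_differ[OF fo2 f2 s(2)] frame_mids_differ[OF fo2 assms s(5)] by auto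
    show "mid d e \<noteq> m" using m frame_mids_differ[OF fo3 f2 s(3)] frame_mids_differ[OF fo3 assms s(6)] by auto
  qed
  \<comment> \<open>From \<open>q\<close> the walk may make excursions into the neighbouring triangle, whose other corners have
    potential 0. There the midpoints next to \<open>q\<close> have 2/5 of the potential of \<open>q\<close>.\<close>
  have eqs: "5 * potential k I p (mid q d) = 2 * potential k I p q"  "5 * potential k I p (mid q e) = 2 * potential k I p q"
     "p \<notin> I" "potential k I p x = 0" "potential k I p m = 0" "potential k I p q = hitting k I q p"
    if m: "m = mid x q \<or> m = mid x p" and I: "I = off_grid k \<union> {q} - {m}" for m I
  proof -
    show y: "p \<notin> I" using c ds I by auto
    have m_ne: "m \<noteq> q" "m \<noteq> p" using m ds by auto
    have h0: "potential k I p d = 0" "potential k I p e = 0"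
      by (rule potential_out; use c ds fo(3) I in auto)+
    show "potential k I p x = 0" by (rule potential_out; use c ds I in auto)
    show "potential k I p m = 0" by (rule potential_out; use m_ne I in auto)
    show "potential k I p q = hitting k I q p" by (rule potential_in[OF _ y]) (use I m_ne in auto)
    have "5 * potential k I p (mid q d) = 2 * potential k I p q + 2 * potential k I p d + potential k I p e"
      by (rule potential_mid[OF dec fo(1) y]) (use mo sep[OF m] I in auto)
    then show "5 * potential k I p (mid q d) = 2 * potential k I p q" using h0 by simp
    have "5 * potential k I p (mid q e) = 2 * potential k I p q + 2 * potential k I p e + potential k I p d"
      by (rule potential_mid[OF dec fo2 y]) (use mo sep[OF m] I in \<open>auto simp: mid_commute\<close>)
    then show "5 * potential k I p (mid q e) = 2 * potential k I p q" using h0 by simp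
  qed
  note mc = mid_commute[of p x] mid_commute[of q x] mid_commute[of q p]
  {
    let ?m = "mid x q" let ?I = "off_grid k \<union> {q} - {?m}" let ?h = "potential k ?I p"
    note E = eqs[OF disjI1[OF refl] refl]
    have i: "?h (mid x p) = hitting k ?I (mid x p) p" "?h (mid p q) = hitting k ?I (mid p q) p"
      by (rule potential_in[OF _ E(3)]; use m ds in auto)+
    have "4 * ?h q = ?h (mid q x) + ?h (mid q p) + ?h (mid q d) + ?h (mid q e)"
      unfolding E(6) by (rule hitting_corner[OF dec fq fo(1,2) E(3)])
    moreover have "4 * ?h (mid x p) = ?h x + ?h p + ?h ?m + ?h (mid p q)"
      unfolding i(1) by (rule hitting_mid[OF dec assms E(3)])
    moreover have "4 * ?h (mid p q) = ?h p + ?h q + ?h (mid p x) + ?h (mid q x)"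
      unfolding i(2) by (rule hitting_mid[OF dec f3 E(3)])
    moreover have "4 * hitting k ?I ?m p = ?h x + ?h q + ?h (mid x p) + ?h (mid q p)"
      by (rule hitting_mid[OF dec f2 E(3)])
    ultimately have "44 * hitting k ?I (mid x p) p = 15" "44 * hitting k ?I ?m p = 9"
      using E(1,2,4,5) potential_target[of k ?I p] unfolding mc i by linarith+
    then have vals: "hitting k ?I (mid x p) p = 15 / 44" "hitting k ?I ?m p = 9 / 44" by simp_all
    show "mass (loops k (off_grid k \<union> {q}) ?m) * mass (lang k ?I (mid x p) p) = ennreal (1 / 2)"
      by (rule loops_then[OF vals(2) hitting_via(2)[OF assms] vals(1)]) (use m v c ds in simp_all)
  }
  {
    let ?m = "mid x p" let ?I = "off_grid k \<union> {q} - {?m}" let ?h = "potential k ?I p"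
    note E = eqs[OF disjI2[OF refl] refl]
    have i: "?h (mid x q) = hitting k ?I (mid x q) p" "?h (mid p q) = hitting k ?I (mid p q) p"
      by (rule potential_in[OF _ E(3)]; use m ds in auto)+
    have "4 * ?h q = ?h (mid q x) + ?h (mid q p) + ?h (mid q d) + ?h (mid q e)"
      unfolding E(6) by (rule hitting_corner[OF dec fq fo(1,2) E(3)])
    moreover have "4 * ?h (mid x q) = ?h x + ?h q + ?h ?m + ?h (mid q p)"
      unfolding i(1) by (rule hitting_mid[OF dec f2 E(3)])
    moreover have "4 * ?h (mid p q) = ?h p + ?h q + ?h (mid p x) + ?h (mid q x)"
      unfolding i(2) by (rule hitting_mid[OF dec f3 E(3)])
    moreover have "4 * hitting k ?I ?m p = ?h x + ?h p + ?h (mid x q) + ?h (mid p q)"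
      by (rule hitting_mid[OF dec assms E(3)])
    ultimately have "190 * hitting k ?I (mid x q) p = 21" "76 * hitting k ?I ?m p = 27"
      using E(1,2,4,5) potential_target[of k ?I p] unfolding mc i by linarith+
    then have vals: "hitting k ?I (mid x q) p = 21 / 190" "hitting k ?I ?m p = 27 / 76" by simp_all
    show "mass (loops k (off_grid k \<union> {q}) ?m) * mass (lang k ?I (mid x q) p) = ennreal (7 / 50)"
      by (rule loops_then[OF vals(2) hitting_via(1)[OF assms] vals(1)]) (use m v c ds in simp_all)
  }
qed

section \<open>The path classes as lists of steps\<close>

lemma hit_Suc_enat:
  assumes "hit k w (Suc m) = enat n"
  obtains t where "hit k w m = enat t" "t < n" "n \<le> path_length w" "w ! n \<in> gasket_vertices k" "w ! n \<noteq> w ! t"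
    "\<And>j. t < j \<Longrightarrow> j < n \<Longrightarrow> w ! j \<in> gasket_vertices k \<Longrightarrow> w ! j = w ! t"
proof (cases "hit k w m")
  case (enat t)
  let ?S = "{j. t < j \<and> j \<le> path_length w \<and> w ! j \<in> gasket_vertices k - {w ! t}}"
  have I: "Inf (enat ` ?S) = enat n" using assms enat by simp
  have "?S \<noteq> {}"
  proof
    assume "?S = {}"
    then have "Inf (enat ` ?S) = \<infinity>" by (simp only: image_empty Inf_empty top_enat_def)
    then show False using I by simp
  qed
  then obtain j where "j \<in> ?S" by blast
  then have "Inf (enat ` ?S) \<in> enat ` ?S" by (intro wellorder_InfI[of "enat j"] imageI)
  then have n: "n \<in> ?S" unfolding I by auto
  have low: "w ! j = w ! t" if "t < j" "j < n" "w ! j \<in> gasket_vertices k" for j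
  proof (rule ccontr)
    assume "w ! j \<noteq> w ! t"
    then have "j \<in> ?S" using that n by auto
    then have "Inf (enat ` ?S) \<le> enat j" by (intro Inf_lower imageI)
    then show False unfolding I using that(2) by simp
  qed
  show ?thesis by (rule that[of t]) (use enat n low in auto)
qed (use assms in simp)

text \<open>Conversely to \<open>hit_steps\<close>, finite hitting times come from a decomposition
  into steps.\<close>

lemma hit_enat_steps:
  "hit k (x # l) m = enat n \<Longrightarrow> n \<le> length l \<and> (\<exists>ts. steps k x ts \<and> concat ts = take n l \<and> length ts = m)"
proof (induction m arbitrary: n)
  case 0
  then show ?case by (auto simp: zero_enat_def)
next
  case (Suc m)
  let ?w = "x # l"
  obtain t where t: "hit k ?w m = enat t" "t < n" "n \<le> path_length ?w" "?w ! n \<in> gasket_vertices k" "?w ! n \<noteq> ?w ! t"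
    "\<And>j. t < j \<Longrightarrow> j < n \<Longrightarrow> ?w ! j \<in> gasket_vertices k \<Longrightarrow> ?w ! j = ?w ! t"
    using hit_Suc_enat[OF Suc.prems] by blast
  from Suc.IH[OF t(1)] obtain ts where ts: "t \<le> length l" "steps k x ts" "concat ts = take t l" "length ts = m" by blast
  have n: "n \<le> length l" using t(3) by (simp add: path_length_def)
  define s where "s = take (n - t) (drop t l)"
  have ls: "length s = n - t" using n by (simp add: s_def)
  have sn: "s ! i = ?w ! (t + Suc i)" if "i < n - t" for i using that n by (simp add: s_def)
  have c: "last (skel x ts) = ?w ! t"
  proof -
    have "l = take t l @ drop t l" by simp
    then have "(x # l) ! t = last (x # take t l)"
      using nth_length_last[of x "take t l" "drop t l"] ts(1) by simp
    then show ?thesis unfolding last_skel[OF ts(2)] ts(3) by simp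
  qed
  have s0: "s \<noteq> []" using ls t(2) by auto
  have lasts: "last s = ?w ! n" using s0 sn[of "n - t - 1"] t(2) by (simp add: last_conv_nth ls)
  have "is_step k (?w ! t) s" unfolding is_step_def
  proof (intro conjI subsetI)
    fix p assume p: "p \<in> set (butlast s) \<inter> gasket_vertices k"
    then obtain i where i: "i < length (butlast s)" "butlast s ! i = p" by (auto simp: in_set_conv_nth)
    then have il: "i < n - t - 1" by (simp add: ls)
    then have "p = ?w ! (t + Suc i)" using i sn[of i] by (simp add: nth_butlast)
    then show "p \<in> {?w ! t}" using t(6)[of "t + Suc i"] p il by simp
  qed (use s0 lasts t(4,5) in simp_all)
  then have "steps k x (ts @ [s])" using ts(2) c by (simp add: steps_append del: last.simps)
  moreover have "concat (ts @ [s]) = take n l"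
    using ts(3) t(2) by (simp add: s_def take_add[symmetric])
  ultimately show ?case using ts(4) n by (intro conjI exI[of _ "ts @ [s]"]) simp_all
qed

lemma zero_cell: "0 \<in> cells k"
  using cellsI[OF cell.right, of k] by (simp add: zero_eq_pt)

lemma zero_corners: "corners k 0 = {0, apex k, corner k}"
  by (simp add: corners_def)

lemma zero_vertex: "0 \<in> gasket_vertices k"
  using gasket_verticesI[OF zero_cell, of 0 k] by (simp add: zero_corners)

lemma is_path_iff: "is_path w \<longleftrightarrow> w \<noteq> [] \<and> set w \<subseteq> gasket_vertices 0 \<and> successively (adj 0) w"
  unfolding is_path_def successively_conv_nth adj_def[symmetric]
  by (cases w) (auto simp: path_length_def)

lemma successively_adj_vertices:
  "successively (adj k) (x # l) \<Longrightarrow> x \<in> gasket_vertices k \<Longrightarrow> set (x # l) \<subseteq> gasket_vertices k"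
proof (induction l arbitrary: x)
  case (Cons y l)
  then have "adj k x y" by simp
  then have "y \<in> gasket_vertices k" using adj_vertices by blast
  then show ?case using Cons.IH[of y] Cons.prems by simp
qed simp

lemma walk_is_path: "x \<in> gasket_vertices 0 \<Longrightarrow> is_path (x # concat ts) \<longleftrightarrow> walk x ts"
  unfolding is_path_iff walk_def using successively_adj_vertices[of 0 x "concat ts"] by blast

definition routes :: "nat \<Rightarrow> point list \<Rightarrow> path list set" where
  "routes k ps = {ts. steps k 0 ts \<and> walk 0 ts \<and> map last ts = ps}"

lemma hit_end_iff:
  assumes "w ! 0 = 0" "is_path w"
  shows "hit k w m = enat (path_length w) \<longleftrightarrow> (\<exists>ts. w = 0 # concat ts \<and> steps k 0 ts \<and> length ts = m)"
proof
  assume h: "hit k w m = enat (path_length w)"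
  obtain l where w: "w = 0 # l" using assms by (cases w) (auto simp: is_path_iff)
  then obtain ts where "steps k 0 ts" "concat ts = take (path_length w) l" "length ts = m"
    using hit_enat_steps h by blast
  then show "\<exists>ts. w = 0 # concat ts \<and> steps k 0 ts \<and> length ts = m"
    using w by (auto simp: path_length_def)
next
  assume "\<exists>ts. w = 0 # concat ts \<and> steps k 0 ts \<and> length ts = m"
  then obtain ts where "w = 0 # concat ts" "steps k 0 ts" "length ts = m" by blast
  then show "hit k w m = enat (path_length w)"
    using hit_steps[of k 0 ts m] by (simp add: path_length_def)
qed

lemma W_eq: "W N p = (\<lambda>ts. 0 # concat ts) ` routes N [p]"
proof (intro equalityI subsetI)
  fix w assume "w \<in> W N p"
  then have w: "is_path w" "w ! 0 = 0" "hit N w 1 = enat (path_length w)" "hit_point N w 1 = p" by (auto simp: W_def)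
  obtain ts where ts: "w = 0 # concat ts" "steps N 0 ts" "length ts = 1" using hit_end_iff[OF w(2,1), THEN iffD1, OF w(3)] by blast
  have "map last ts = [p]" using hit_point_steps[OF ts(2), of 1] w(4) ts(1,3) by (cases ts) auto
  moreover have "walk 0 ts" using w(1) walk_is_path[OF zero_vertex, of ts] unfolding ts(1) by simp
  ultimately have "ts \<in> routes N [p]" using ts(2) by (simp add: routes_def)
  then show "w \<in> (\<lambda>ts. 0 # concat ts) ` routes N [p]" unfolding ts(1) by (rule imageI)
next
  fix w assume "w \<in> (\<lambda>ts. 0 # concat ts) ` routes N [p]"
  then obtain ts where ts: "w = 0 # concat ts" "ts \<in> routes N [p]" by (rule imageE)
  then have ts: "w = 0 # concat ts" "steps N 0 ts" "walk 0 ts" "map last ts = [p]" by (simp_all add: routes_def)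
  then have l: "length ts = 1" by (metis length_map One_nat_def length_Cons list.size(3))
  have path: "is_path w" using ts(3) walk_is_path[OF zero_vertex, of ts] unfolding ts(1) by simp
  have "hit_point N w 1 = p" using hit_point_steps[OF ts(2), of 1] ts(1,4) l by simp
  moreover have "w ! 0 = 0" using ts(1) by simp
  moreover have "hit N w 1 = enat (path_length w)" using hit_end_iff[OF \<open>w ! 0 = 0\<close> path] ts(1,2) l by blast
  ultimately show "w \<in> W N p" using path by (simp add: W_def)
qed

lemma V_eq: "V N q p = (\<lambda>ts. 0 # concat ts) ` routes N [q, p]"
proof (intro equalityI subsetI)
  fix w assume "w \<in> V N q p"
  then have w: "is_path w" "w ! 0 = 0" "hit N w 2 = enat (path_length w)" "hit_point N w 1 = q" "hit_point N w 2 = p" by (auto simp: V_def)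
  obtain ts where ts: "w = 0 # concat ts" "steps N 0 ts" "length ts = 2" using hit_end_iff[OF w(2,1), THEN iffD1, OF w(3)] by blast
  then obtain t s where "ts = [t, s]" by (metis One_nat_def Suc_1 length_0_conv length_Suc_conv)
  then have "map last ts = [q, p]"
    using hit_point_steps[OF ts(2), of 1] hit_point_steps[OF ts(2), of 2] w(4,5) ts(1,3) by simp
  moreover have "walk 0 ts" using w(1) walk_is_path[OF zero_vertex, of ts] unfolding ts(1) by simp
  ultimately have "ts \<in> routes N [q, p]" using ts(2) by (simp add: routes_def)
  then show "w \<in> (\<lambda>ts. 0 # concat ts) ` routes N [q, p]" unfolding ts(1) by (rule imageI)
next
  fix w assume "w \<in> (\<lambda>ts. 0 # concat ts) ` routes N [q, p]"
  then obtain ts where ts: "w = 0 # concat ts" "ts \<in> routes N [q, p]" by (rule imageE)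
  then have ts: "w = 0 # concat ts" "steps N 0 ts" "walk 0 ts" "map last ts = [q, p]" by (simp_all add: routes_def)
  then have l: "length ts = 2" by (metis length_map One_nat_def Suc_1 length_Cons list.size(3))
  have path: "is_path w" using ts(3) walk_is_path[OF zero_vertex, of ts] unfolding ts(1) by simp
  have "hit_point N w 1 = q" "hit_point N w 2 = p"
    using hit_point_steps[OF ts(2), of 1] hit_point_steps[OF ts(2), of 2] ts(1,4) l by simp_all
  moreover have "w ! 0 = 0" using ts(1) by simp
  moreover have "hit N w 2 = enat (path_length w)" using hit_end_iff[OF \<open>w ! 0 = 0\<close> path] ts(1,2) l by blast
  ultimately show "w \<in> V N q p" using path by (simp add: V_def)
qed

text \<open>The two corners of the triangle at the origin, in either order, so that the reflected
  classes need no separate treatment.\<close>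

definition is_target :: "nat \<Rightarrow> point \<Rightarrow> point \<Rightarrow> bool" where
  "is_target N p q \<longleftrightarrow> (p = apex N \<and> q = corner N) \<or> (p = corner N \<and> q = apex N)"

lemma apex_corner_distinct: "distinct [0, apex N, corner N]" "distinct [0, corner N, apex N]"
  by (simp_all add: apex_eq_pt corner_eq_pt zero_eq_pt)

lemma target_corners: "is_target N p q \<Longrightarrow> corners N 0 = {0, p, q}" "is_target N p q \<Longrightarrow> distinct [0, p, q]"
  using apex_corner_distinct[of N] unfolding is_target_def zero_corners
  by (elim disjE conjE; simp add: insert_commute)+

lemma target_frame: "is_target (Suc k) p q \<Longrightarrow> frame k 0 p q"
  using target_corners[of "Suc k" p q] zero_cell unfolding frame_def by blast

lemma target_sym: "is_target N p q \<Longrightarrow> is_target N q p"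
  by (auto simp: is_target_def)

lemma target_mid: "is_target (Suc k) p q \<Longrightarrow> is_target k (mid 0 p) (mid 0 q)"
  unfolding is_target_def by (elim disjE conjE; simp add: zero_eq_pt apex_eq_pt corner_eq_pt mid_pt)

lemma U_cases:
  assumes "w \<in> U N"
  obtains p q ts where "is_target N p q" "w = 0 # concat ts" "ts \<in> routes N [p] \<or> ts \<in> routes N [q, p]"
  using assms unfolding U_def W_eq V_eq is_target_def by blast

lemma U_I: "is_target N p q \<Longrightarrow> ts \<in> routes N [p] \<or> ts \<in> routes N [q, p] \<Longrightarrow> 0 # concat ts \<in> U N"
  unfolding U_def W_eq V_eq is_target_def by blast

lemma routes_good:
  assumes "is_target N p q" "ts \<in> routes N [p] \<or> ts \<in> routes N [q, p]"
  shows "good N 0 ts" "ts \<noteq> []" "set (map last ts) \<subseteq> {p, q}" "last (skel 0 ts) = p"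
proof -
  have ts: "steps N 0 ts" "walk 0 ts" "map last ts = [p] \<or> map last ts = [q, p]"
    using assms(2) by (auto simp: routes_def)
  show "good N 0 ts" "ts \<noteq> []" "set (map last ts) \<subseteq> {p, q}" "last (skel 0 ts) = p"
    using ts target_corners(2)[OF assms(1)] zero_vertex by (auto simp: good_def)
qed

text \<open>The coarse path of scale \<open>N\<close> of the erased path visits a subset of the
  corners visited before, without repetition and with the same end, hence it belongs to one of the
  four classes again.\<close>

lemma loop_erasure_U:
  assumes "w \<in> U N"
  shows "loop_erasure N w \<in> \<Gamma> N"
proof -
  obtain p q ts where pq: "is_target N p q" and w: "w = 0 # concat ts" and ts: "ts \<in> routes N [p] \<or> ts \<in> routes N [q, p]"
    using U_cases[OF assms] by blast
  note r = routes_good[OF pq ts]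
  obtain us where us: "steps N 0 us" "loop_erasure N w = 0 # concat us" "set (map last us) \<subseteq> set (map last ts)"
    "last (skel 0 us) = last (skel 0 ts)" "distinct (skel 0 us)" "ts \<noteq> [] \<longrightarrow> us \<noteq> []"
    unfolding w by (rule loop_erasure_steps[OF r(1)])
  have pr: "proper (loop_erasure N w) 0 p" using loop_erasure_proper[OF r(1)] w r(4) by simp
  then have walk: "walk 0 us" unfolding us(2) by (simp add: proper_def walk_def)
  obtain bs where bs: "map last us = bs @ [p]"
  proof -
    have ne: "map last us \<noteq> []" using us(6) r(2) by simp
    then have "last (map last us) = p" using us(4) r(4) by simp
    then show thesis using that[of "butlast (map last us)"] ne by (metis append_butlast_last_id)
  qed
  have "set (map last us) \<subseteq> {p, q}" using us(3) r(3) by (rule order_trans)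
  then have 1: "set bs \<subseteq> {p, q}" unfolding bs by simp
  have "distinct (map last us)" using us(5) by simp
  then have "p \<notin> set bs" "distinct bs" unfolding bs by simp_all
  with 1 have "set bs \<subseteq> {q}" "distinct bs" by blast+
  then have "bs = [] \<or> bs = [q]" by (cases bs; cases "tl bs") auto
  then have "us \<in> routes N [p] \<or> us \<in> routes N [q, p]" using us(1) walk bs by (auto simp: routes_def)
  then have "loop_erasure N w \<in> U N" unfolding us(2) using U_I[OF pq] by blast
  moreover have "distinct (loop_erasure N w)" using pr by (simp add: proper_def)
  ultimately show ?thesis by (simp add: \<Gamma>_def)
qed

section \<open>The first piece after one erasure\<close>

lemma erased_to_erase_loops:
  assumes "good (Suc k) x g" "first_run (Suc k) x g []" "steps k x ts" "concat ts = concat g" "erased_to k x g us"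
  shows "us = erase_loops x ts"
proof -
  have "x # concat us = erase_level k (x # concat g)" using assms(5) by (simp add: erased_to_def)
  also have "\<dots> = erase k (x # concat ts)"
    using good_erase_level_run[of k x g "[]"] assms(1,2,4) erase_Cons[of k x "concat g"]
    by (simp add: erase_level_single)
  also have "\<dots> = x # concat (erase_loops x ts)" by (rule erase_steps[OF assms(3)])
  finally have "concat us = concat (erase_loops x ts)" by simp
  moreover have "steps k x us" using assms(5) by (simp add: erased_to_def good_def)
  ultimately show ?thesis using steps_unique steps_erase_loops[OF assms(3)] by blast
qed

text \<open>After one erasure the path leaves the origin along the triangle of side
  \<open>2 ^ N\<close> at the origin, because it stays in the triangle of side
  \<open>2 ^ (N + 1)\<close>. Its first run consists of one step to a corner \<open>z\<close>, or of
  a second step to the other corner \<open>z'\<close> if this is where the path goes next.\<close>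

lemma first_piece:
  assumes pq: "is_target (Suc N) p q" and w: "0 # concat ts \<in> U (Suc N)" and st: "steps N 0 ts"
  obtains t us z z' where "erase_loops 0 ts = t # us" "erase_level N (0 # concat ts) = 0 # concat (t # us)"
    "good N 0 (t # us)" "is_target N z z'" "last t = z"
    "us = [] \<or> last (hd us) \<noteq> z' \<Longrightarrow> first_run N 0 [t] us"
    "us \<noteq> [] \<Longrightarrow> last (hd us) = z' \<Longrightarrow> first_run N 0 [t, hd us] (tl us)"
proof -
  obtain p' q' g where pq': "is_target (Suc N) p' q'" and g: "(0::point) # concat ts = 0 # concat g"
    "g \<in> routes (Suc N) [p'] \<or> g \<in> routes (Suc N) [q', p']"
    using U_cases[OF w] by blast
  note r = routes_good[OF pq' g(2)]
  have fr: "first_run (Suc N) 0 g []"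
  proof (rule first_runI[OF zero_cell])
    show "0 \<in> corners (Suc N) 0" by (simp add: zero_corners)
    show "set (map last g) \<subseteq> corners (Suc N) 0" using r(3) target_corners(1)[OF pq'] by blast
    show "0 \<notin> set (map last g)" using r(1) by (simp add: good_def)
  qed (use r(2) in simp_all)
  obtain us0 where us0: "erased_to N 0 g us0" using erased_to_single_run[OF r(1) fr] by blast
  have le: "us0 = erase_loops 0 ts" by (rule erased_to_erase_loops[OF r(1) fr st _ us0]) (use g(1) in simp)
  have er: "erase_level N (0 # concat ts) = 0 # concat us0" "good N 0 us0" "us0 \<noteq> []"
    using us0 g(1) r(2) by (auto simp: erased_to_def)
  then obtain t us where tu: "us0 = t # us" by (cases us0) auto
  have "last (hd g) \<in> set (map last g)" using r(2) by simp
  then have "last (hd g) \<in> corners (Suc N) 0" using r(3) target_corners(1)[OF pq'] by blast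
  moreover have "0 \<in> corners (Suc N) 0" by (simp add: zero_corners)
  ultimately have tin: "last t \<in> tri (Suc N) 0"
    using us0 r(2) zero_cell[of "Suc N"] unfolding erased_to_def tu by (metis list.sel(1))
  have ad: "adj N 0 (last t)" using good_Cons_adj er(2) tu by blast
  have f: "frame N 0 p q" by (rule target_frame[OF pq])
  obtain d e where f': "frame N 0 d e" "{p, q} \<noteq> {d, e}" "{d, e} \<inter> {p, q} = {}" by (rule other_frame[OF f])
  have "last t \<in> {mid 0 p, mid 0 q, mid 0 d, mid 0 e}"
    using ad unfolding nbr_corner(1)[OF f f'(1,2), symmetric] by simp
  moreover have "last t \<noteq> mid 0 d" "last t \<noteq> mid 0 e"
  proof -
    obtain v where v: "v \<in> cells (Suc N)" "corners (Suc N) v = {0, d, e}" using f'(1) by (auto simp: frame_def)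
    have "v \<noteq> 0"
    proof
      assume "v = 0"
      then have "{0, d, e} = {0, p, q}" using v(2) target_corners(1)[OF pq] by simp
      moreover have "distinct [0, p, q]" "distinct [0, d, e]" using target_corners(2)[OF pq] f'(1) by (auto simp: frame_def)
      ultimately show False using f'(3) by auto
    qed
    have "mid 0 d \<in> tri (Suc N) v" "mid 0 e \<in> tri (Suc N) v"
      using mid_not_vertex(1)[OF v(1), of 0 d] mid_not_vertex(1)[OF v(1), of 0 e] v(2) f'(1) by (auto simp: frame_def)
    moreover have "mid 0 d \<notin> gasket_vertices (Suc N)" "mid 0 e \<notin> gasket_vertices (Suc N)"
      using frame_vertices[OF f'(1)] by simp_all
    moreover have "a \<in> gasket_vertices (Suc N)" if "a \<in> tri (Suc N) v" "a \<in> tri (Suc N) 0" for a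
      using tri_Int_tri(1)[OF v(1) zero_cell \<open>v \<noteq> 0\<close> that] gasket_verticesI[OF v(1)] by blast
    ultimately show "last t \<noteq> mid 0 d" "last t \<noteq> mid 0 e" using tin by metis+
  qed
  \<comment> \<open>The path to the first corner is confined to the triangle of side
    \<open>2 ^ (N + 1)\<close> at the origin, so of the four neighbours of the origin only the two
    midpoints of its sides remain.\<close>
  ultimately have "last t = mid 0 p \<or> last t = mid 0 q" by blast
  then obtain z' where z: "is_target N (last t) z'" using target_mid[OF pq] target_sym by metis
  note cz = target_corners[OF z]
  have dist: "distinct (skel 0 (t # us))" using er(2) tu by (simp add: good_def)
  have outside: "u \<notin> tri N 0" if "u \<in> set (map last us)" "u \<noteq> z'" for u
  proof
    assume "u \<in> tri N 0"
    moreover have "u \<in> gasket_vertices N" using good_skel_vertices[OF er(2)] that(1) tu by auto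
    ultimately have "u \<in> {0, last t, z'}" using gasket_vertices_tri[OF zero_cell] cz(1) by blast
    moreover have "0 \<notin> set (map last us)" "last t \<notin> set (map last us)" using dist by simp_all
    ultimately show False using that by blast
  qed
  have c0: "0 \<in> corners N 0" by (simp add: zero_corners)
  show ?thesis
  proof (rule that[of t us "last t" z'])
    show "erase_loops 0 ts = t # us" using le tu by simp
    show "erase_level N (0 # concat ts) = 0 # concat (t # us)" "good N 0 (t # us)" using er tu by simp_all
    show "first_run N 0 [t] us" if "us = [] \<or> last (hd us) \<noteq> z'"
    proof (rule first_runI[OF zero_cell c0])
      show "us = [] \<or> last (hd us) \<notin> tri N 0" using that outside[of "last (hd us)"] by (cases us) auto
    qed (use dist cz in auto)
    show "first_run N 0 [t, hd us] (tl us)" if u: "us \<noteq> []" "last (hd us) = z'"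
    proof (rule first_runI[OF zero_cell c0])
      show "tl us = [] \<or> last (hd (tl us)) \<notin> tri N 0"
      proof (cases "tl us")
        case (Cons a l)
        then have "us = hd us # a # l" using u(1) by (cases us) auto
        then have "last a \<in> set (map last us)" "last a \<noteq> last (hd us)" using dist
          by (metis (mono_tags) list.set_intros list.simps(9), metis distinct.simps(2) list.set_intros(1) list.simps(9) )
        then show ?thesis using outside[of "last a"] u(2) Cons by simp
      qed simp
    qed (use dist cz u in auto)
  qed (use z in simp_all)
qed

section \<open>Surviving steps of a loop-erased walk\<close>

text \<open>A walk whose loop erasure starts with a step in \<open>T\<close> is, in a unique way, a
  walk in \<open>L\<close> that returns to \<open>x\<close>, then this step, then a walk that avoids
  \<open>x\<close> and whose own loop erasure is constrained by \<open>Q\<close>. Letting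
  \<open>Q\<close> talk about the next surviving step iterates the decomposition.\<close>

lemma surviving_first:
  assumes L: "\<And>a. a \<in> L \<Longrightarrow> a = [] \<or> last (last a) = x" and x: "x \<notin> I" "x \<noteq> y" and z: "z \<in> I" "z \<noteq> x"
    and T: "T \<subseteq> one_step k x z"
  shows "{ts \<in> conc L (lang k I x y). \<exists>t r. [t] \<in> T \<and> erase_loops x ts = t # r \<and> Q r}
    = conc L (conc T {us. (us = [] \<and> z = y \<or> us \<in> lang k I z y) \<and> Q (erase_loops z us)})"
    and "mass (conc L (conc T {us. (us = [] \<and> z = y \<or> us \<in> lang k I z y) \<and> Q (erase_loops z us)})) = mass L * (mass T * mass {us. (us = [] \<and> z = y \<or> us \<in> lang k I z y) \<and> Q (erase_loops z us)})"
proof -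
  let ?U = "{us. (us = [] \<and> z = y \<or> us \<in> lang k I z y) \<and> Q (erase_loops z us)}"
  let ?A = "{ts \<in> conc L (lang k I x y). \<exists>t r. [t] \<in> T \<and> erase_loops x ts = t # r \<and> Q r}"
  let ?B = "conc L (conc T ?U)"
  have one: "\<exists>t. a = [t] \<and> last t = z \<and> is_step k x t \<and> successively (adj 0) (x # t)" if "a \<in> T" for a
    using that T unfolding one_step_iff[symmetric] subset_iff by (auto simp: one_step_iff)
  have TU: "l \<in> lang k I x y \<and> (\<exists>t us. l = t # us \<and> [t] \<in> T \<and> us \<in> ?U)" if l0: "l \<in> conc T ?U" for l
  proof -
    obtain a us where l: "l = a @ us" "a \<in> T" "us \<in> ?U" using l0 unfolding conc_def by blast
    obtain t where t: "a = [t]" "last t = z" "is_step k x t" "successively (adj 0) (x # t)" using one[OF l(2)] by blast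
    have "l \<in> lang k I x y" using l t z by (auto simp: lang_Cons)
    then show ?thesis using l t by auto
  qed
  show "?A = ?B"
  proof (intro equalityI subsetI)
    fix ts assume "ts \<in> ?A"
    then obtain a l t r where *: "ts = a @ l" "a \<in> L" "l \<in> lang k I x y" "[t] \<in> T" "erase_loops x ts = t # r" "Q r"
      unfolding conc_def by blast
    obtain t' us where l: "l = t' # us" using lang_last(2)[OF *(3)] by (cases l) auto
    have "after x ts = t' # us"
      unfolding *(1) l by (rule after_eq[OF L[OF *(2)]]) (use lang_avoids[OF *(3) x] l in simp)
    then have e: "t' = t" "r = erase_loops (last t) us" using erase_loops_Cons[of x ts t' us] *(5) by auto
    have lt: "last t = z" using one[OF *(4)] by auto
    have "us \<in> ?U" using *(3,6) e lt unfolding l lang_Cons by auto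
    then show "ts \<in> ?B" using concI[OF *(2) concI[OF *(4)]] *(1) l e by auto
  next
    fix ts assume "ts \<in> ?B"
    then obtain a l where *: "ts = a @ l" "a \<in> L" "l \<in> conc T ?U" unfolding conc_def[of L] by blast
    obtain t us where l: "l = t # us" "[t] \<in> T" "us \<in> ?U" "l \<in> lang k I x y" using TU[OF *(3)] by blast
    have "after x ts = t # us"
      unfolding *(1) l(1) by (rule after_eq[OF L[OF *(2)]]) (use lang_avoids[OF l(4) x] l(1) in simp)
    then have "erase_loops x ts = t # erase_loops (last t) us" by (rule erase_loops_Cons)
    moreover have "last t = z" using one[OF l(2)] by auto
    ultimately have "erase_loops x ts = t # erase_loops z us" "Q (erase_loops z us)" using l(3) by auto
    then show "ts \<in> ?A" using concI[OF *(2) l(4)] *(1) l(2) by blast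
  qed
  have "mass ?B = mass L * mass (conc T ?U)"
  proof (rule mass_conc)
    fix a b a' b' assume *: "a \<in> L" "a' \<in> L" "b \<in> conc T ?U" "b' \<in> conc T ?U" "a @ b = a' @ b'"
    have "b \<in> lang k I x y" "b' \<in> lang k I x y" using TU *(3,4) by blast+
    then show "a = a'"
      by (intro conc_after_unique[of a x a' b b']) (use *(5) L[OF *(1)] L[OF *(2)] lang_avoids[OF _ x] in auto)
  qed
  also have "mass (conc T ?U) = mass T * mass ?U"
  proof (rule mass_conc)
    fix a b a' b' assume *: "a \<in> T" "a' \<in> T" "a @ b = a' @ b'"
    obtain t t' where "a = [t]" "a' = [t']" using one[OF *(1)] one[OF *(2)] by blast
    then show "a = a'" using *(3) by simp
  qed
  finally show "mass ?B = mass L * (mass T * mass ?U)" .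
qed

lemma loops_ends: "a \<in> loops k I x \<Longrightarrow> a = [] \<or> last (last a) = x"
  by (auto simp: loops_def lang_def)

lemma lang_eq_conc_loops:
  assumes "m \<in> I" "m \<noteq> y"
  shows "lang k I m y = conc (loops k I m) (lang k (I - {m}) m y)"
proof -
  have "conc (loops k I m) B = B \<union> conc (lang k I m m) B" for B
    unfolding loops_def conc_def by auto
  then show ?thesis using lang_last_visit(1)[OF assms, of k m] by simp
qed

text \<open>Cut at the first visit to \<open>q\<close>.\<close>

lemma lang_first_visit:
  assumes "q \<notin> I" "q \<noteq> y"
  shows "lang k (insert q I) x y = lang k I x y \<union> conc (lang k I x q) (lang k (insert q I) q y)" (is "?l = _ \<union> ?r")
    and "lang k I x y \<inter> conc (lang k I x q) (lang k (insert q I) q y) = {}"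
proof -
  show "lang k I x y \<inter> ?r = {}"
  proof (intro equals0I, elim IntE)
    fix ts assume 1: "ts \<in> lang k I x y" and "ts \<in> ?r"
    then obtain a b where ab: "ts = a @ b" "a \<in> lang k I x q" "b \<in> lang k (insert q I) q y" unfolding conc_def by blast
    then have "last (last a) \<in> I" using 1 lang_split[of a b k I x y] lang_last(2) by blast
    then show False using lang_last(1)[OF ab(2)] assms(1) by simp
  qed
  show "?l = lang k I x y \<union> ?r"
  proof (intro equalityI subsetI)
    fix ts assume ts: "ts \<in> ?l"
    show "ts \<in> lang k I x y \<union> ?r"
    proof (cases "\<exists>t\<in>set ts. last t = q")
      case False
      have "last ` set (butlast ts) \<subseteq> insert q I" using ts by (simp add: lang_def)
      moreover have "q \<notin> last ` set (butlast ts)" using False in_set_butlastD by fastforce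
      ultimately have "last ` set (butlast ts) \<subseteq> I" by blast
      then show ?thesis using ts by (simp add: lang_def)
    next
      case True
      then obtain a t b where t: "ts = a @ t # b" "last t = q" "\<forall>u\<in>set a. last u \<noteq> q"
        using split_list_first_prop[of ts "\<lambda>t. last t = q"] by blast
      have b: "b \<noteq> []" using lang_last(1)[OF ts] t assms(2) by auto
      have "(a @ [t]) @ b \<in> ?l" using ts t(1) by simp
      then have s: "a @ [t] \<in> lang k (insert q I) x q" "b \<in> lang k (insert q I) q y"
        using lang_split[of "a @ [t]" b k "insert q I" x y] b t(2) by simp_all
      have "last ` set a \<subseteq> I" using s(1) t(3) by (auto simp: lang_def)
      then have "a @ [t] \<in> lang k I x q" using s(1) by (simp add: lang_def)
      from concI[OF this s(2)] show ?thesis using t(1) by simp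
    qed
  next
    fix ts assume "ts \<in> lang k I x y \<union> ?r"
    then show "ts \<in> ?l"
    proof
      assume "ts \<in> lang k I x y" then show ?thesis using lang_mono[of I "insert q I"] by blast
    next
      assume "ts \<in> ?r"
      then obtain a b where ab: "ts = a @ b" "a \<in> lang k I x q" "b \<in> lang k (insert q I) q y" unfolding conc_def by blast
      then have "a \<in> lang k (insert q I) x q" using lang_mono[of I "insert q I"] by blast
      then show ?thesis unfolding ab(1)
        using ab lang_split[of a b k "insert q I" x y] lang_last[OF ab(2)] lang_last(2)[OF ab(3)] by simp
    qed
  qed
qed

lemma conc_assoc: "conc (conc A B) C = conc A (conc B C)"
proof (intro set_eqI iffI)
  fix l assume "l \<in> conc (conc A B) C"
  then obtain a b c where "l = (a @ b) @ c" "a \<in> A" "b \<in> B" "c \<in> C" unfolding conc_def by blast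
  then show "l \<in> conc A (conc B C)" using concI[of a A "b @ c" "conc B C"] concI[of b B c C] by simp
next
  fix l assume "l \<in> conc A (conc B C)"
  then obtain a b c where "l = a @ (b @ c)" "a \<in> A" "b \<in> B" "c \<in> C" unfolding conc_def by blast
  then show "l \<in> conc (conc A B) C" using concI[of "a @ b" "conc A B" c C] concI[of a A b B] by simp
qed

lemma conc_Un: "conc A (B \<union> C) = conc A B \<union> conc A C"
  unfolding conc_def by blast

section \<open>Refining the two path classes\<close>

text \<open>Walks of scale \<open>N\<close> from the origin to \<open>p\<close> that refine a path
  of scale \<open>N + 1\<close>: loops at the origin, followed by a walk through \<open>I\<close>
  that does not come back to the origin.\<close>

definition walks :: "nat \<Rightarrow> point set \<Rightarrow> point \<Rightarrow> path list set" where
  "walks N I p = conc (loops N (off_grid N \<union> {0}) 0) (lang N I 0 p)"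

text \<open>Refinements of the paths in \<open>W (Suc N) p\<close>.\<close>

definition W_walks :: "nat \<Rightarrow> point \<Rightarrow> path list set" where
  "W_walks N p = walks N (off_grid N) p"

text \<open>Refinements of the paths in \<open>V (Suc N) q p\<close>. The second step of scale
  \<open>N + 1\<close> starts at \<open>q\<close> and may return there.\<close>

definition V_walks :: "nat \<Rightarrow> point \<Rightarrow> point \<Rightarrow> path list set" where
  "V_walks N q p = conc (W_walks N q) (lang N (off_grid N \<union> {q}) q p)"

lemma target_off_grid:
  assumes "is_target (Suc N) p q"
  shows "0 \<notin> off_grid N" "p \<notin> off_grid N" "q \<notin> off_grid N" "p \<noteq> 0" "q \<noteq> 0" "p \<noteq> q"
    "p \<in> gasket_vertices (Suc N)" "q \<in> gasket_vertices (Suc N)"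
  using corner_on_grid[OF target_frame[OF assms]] target_corners(2)[OF assms] frame_vertices(1)[OF target_frame[OF assms]]
  by auto

lemma W_walks_eq:
  assumes "is_target (Suc N) p q"
  shows "W_walks N p = lang N (off_grid N \<union> {0}) 0 p"
proof -
  note o = target_off_grid[OF assms]
  have e: "off_grid N \<union> {0} - {0} = off_grid N" using o(1) by auto
  have "0 \<in> off_grid N \<union> {0}" by simp
  from lang_eq_conc_loops[OF this, of p N] o(4) show ?thesis unfolding W_walks_def walks_def e by simp
qed

text \<open>Walks that may pass through \<open>q\<close> go straight to \<open>p\<close> or visit
  \<open>q\<close> first, so masses over \<open>V_walks\<close> are differences of masses of
  languages that are easier to compute.\<close>

lemma walks_split:
  assumes "is_target (Suc N) p q"
  shows "walks N (off_grid N \<union> {q}) p = W_walks N p \<union> V_walks N q p" "W_walks N p \<inter> V_walks N q p = {}"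
proof -
  note o = target_off_grid[OF assms]
  have i: "off_grid N \<union> {q} = insert q (off_grid N)" by simp
  have q: "q \<noteq> p" using o(6) by simp
  show "walks N (off_grid N \<union> {q}) p = W_walks N p \<union> V_walks N q p"
    unfolding walks_def W_walks_def V_walks_def i lang_first_visit(1)[OF o(3) q, of N 0] conc_assoc conc_Un ..
  show "W_walks N p \<inter> V_walks N q p = {}"
  proof (intro equals0I, elim IntE)
    fix ts assume 1: "ts \<in> W_walks N p" and "ts \<in> V_walks N q p"
    then obtain a b where ab: "ts = a @ b" "a \<in> W_walks N q" "b \<in> lang N (off_grid N \<union> {q}) q p"
      unfolding V_walks_def conc_def by blast
    have a: "a \<in> lang N (off_grid N \<union> {0}) 0 q" using ab(2) W_walks_eq[OF target_sym[OF assms]] by simp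
    have "last (last a) \<in> off_grid N \<union> {0}"
      using 1 lang_split[of a b N "off_grid N \<union> {0}" 0 p] lang_last(2)[OF a] lang_last(2)[OF ab(3)]
      unfolding W_walks_eq[OF assms] ab(1) by blast
    then show False using lang_last(1)[OF a] o by simp
  qed
qed

abbreviation as_path :: "path list \<Rightarrow> path" where
  "as_path ts \<equiv> 0 # concat ts"

lemma routes_single: "ts \<in> routes k [p] \<longleftrightarrow> ts \<in> one_step k 0 p"
  unfolding routes_def one_step_iff by (cases ts; cases "tl ts") (auto simp: walk_def is_step_def)

lemma W_refined:
  assumes "is_target (Suc N) p q"
  shows "W (Suc N) p = as_path ` W_walks N p"
proof -
  note o = target_off_grid[OF assms]
  have "one_step (Suc N) 0 p = (\<lambda>ts. [concat ts]) ` lang N (off_grid N \<union> {0}) 0 p"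
    using coarse_step_lang[OF o(7,4)] by (simp add: bij_betw_def)
  moreover have "routes (Suc N) [p] = one_step (Suc N) 0 p"
    by (rule set_eqI) (rule routes_single)
  ultimately have "routes (Suc N) [p] = (\<lambda>ts. [concat ts]) ` W_walks N p"
    unfolding W_walks_eq[OF assms] by (simp only:)
  then show ?thesis unfolding W_eq by (simp add: image_image)
qed

lemma routes_pair:
  "ts \<in> routes k [q, p] \<longleftrightarrow> (\<exists>a b. ts = [a, b] \<and> [a] \<in> one_step k 0 q \<and> [b] \<in> one_step k q p)"
proof
  assume ts: "ts \<in> routes k [q, p]"
  then obtain a b where ab: "ts = [a, b]" by (auto simp: routes_def map_eq_Cons_conv)
  then show "\<exists>a b. ts = [a, b] \<and> [a] \<in> one_step k 0 q \<and> [b] \<in> one_step k q p"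
    using ts unfolding routes_def one_step_iff by (auto simp: walk_Cons is_step_def)
next
  assume "\<exists>a b. ts = [a, b] \<and> [a] \<in> one_step k 0 q \<and> [b] \<in> one_step k q p"
  then show "ts \<in> routes k [q, p]" unfolding routes_def one_step_iff by (auto simp: walk_Cons is_step_def)
qed

lemma V_refined:
  assumes "is_target (Suc N) p q"
  shows "V (Suc N) q p = as_path ` V_walks N q p"
proof -
  note o = target_off_grid[OF assms]
  have 1: "one_step (Suc N) 0 q = (\<lambda>ts. [concat ts]) ` W_walks N q"
    using coarse_step_lang[OF o(8,5)] unfolding W_walks_eq[OF target_sym[OF assms]] by (simp add: bij_betw_def)
  have 2: "one_step (Suc N) q p = (\<lambda>ts. [concat ts]) ` lang N (off_grid N \<union> {q}) q p"
    using coarse_step_lang[OF o(7,6)] by (simp add: bij_betw_def)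
  show ?thesis
  proof (intro set_eqI iffI)
    fix w assume "w \<in> V (Suc N) q p"
    then obtain ts where ts: "w = as_path ts" "ts \<in> routes (Suc N) [q, p]" unfolding V_eq by (rule imageE)
    then obtain a b where ab: "ts = [a, b]" "[a] \<in> one_step (Suc N) 0 q" "[b] \<in> one_step (Suc N) q p"
      unfolding routes_pair by blast
    obtain a' where a': "[a] = [concat a']" "a' \<in> W_walks N q" using ab(2) unfolding 1 by (rule imageE)
    obtain b' where b': "[b] = [concat b']" "b' \<in> lang N (off_grid N \<union> {q}) q p" using ab(3) unfolding 2 by (rule imageE)
    have "a' @ b' \<in> V_walks N q p" unfolding V_walks_def by (rule concI[OF a'(2) b'(2)])
    then have "as_path (a' @ b') \<in> as_path ` V_walks N q p" by (rule imageI)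
    moreover have "w = as_path (a' @ b')" using ts(1) ab(1) a'(1) b'(1) by simp
    ultimately show "w \<in> as_path ` V_walks N q p" by (simp only:)
  next
    fix w assume "w \<in> as_path ` V_walks N q p"
    then obtain ts where ts: "w = as_path ts" "ts \<in> V_walks N q p" by (rule imageE)
    then obtain a' b' where ab: "ts = a' @ b'" "a' \<in> W_walks N q" "b' \<in> lang N (off_grid N \<union> {q}) q p"
      unfolding V_walks_def conc_def by blast
    have "[concat a'] \<in> one_step (Suc N) 0 q" unfolding 1 by (rule imageI[OF ab(2)])
    moreover have "[concat b'] \<in> one_step (Suc N) q p" unfolding 2 by (rule imageI[OF ab(3)])
    ultimately have "[concat a', concat b'] \<in> routes (Suc N) [q, p]" unfolding routes_pair by blast
    from imageI[OF this, of as_path] have "as_path [concat a', concat b'] \<in> V (Suc N) q p" unfolding V_eq .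
    moreover have "w = as_path [concat a', concat b']" using ts(1) ab(1) by simp
    ultimately show "w \<in> V (Suc N) q p" by (simp only:)
  qed
qed

lemma walks_steps:
  assumes "ts \<in> walks N I p"
  shows "steps N 0 ts"
proof -
  obtain a b where ab: "ts = a @ b" "a \<in> loops N (off_grid N \<union> {0}) 0" "b \<in> lang N I 0 p"
    using assms unfolding walks_def conc_def by blast
  show ?thesis
  proof (cases "a = []")
    case True
    then show ?thesis using ab by (simp add: lang_def)
  next
    case False
    then have "steps N 0 a" "last (skel 0 a) = 0" using ab(2) by (auto simp: loops_def lang_def last_map)
    then show ?thesis using ab(1,3) by (simp add: steps_append lang_def del: last.simps)
  qed
qed

section \<open>Masses of first pieces\<close>

definition starts :: "nat \<Rightarrow> point set \<Rightarrow> point \<Rightarrow> path \<Rightarrow> path list set" where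
  "starts N I p t = {ts \<in> walks N I p. \<exists>r. erase_loops 0 ts = t # r}"

definition starts2 :: "nat \<Rightarrow> point set \<Rightarrow> point \<Rightarrow> path \<Rightarrow> path set \<Rightarrow> path list set" where
  "starts2 N I p t S = {ts \<in> walks N I p. \<exists>s r. s \<in> S \<and> erase_loops 0 ts = t # s # r}"

lemma mass_starts:
  assumes "is_target (Suc N) p q" "[t] \<in> one_step N 0 m" "m \<in> off_grid N" "I = off_grid N \<or> I = off_grid N \<union> {q}"
  shows "mass (starts N I p t) = ennreal (5 / 3) * (weight [t] * mass (lang N I m p))"
proof -
  note o = target_off_grid[OF assms(1)]
  have I: "0 \<notin> I" "m \<in> I" "p \<notin> I" using assms(3,4) o by auto
  have m: "m \<noteq> 0" "m \<noteq> p" using assms(3) o by auto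
  have T: "{[t]} \<subseteq> one_step N 0 m" using assms(2) by simp
  note S = surviving_first[where L = "loops N (off_grid N \<union> {0}) 0" and Q = "\<lambda>r. True" and y = p,
      OF loops_ends I(1) o(4)[symmetric] I(2) m(1) T]
  have "starts N I p t = {ts \<in> conc (loops N (off_grid N \<union> {0}) 0) (lang N I 0 p). \<exists>t' r. [t'] \<in> {[t]} \<and> erase_loops 0 ts = t' # r \<and> True}"
    unfolding starts_def walks_def by auto
  then have "mass (starts N I p t) = mass (loops N (off_grid N \<union> {0}) 0) *
      (mass {[t]} * mass {us. (us = [] \<and> m = p \<or> us \<in> lang N I m p) \<and> True})"
    by (simp only: S(1)) (rule S(2))
  then show ?thesis
    using m(2) mass_loops_start[OF target_frame[OF assms(1)]] by (simp add: mass_single)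
qed

lemma mass_starts2:
  assumes "is_target (Suc N) p q" "[t] \<in> one_step N 0 m" "m \<in> off_grid N" "I = off_grid N \<or> I = off_grid N \<union> {q}"
    and "m' \<in> off_grid N" "m' \<noteq> m" "(\<lambda>s. [s]) ` S \<subseteq> one_step N m m'"
    and "mass (loops N I m) * mass (lang N (I - {m}) m' p) = ennreal r"
  shows "mass (starts2 N I p t S) = ennreal (5 / 3) * (weight [t] * (mass ((\<lambda>s. [s]) ` S) * ennreal r))"
proof -
  note o = target_off_grid[OF assms(1)]
  let ?T = "(\<lambda>s. [s]) ` S"
  have I: "0 \<notin> I" "m \<in> I" "p \<notin> I" "m' \<in> I - {m}" "m \<notin> I - {m}" using assms(3-6) o by auto
  have m: "m \<noteq> 0" "m \<noteq> p" "m' \<noteq> p" using assms(3,5) o by auto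
  have T: "{[t]} \<subseteq> one_step N 0 m" using assms(2) by simp
  let ?Q = "\<lambda>r. \<exists>s r'. [s] \<in> ?T \<and> r = s # r' \<and> True"
  note S1 = surviving_first[where L = "loops N (off_grid N \<union> {0}) 0" and Q = "?Q" and y = p,
      OF loops_ends I(1) o(4)[symmetric] I(2) m(1) T]
  note S2 = surviving_first[where L = "loops N I m" and Q = "\<lambda>r. True" and y = p,
      OF loops_ends I(5) m(2) I(4) assms(6,7)]
  have "starts2 N I p t S = {ts \<in> conc (loops N (off_grid N \<union> {0}) 0) (lang N I 0 p). \<exists>t' r. [t'] \<in> {[t]} \<and> erase_loops 0 ts = t' # r \<and> ?Q r}"
    unfolding starts2_def walks_def by auto
  moreover have "{us. (us = [] \<and> m = p \<or> us \<in> lang N I m p) \<and> ?Q (erase_loops m us)} =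
      {us \<in> conc (loops N I m) (lang N (I - {m}) m p). \<exists>s r'. [s] \<in> ?T \<and> erase_loops m us = s # r' \<and> True}"
    unfolding lang_eq_conc_loops[OF I(2) m(2), symmetric] using m(2) by auto
  ultimately have "mass (starts2 N I p t S) = ennreal (5 / 3) * (weight [t] * (mass (loops N I m) * (mass ?T * mass (lang N (I - {m}) m' p))))"
    using S1 S2 m(3) mass_loops_start[OF target_frame[OF assms(1)]] by (simp add: mass_single)
  then show ?thesis unfolding assms(8)[symmetric] by (simp add: ac_simps)
qed

text \<open>The mixture of the four laws: \<open>11 / 28 * 4 = 11 / 7\<close> and
  \<open>3 / 28 * 16 = 12 / 7\<close>, where 4 and 16 come from the exponents \<open>n - 1\<close>
  and \<open>n - 2\<close>.\<close>

definition U_mass :: "nat \<Rightarrow> path \<Rightarrow> real" where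
  "U_mass N w = (if w \<in> W N (apex N) \<union> W N (corner N) then 11 / 7 * (1 / 4) ^ path_length w
     else if w \<in> V N (corner N) (apex N) \<union> V N (apex N) (corner N) then 12 / 7 * (1 / 4) ^ path_length w else 0)"

definition first_piece_of :: "nat \<Rightarrow> path \<Rightarrow> path" where
  "first_piece_of N w = stopped N (erase_level N w)"

lemma first_piece_walks:
  assumes "is_target (Suc N) p q" "ts \<in> W_walks N p \<union> V_walks N q p"
  obtains t us z z' where "erase_loops 0 ts = t # us" "is_target N z z'" "last t = z" "is_step N 0 t" "walk 0 [t]"
    "first_piece_of N (as_path ts) = (if us \<noteq> [] \<and> last (hd us) = z' then 0 # t @ hd us else 0 # t)"
    "us \<noteq> [] \<longrightarrow> [hd us] \<in> one_step N z (last (hd us))"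
proof -
  have ts: "ts \<in> walks N (off_grid N \<union> {q}) p" using assms walks_split(1) by blast
  have "as_path ts \<in> W (Suc N) p \<union> V (Suc N) q p" using assms W_refined V_refined by blast
  then have U: "as_path ts \<in> U (Suc N)" using assms(1) unfolding U_def is_target_def by blast
  obtain t us z z' where *: "erase_loops 0 ts = t # us" "erase_level N (as_path ts) = as_path (t # us)"
    "good N 0 (t # us)" "is_target N z z'" "last t = z"
    "us = [] \<or> last (hd us) \<noteq> z' \<Longrightarrow> first_run N 0 [t] us"
    "us \<noteq> [] \<Longrightarrow> last (hd us) = z' \<Longrightarrow> first_run N 0 [t, hd us] (tl us)"
    using first_piece[OF assms(1) U walks_steps[OF ts]] by blast
  have st: "steps N 0 (t # us)" "walk 0 (t # us)" using *(3) by (auto simp: good_def)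
  have t: "t \<noteq> []" using st(1) by (auto simp: is_step_def)
  have piece: "first_piece_of N (as_path ts) = (if us \<noteq> [] \<and> last (hd us) = z' then 0 # t @ hd us else 0 # t)"
  proof (cases "us \<noteq> [] \<and> last (hd us) = z'")
    case True
    then have fr: "first_run N 0 [t, hd us] (tl us)" using *(7) by blast
    have e: "t # us = [t, hd us] @ tl us" using True by simp
    show ?thesis unfolding first_piece_of_def *(2) e
      using stopped_first_run[OF st(1)[unfolded e] fr] True by simp
  next
    case False
    then have fr: "first_run N 0 [t] us" using *(6) by blast
    have e: "t # us = [t] @ us" by simp
    show ?thesis unfolding first_piece_of_def *(2) e if_not_P[OF False]
      using stopped_first_run[OF st(1)[unfolded e] fr] by simp
  qed
  show ?thesis
  proof (rule that[OF *(1,4,5) _ _ piece])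
    show "is_step N 0 t" using st by simp
    show "walk 0 [t]" using st(2) t by (simp add: walk_Cons)
    show "us \<noteq> [] \<longrightarrow> [hd us] \<in> one_step N z (last (hd us))"
    proof
      assume "us \<noteq> []"
      then obtain u us' where us: "us = u # us'" by (cases us) auto
      then have "is_step N z u" "u \<noteq> []" using st(1) *(5) by (auto simp: is_step_def)
      then show "[hd us] \<in> one_step N z (last (hd us))"
        using st(2) t *(5) us unfolding one_step_iff by (auto simp: walk_Cons)
    qed
  qed
qed

lemma path_steps_inject:
  assumes "is_step N 0 t" "is_step N 0 t'" "0 # t @ a = 0 # t' @ b"
  shows "t = t' \<and> a = b"
proof -
  have "t @ a = t' @ b" using assms(3) by simp
  moreover from is_step_prefix[OF assms(1,2) this] have "t = t'" .
  ultimately show ?thesis by simp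
qed

text \<open>The first piece is the single step \<open>t\<close> unless the loop erasure continues
  from \<open>m\<close> to the other corner \<open>m'\<close>. So the walks above this piece are
  those that start with \<open>t\<close> minus those that start with \<open>t\<close> and a step to
  \<open>m'\<close>.\<close>

lemma fibre_one:
  assumes pq: "is_target (Suc N) p q" and t: "is_target N m m'" "[t] \<in> one_step N 0 m"
    and T: "T \<subseteq> W_walks N p \<union> V_walks N q p"
  shows "{ts \<in> T. \<exists>r. erase_loops 0 ts = t # r} =
    {ts \<in> T. first_piece_of N (as_path ts) = 0 # t} \<union>
    {ts \<in> T. \<exists>s r. s \<in> {s. [s] \<in> one_step N m m'} \<and> erase_loops 0 ts = t # s # r}"
    "{ts \<in> T. first_piece_of N (as_path ts) = 0 # t} \<inter>
    {ts \<in> T. \<exists>s r. s \<in> {s. [s] \<in> one_step N m m'} \<and> erase_loops 0 ts = t # s # r} = {}"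
proof -
  have st: "is_step N 0 t" "last t = m" using t(2) by (auto simp: one_step_iff)
  have key: "(first_piece_of N (as_path ts) = 0 # t \<longleftrightarrow> (\<exists>r. erase_loops 0 ts = t # r) \<and> \<not> (\<exists>s r. [s] \<in> one_step N m m' \<and> erase_loops 0 ts = t # s # r))"
    if ts: "ts \<in> T" for ts
  proof -
    from ts T have "ts \<in> W_walks N p \<union> V_walks N q p" by blast
    then obtain t0 us z z' where *: "erase_loops 0 ts = t0 # us" "is_target N z z'" "last t0 = z" "is_step N 0 t0" "walk 0 [t0]"
      "first_piece_of N (as_path ts) = (if us \<noteq> [] \<and> last (hd us) = z' then 0 # t0 @ hd us else 0 # t0)"
      "us \<noteq> [] \<longrightarrow> [hd us] \<in> one_step N z (last (hd us))"
      by (rule first_piece_walks[OF pq])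
    have z': "z' = m'" if "t0 = t"
      using *(2,3) t(1) st(2) that target_corners(2)[OF t(1)] unfolding is_target_def by auto
    show ?thesis
    proof (cases "t0 = t")
      case False
      then have "\<not> (0 # t0 @ hd us = 0 # t)" "\<not> (0 # t0 = 0 # t)"
        using path_steps_inject[OF *(4) st(1), of "hd us" "[]"] by auto
      then show ?thesis using False *(1,6) by auto
    next
      case True
      show ?thesis
      proof (cases "us \<noteq> [] \<and> last (hd us) = z'")
        case True': True
        then have ne: "hd us \<noteq> []" using *(7) by (auto simp: one_step_iff is_step_def)
        have m: "[hd us] \<in> one_step N m m'" using *(7,3) True' z'[OF True] st(2) True by auto
        have "erase_loops 0 ts = t # hd us # tl us" using *(1) True True' by simp
        then have "\<exists>s r. [s] \<in> one_step N m m' \<and> erase_loops 0 ts = t # s # r" using m by blast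
        moreover have "first_piece_of N (as_path ts) \<noteq> 0 # t" using *(6) True' True ne by simp
        ultimately show ?thesis by blast
      next
        case False
        then have "\<not> (\<exists>s r. [s] \<in> one_step N m m' \<and> erase_loops 0 ts = t # s # r)"
          using *(1) z'[OF True] by (auto simp: one_step_iff)
        moreover have "first_piece_of N (as_path ts) = 0 # t" using *(6) False True by (simp only: if_False)
        ultimately show ?thesis using *(1) True by blast
      qed
    qed
  qed
  show "{ts \<in> T. \<exists>r. erase_loops 0 ts = t # r} =
    {ts \<in> T. first_piece_of N (as_path ts) = 0 # t} \<union>
    {ts \<in> T. \<exists>s r. s \<in> {s. [s] \<in> one_step N m m'} \<and> erase_loops 0 ts = t # s # r}" using key by blast
  show "{ts \<in> T. first_piece_of N (as_path ts) = 0 # t} \<inter>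
    {ts \<in> T. \<exists>s r. s \<in> {s. [s] \<in> one_step N m m'} \<and> erase_loops 0 ts = t # s # r} = {}" using key by blast
qed

lemma fibre_two:
  assumes pq: "is_target (Suc N) p q" and t: "is_target N m m'" "[t] \<in> one_step N 0 m" "[s] \<in> one_step N m m'"
    and T: "T \<subseteq> W_walks N p \<union> V_walks N q p"
  shows "{ts \<in> T. first_piece_of N (as_path ts) = 0 # t @ s} = {ts \<in> T. \<exists>s' r. s' \<in> {s} \<and> erase_loops 0 ts = t # s' # r}"
proof -
  have st: "is_step N 0 t" "last t = m" "s \<noteq> []" "last s = m'" using t(2,3) by (auto simp: one_step_iff is_step_def)
  have key: "first_piece_of N (as_path ts) = 0 # t @ s \<longleftrightarrow> (\<exists>r. erase_loops 0 ts = t # s # r)" if ts: "ts \<in> T" for ts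
  proof -
    from ts T have "ts \<in> W_walks N p \<union> V_walks N q p" by blast
    then obtain t0 us z z' where *: "erase_loops 0 ts = t0 # us" "is_target N z z'" "last t0 = z" "is_step N 0 t0" "walk 0 [t0]"
      "first_piece_of N (as_path ts) = (if us \<noteq> [] \<and> last (hd us) = z' then 0 # t0 @ hd us else 0 # t0)"
      "us \<noteq> [] \<longrightarrow> [hd us] \<in> one_step N z (last (hd us))"
      by (rule first_piece_walks[OF pq])
    have z': "z' = m'" if "t0 = t"
      using *(2,3) t(1) st(2) that target_corners(2)[OF t(1)] unfolding is_target_def by auto
    show ?thesis
    proof (cases "t0 = t")
      case False
      then have "\<not> (0 # t0 @ hd us = 0 # t @ s)" "\<not> (0 # t0 = 0 # t @ s)"
        using path_steps_inject[OF *(4) st(1), of "hd us" s] path_steps_inject[OF *(4) st(1), of "[]" s] by auto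
      then show ?thesis using False *(1,6) by auto
    next
      case True
      then show ?thesis using *(1,6) z' st(3,4) by (cases us) auto
    qed
  qed
  then show ?thesis by auto
qed

lemma ennreal_add_cancel_real:
  assumes "x + ennreal b = ennreal a" "b \<ge> 0" "a \<ge> 0"
  shows "x = ennreal (a - b)"
proof (cases x)
  case (real r)
  then have "ennreal (r + b) = ennreal a" using assms(1,2) by (simp only: ennreal_plus)
  moreover have "r + b \<ge> 0" using real assms(2) by simp
  ultimately have "r + b = a" using assms(3) by (simp only: ennreal_inj)
  then have "r = a - b" by simp
  then show ?thesis using real by simp
qed (use assms in simp)

lemma mass_fibre_two:
  assumes pq: "is_target (Suc N) p q" and m: "is_target N m m'" "m \<in> off_grid N" "m' \<in> off_grid N"
    and t: "[t] \<in> one_step N 0 m" "[s] \<in> one_step N m m'" and I: "I = off_grid N \<or> I = off_grid N \<union> {q}"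
    and r: "mass (loops N I m) * mass (lang N (I - {m}) m' p) = ennreal r" "r \<ge> 0"
  shows "mass {ts \<in> walks N I p. first_piece_of N (as_path ts) = 0 # t @ s}
    = ennreal (5 / 3 * r * (1 / 4) ^ length (t @ s))"
proof -
  have sub: "walks N I p \<subseteq> W_walks N p \<union> V_walks N q p"
    using I walks_split(1)[OF pq] by (auto simp: W_walks_def)
  have ne: "m' \<noteq> m" using target_corners(2)[OF m(1)] by auto
  have "{ts \<in> walks N I p. first_piece_of N (as_path ts) = 0 # t @ s} = starts2 N I p t {s}"
    unfolding fibre_two[OF pq m(1) t sub] starts2_def ..
  also have "mass \<dots> = ennreal (5 / 3) * (weight [t] * (mass {[s]} * ennreal r))"
    using mass_starts2[OF pq t(1) m(2) I m(3) ne _ r(1), of "{s}"] t(2) by simp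
  also have "\<dots> = ennreal (5 / 3 * ((1 / 4) ^ length t * ((1 / 4) ^ length s * r)))"
    using r(2) unfolding mass_single weight_def by (simp add: ennreal_mult[symmetric] del: ennreal_power)
  also have "5 / 3 * ((1 / 4) ^ length t * ((1 / 4) ^ length s * r)) = 5 / 3 * r * (1 / 4) ^ length (t @ s)"
    by (simp add: power_add)
  finally show ?thesis .
qed

text \<open>The walks that continue from \<open>m\<close> to \<open>m'\<close> are removed; their
  step from \<open>m\<close> to \<open>m'\<close> has mass \<open>1 / 4\<close>, whence
  \<open>h - r / 4\<close>.\<close>

lemma mass_fibre_one:
  assumes pq: "is_target (Suc N) p q" and m: "is_target N m m'" "m \<in> off_grid N" "m' \<in> off_grid N"
    and t: "[t] \<in> one_step N 0 m" and I: "I = off_grid N \<or> I = off_grid N \<union> {q}"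
    and r: "mass (loops N I m) * mass (lang N (I - {m}) m' p) = ennreal r" "r \<ge> 0"
    and h: "hitting N I m p = h"
  shows "mass {ts \<in> walks N I p. first_piece_of N (as_path ts) = 0 # t}
    = ennreal (5 / 3 * (h - r / 4) * (1 / 4) ^ length t)"
proof -
  note o = target_off_grid[OF pq]
  have sub: "walks N I p \<subseteq> W_walks N p \<union> V_walks N q p"
    using I walks_split(1)[OF pq] by (auto simp: W_walks_def)
  have ne: "m' \<noteq> m" using target_corners(2)[OF m(1)] by auto
  have mN: "m \<in> gasket_vertices N" using t one_step_iff[of "[t]" N 0 m] by (auto simp: is_step_def)
  have "m' \<in> gasket_vertices N" using target_corners(1)[OF m(1)] gasket_verticesI[OF zero_cell, of m' N] by simp
  then have am: "adj N m m'" using target_corners[OF m(1)] zero_cell[of N] unfolding adj_iff by auto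
  let ?S = "{s. [s] \<in> one_step N m m'}" let ?w = "(1 / 4) ^ length t :: real"
  have S: "(\<lambda>s. [s]) ` ?S = one_step N m m'" by (auto simp: one_step_iff)
  have "mass (starts N I p t) = ennreal (5 / 3) * (weight [t] * mass (lang N I m p))"
    by (rule mass_starts[OF pq t m(2) I])
  also have "mass (lang N I m p) = ennreal h"
    using mass_hitting[OF decimates mN, of p I] h I o by auto
  finally have 1: "mass (starts N I p t) = ennreal (5 / 3 * h * ?w)"
    unfolding weight_def by (simp add: ennreal_mult[symmetric] h[symmetric] hitting_def mult_ac del: ennreal_power)
  have "mass (starts2 N I p t ?S) = ennreal (5 / 3) * (weight [t] * (mass (one_step N m m') * ennreal r))"
    using mass_starts2[OF pq t m(2) I m(3) ne _ r(1), of ?S] unfolding S by simp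
  also have "mass (one_step N m m') = ennreal (1 / 4)" using decimates[of N] am by (simp add: decimates_def)
  also have "ennreal (5 / 3) * (weight [t] * (ennreal (1 / 4) * ennreal r)) = ennreal (5 / 3 * (?w * (1 / 4 * r)))"
    using r(2) unfolding weight_def by (simp add: ennreal_mult[symmetric] del: ennreal_power)
  finally have 2: "mass (starts2 N I p t ?S) = ennreal (5 / 3 * (?w * (1 / 4 * r)))" .
  have un: "starts N I p t = {ts \<in> walks N I p. first_piece_of N (as_path ts) = 0 # t} \<union> starts2 N I p t ?S"
    "{ts \<in> walks N I p. first_piece_of N (as_path ts) = 0 # t} \<inter> starts2 N I p t ?S = {}"
    using fibre_one[OF pq m(1) t sub] unfolding starts_def starts2_def by blast+
  have "mass {ts \<in> walks N I p. first_piece_of N (as_path ts) = 0 # t} + ennreal (5 / 3 * (?w * (1 / 4 * r)))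
    = ennreal (5 / 3 * h * ?w)"
    using mass_Un[OF un(2)] unfolding un(1)[symmetric] 1 2 by (rule sym)
  then have "mass {ts \<in> walks N I p. first_piece_of N (as_path ts) = 0 # t} =
    ennreal (5 / 3 * h * ?w - 5 / 3 * (?w * (1 / 4 * r)))"
    by (rule ennreal_add_cancel_real) (use r(2) h in \<open>auto simp: hitting_def\<close>)
  moreover have "5 / 3 * h * ?w - 5 / 3 * (?w * (1 / 4 * r)) = 5 / 3 * (h - r / 4) * ?w"
    by (simp add: field_simps)
  ultimately show ?thesis by (simp only:)
qed

lemma mass_V_fibre:
  assumes "is_target (Suc N) p q"
    "mass {ts \<in> W_walks N p. P ts} = ennreal (a * w)" "mass {ts \<in> walks N (off_grid N \<union> {q}) p. P ts} = ennreal (c * w)"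
    "a \<ge> 0" "c \<ge> 0" "w \<ge> 0"
  shows "mass {ts \<in> V_walks N q p. P ts} = ennreal ((c - a) * w)"
proof -
  have un: "{ts \<in> walks N (off_grid N \<union> {q}) p. P ts} = {ts \<in> V_walks N q p. P ts} \<union> {ts \<in> W_walks N p. P ts}"
    "{ts \<in> V_walks N q p. P ts} \<inter> {ts \<in> W_walks N p. P ts} = {}"
    using walks_split[OF assms(1)] by blast+
  have "mass {ts \<in> V_walks N q p. P ts} + ennreal (a * w) = ennreal (c * w)"
    using mass_Un[OF un(2)] unfolding un(1)[symmetric] assms(2,3) by (rule sym)
  then have "mass {ts \<in> V_walks N q p. P ts} = ennreal (c * w - a * w)"
    by (rule ennreal_add_cancel_real) (use assms in simp_all)
  then show ?thesis by (simp add: left_diff_distrib)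
qed

lemma target_mids_off_grid:
  assumes "is_target (Suc N) p q"
  shows "mid 0 p \<in> off_grid N" "mid 0 q \<in> off_grid N"
  using mid_off_grid[OF target_frame[OF assms]] by simp_all

text \<open>The first corner \<open>mid 0 p\<close> of the piece may lie on the way to the target or
  on the way to the other corner; the four lines list both possibilities for the two kinds of
  classes.\<close>

lemma masses_two:
  assumes pq: "is_target (Suc N) p q" and t: "[t] \<in> one_step N 0 (mid 0 p)" "[s] \<in> one_step N (mid 0 p) (mid 0 q)"
  defines "w \<equiv> (1 / 4) ^ length (t @ s) :: real" and "P \<equiv> \<lambda>ts. first_piece_of N (as_path ts) = 0 # t @ s"
  shows "mass {ts \<in> W_walks N p. P ts} = ennreal (2 / 15 * w)" "mass {ts \<in> V_walks N q p. P ts} = ennreal (1 / 10 * w)"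
    "mass {ts \<in> W_walks N q. P ts} = ennreal (2 / 3 * w)" "mass {ts \<in> V_walks N p q. P ts} = ennreal (1 / 6 * w)"
proof -
  note qp = target_sym[OF pq] and mm = target_mid[OF pq]
  note f = target_frame[OF pq] and f' = target_frame[OF qp] and o = target_mids_off_grid[OF pq]
  have w: "w \<ge> 0" by (simp add: w_def)
  have 1: "mass {ts \<in> W_walks N p. P ts} = ennreal (5 / 3 * (2 / 25) * w)"
    unfolding P_def w_def W_walks_def by (rule mass_fibre_two[OF pq mm o t disjI1[OF refl] walk_mids(2)[OF f]]) simp
  have 2: "mass {ts \<in> walks N (off_grid N \<union> {q}) p. P ts} = ennreal (5 / 3 * (7 / 50) * w)"
    unfolding P_def w_def by (rule mass_fibre_two[OF pq mm o t disjI2[OF refl] walk_mids_via(2)[OF f]]) simp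
  have 3: "mass {ts \<in> W_walks N q. P ts} = ennreal (5 / 3 * (2 / 5) * w)"
    unfolding P_def w_def W_walks_def by (rule mass_fibre_two[OF qp mm o t disjI1[OF refl] walk_mids(1)[OF f']]) simp
  have 4: "mass {ts \<in> walks N (off_grid N \<union> {p}) q. P ts} = ennreal (5 / 3 * (1 / 2) * w)"
    unfolding P_def w_def by (rule mass_fibre_two[OF qp mm o t disjI2[OF refl] walk_mids_via(1)[OF f']]) simp
  show "mass {ts \<in> W_walks N p. P ts} = ennreal (2 / 15 * w)" using 1 by simp
  show "mass {ts \<in> W_walks N q. P ts} = ennreal (2 / 3 * w)" using 3 by simp
  show "mass {ts \<in> V_walks N q p. P ts} = ennreal (1 / 10 * w)"
    using mass_V_fibre[OF pq 1 2 _ _ w] by simp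
  show "mass {ts \<in> V_walks N p q. P ts} = ennreal (1 / 6 * w)"
    using mass_V_fibre[OF qp 3 4 _ _ w] by simp
qed

text \<open>As in \<open>masses_two\<close>, for pieces that consist of one step.\<close>

lemma masses_one:
  assumes pq: "is_target (Suc N) p q" and t: "[t] \<in> one_step N 0 (mid 0 p)"
  defines "w \<equiv> (1 / 4) ^ length t :: real" and "P \<equiv> \<lambda>ts. first_piece_of N (as_path ts) = 0 # t"
  shows "mass {ts \<in> W_walks N p. P ts} = ennreal (19 / 30 * w)" "mass {ts \<in> V_walks N q p. P ts} = ennreal (7 / 120 * w)"
    "mass {ts \<in> W_walks N q. P ts} = ennreal (1 / 6 * w)" "mass {ts \<in> V_walks N p q. P ts} = ennreal (1 / 8 * w)"
proof -
  note qp = target_sym[OF pq] and mm = target_mid[OF pq]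
  note f = target_frame[OF pq] and f' = target_frame[OF qp] and o = target_mids_off_grid[OF pq]
  have w: "w \<ge> 0" by (simp add: w_def)
  have 1: "mass {ts \<in> W_walks N p. P ts} = ennreal (5 / 3 * (2 / 5 - 2 / 25 / 4) * w)"
    unfolding P_def w_def W_walks_def
    by (rule mass_fibre_one[OF pq mm o t disjI1[OF refl] walk_mids(2)[OF f] _ hitting_off_grid(1)[OF f]]) simp
  have 2: "mass {ts \<in> walks N (off_grid N \<union> {q}) p. P ts} = ennreal (5 / 3 * (9 / 20 - 7 / 50 / 4) * w)"
    unfolding P_def w_def
    by (rule mass_fibre_one[OF pq mm o t disjI2[OF refl] walk_mids_via(2)[OF f] _ hitting_via(1)[OF f]]) simp
  have 3: "mass {ts \<in> W_walks N q. P ts} = ennreal (5 / 3 * (1 / 5 - 2 / 5 / 4) * w)"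
    unfolding P_def w_def W_walks_def
    by (rule mass_fibre_one[OF qp mm o t disjI1[OF refl] walk_mids(1)[OF f'] _ hitting_off_grid(2)[OF f']]) simp
  have 4: "mass {ts \<in> walks N (off_grid N \<union> {p}) q. P ts} = ennreal (5 / 3 * (3 / 10 - 1 / 2 / 4) * w)"
    unfolding P_def w_def
    by (rule mass_fibre_one[OF qp mm o t disjI2[OF refl] walk_mids_via(1)[OF f'] _ hitting_via(2)[OF f']]) simp
  show "mass {ts \<in> W_walks N p. P ts} = ennreal (19 / 30 * w)" using 1 by simp
  show "mass {ts \<in> W_walks N q. P ts} = ennreal (1 / 6 * w)" using 3 by simp
  show "mass {ts \<in> V_walks N q p. P ts} = ennreal (7 / 120 * w)"
    using mass_V_fibre[OF pq 1 2 _ _ w] by simp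
  show "mass {ts \<in> V_walks N p q. P ts} = ennreal (1 / 8 * w)"
    using mass_V_fibre[OF qp 3 4 _ _ w] by simp
qed

section \<open>Consistency of the laws\<close>

definition path_weights :: "path measure" where
  "path_weights = density (count_space UNIV) (\<lambda>w. ennreal ((1 / 4) ^ path_length w))"

abbreviation pmass :: "path set \<Rightarrow> ennreal" where
  "pmass \<equiv> emeasure path_weights"

lemma sets_path_weights [simp]: "A \<in> sets path_weights"
  by (simp add: path_weights_def)

lemma pmass_eq: "pmass A = (\<integral>\<^sup>+w. ennreal ((1 / 4) ^ path_length w) \<partial>count_space A)"
  by (simp add: path_weights_def emeasure_density nn_integral_count_space_indicator)

lemma pmass_as_path:
  assumes "\<And>ts. ts \<in> T \<Longrightarrow> steps N 0 ts"
  shows "pmass (as_path ` T) = mass T"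
proof -
  have inj: "inj_on as_path T"
    by (rule inj_onI) (use assms steps_unique in blast)
  have "pmass (as_path ` T) = (\<integral>\<^sup>+ts. ennreal ((1 / 4) ^ path_length (as_path ts)) \<partial>count_space T)"
    unfolding pmass_eq by (rule nn_integral_bij_count_space[OF inj_on_imp_bij_betw[OF inj], symmetric])
  then show ?thesis unfolding mass_eq by (simp add: path_length_def weight_def[abs_def])
qed

lemma pmass_fibre:
  assumes "A = as_path ` T" "\<And>ts. ts \<in> T \<Longrightarrow> steps N 0 ts"
  shows "pmass (A \<inter> {w. P w}) = mass {ts \<in> T. P (as_path ts)}"
proof -
  have "A \<inter> {w. P w} = as_path ` {ts \<in> T. P (as_path ts)}" using assms(1) by blast
  then show ?thesis using pmass_as_path[of "{ts \<in> T. P (as_path ts)}" N] assms(2) by simp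
qed

lemma routes_disjoint:
  assumes "ps \<noteq> ps'"
  shows "as_path ` routes N ps \<inter> as_path ` routes N ps' = {}"
proof (intro equals0I, elim IntE imageE)
  fix w ts us assume *: "w = as_path ts" "ts \<in> routes N ps" "w = as_path us" "us \<in> routes N ps'"
  then have "steps N 0 ts" "steps N 0 us" "concat ts = concat us" by (simp_all add: routes_def)
  then have "ts = us" by (rule steps_unique)
  then show False using * assms by (simp add: routes_def)
qed

lemma U_parts_disjoint:
  "W N (apex N) \<inter> W N (corner N) = {}"
  "(W N (apex N) \<union> W N (corner N)) \<inter> (V N (corner N) (apex N) \<union> V N (apex N) (corner N)) = {}"
  "V N (corner N) (apex N) \<inter> V N (apex N) (corner N) = {}"
  using apex_corner_distinct[of N] routes_disjoint[of "[apex N]" "[corner N]" N]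
    routes_disjoint[of "[apex N]" "[corner N, apex N]" N] routes_disjoint[of "[apex N]" "[apex N, corner N]" N]
    routes_disjoint[of "[corner N]" "[corner N, apex N]" N] routes_disjoint[of "[corner N]" "[apex N, corner N]" N]
    routes_disjoint[of "[corner N, apex N]" "[apex N, corner N]" N]
  unfolding W_eq V_eq by (simp_all add: Int_Un_distrib Int_Un_distrib2)

lemma target_adj: "is_target N p q \<Longrightarrow> adj N 0 p" "is_target N p q \<Longrightarrow> adj N q p"
  using zero_cell[of N] target_corners[of N p q] unfolding adj_iff by auto

text \<open>By decimation invariance the normalisation of the laws is that of one edge.\<close>

lemma pmass_W: "is_target N p q \<Longrightarrow> pmass (W N p) = ennreal (1 / 4)"
proof -
  assume pq: "is_target N p q"
  have "routes N [p] = one_step N 0 p" by (rule set_eqI) (rule routes_single)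
  moreover have "pmass (W N p) = mass (routes N [p])"
    unfolding W_eq by (rule pmass_as_path[of _ N]) (simp add: routes_def)
  ultimately show ?thesis using decimates[of N] target_adj(1)[OF pq] by (simp add: decimates_def)
qed

lemma pmass_V: "is_target N p q \<Longrightarrow> pmass (V N q p) = ennreal (1 / 16)"
proof -
  assume pq: "is_target N p q"
  have "routes N [q, p] = conc (one_step N 0 q) (one_step N q p)"
  proof (intro set_eqI iffI)
    fix ts assume "ts \<in> routes N [q, p]"
    then obtain a b where "ts = [a] @ [b]" "[a] \<in> one_step N 0 q" "[b] \<in> one_step N q p" unfolding routes_pair by auto
    then show "ts \<in> conc (one_step N 0 q) (one_step N q p)" using concI by blast
  next
    fix ts assume "ts \<in> conc (one_step N 0 q) (one_step N q p)"
    then obtain l l' where l: "ts = l @ l'" "l \<in> one_step N 0 q" "l' \<in> one_step N q p" unfolding conc_def by blast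
    moreover from l(2) obtain a where "l = [a]" unfolding one_step_iff by blast
    moreover from l(3) obtain b where "l' = [b]" unfolding one_step_iff by blast
    ultimately show "ts \<in> routes N [q, p]" unfolding routes_pair by simp
  qed
  moreover have "mass (conc (one_step N 0 q) (one_step N q p)) = mass (one_step N 0 q) * mass (one_step N q p)"
  proof (rule mass_conc)
    fix a b a' b' assume *: "a \<in> one_step N 0 q" "a' \<in> one_step N 0 q" "a @ b = a' @ b'"
    obtain t where "a = [t]" using *(1) unfolding one_step_iff by blast
    moreover obtain t' where "a' = [t']" using *(2) unfolding one_step_iff by blast
    ultimately show "a = a'" using *(3) by simp
  qed
  moreover have "pmass (V N q p) = mass (routes N [q, p])"
    unfolding V_eq by (rule pmass_as_path[of _ N]) (simp add: routes_def)
  ultimately show ?thesis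
    using decimates[of N] target_adj(1)[OF target_sym[OF pq]] target_adj(2)[OF pq]
    by (simp add: decimates_def ennreal_mult[symmetric])
qed

lemma targets: "is_target N (apex N) (corner N)" "is_target N (corner N) (apex N)"
  by (simp_all add: is_target_def)

lemma U_mass_integral:
  "(\<integral>\<^sup>+w. ennreal (U_mass N w) * indicator S w \<partial>count_space UNIV) =
    ennreal (11 / 7) * (pmass (W N (apex N) \<inter> S) + pmass (W N (corner N) \<inter> S)) +
    ennreal (12 / 7) * (pmass (V N (corner N) (apex N) \<inter> S) + pmass (V N (apex N) (corner N) \<inter> S))"
proof -
  let ?W = "W N (apex N) \<union> W N (corner N)" and ?V = "V N (corner N) (apex N) \<union> V N (apex N) (corner N)"
  let ?f = "\<lambda>w. ennreal ((1 / 4) ^ path_length w)"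
  have e: "ennreal (U_mass N w) * indicator S w =
      ennreal (11 / 7) * (?f w * indicator (?W \<inter> S) w) + ennreal (12 / 7) * (?f w * indicator (?V \<inter> S) w)" for w
    using U_parts_disjoint(2)[of N]
    by (auto simp: U_mass_def ennreal_mult[symmetric] simp del: ennreal_power split: split_indicator)
  have i: "(\<integral>\<^sup>+w. ?f w * indicator A w \<partial>count_space UNIV) = pmass A" for A
    by (simp add: pmass_eq nn_integral_count_space_indicator)
  have "(\<integral>\<^sup>+w. ennreal (U_mass N w) * indicator S w \<partial>count_space UNIV)
    = ennreal (11 / 7) * pmass (?W \<inter> S) + ennreal (12 / 7) * pmass (?V \<inter> S)"
    unfolding e by (subst nn_integral_add) (simp_all add: nn_integral_cmult i del: ennreal_power)
  moreover have "pmass (?W \<inter> S) = pmass (W N (apex N) \<inter> S) + pmass (W N (corner N) \<inter> S)"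
    unfolding Int_Un_distrib2 by (rule plus_emeasure[symmetric]) (use U_parts_disjoint(1)[of N] in auto)
  moreover have "pmass (?V \<inter> S) = pmass (V N (corner N) (apex N) \<inter> S) + pmass (V N (apex N) (corner N) \<inter> S)"
    unfolding Int_Un_distrib2 by (rule plus_emeasure[symmetric]) (use U_parts_disjoint(3)[of N] in auto)
  ultimately show ?thesis by simp
qed

lemma U_mass_nonneg: "U_mass N w \<ge> 0"
  by (simp add: U_mass_def)

lemma ennreal_mixture:
  fixes a b c d e f :: real
  assumes "a \<ge> 0" "b \<ge> 0" "c \<ge> 0" "d \<ge> 0" "e \<ge> 0" "f \<ge> 0"
  shows "ennreal a * (ennreal b + ennreal c) + ennreal d * (ennreal e + ennreal f) = ennreal (a * (b + c) + d * (e + f))"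
  using assms by (simp add: ennreal_plus[symmetric] ennreal_mult[symmetric] del: ennreal_plus)

lemma U_mass_total: "(\<integral>\<^sup>+w. ennreal (U_mass N w) \<partial>count_space UNIV) = 1"
proof -
  have "(\<integral>\<^sup>+w. ennreal (U_mass N w) \<partial>count_space UNIV) =
     ennreal (11 / 7) * (ennreal (1 / 4) + ennreal (1 / 4)) + ennreal (12 / 7) * (ennreal (1 / 16) + ennreal (1 / 16))"
    using U_mass_integral[of N UNIV] pmass_W[OF targets(1)[of N]] pmass_W[OF targets(2)[of N]]
      pmass_V[OF targets(1)[of N]] pmass_V[OF targets(2)[of N]] by simp
  also have "\<dots> = ennreal (11 / 7 * (1 / 4 + 1 / 4) + 12 / 7 * (1 / 16 + 1 / 16))"
    by (rule ennreal_mixture) simp_all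
  finally show ?thesis by simp
qed

definition walk_pmf :: "nat \<Rightarrow> path pmf" where
  "walk_pmf N = embed_pmf (U_mass N)"

lemma pmf_walk_pmf: "pmf (walk_pmf N) w = U_mass N w"
  unfolding walk_pmf_def by (rule pmf_embed_pmf[OF U_mass_nonneg U_mass_total])

lemma set_walk_pmf: "set_pmf (walk_pmf N) \<subseteq> U N"
  by (auto simp: set_pmf_iff pmf_walk_pmf U_mass_def U_def split: if_splits)

text \<open>The mixture as a measure on sets, the form in which it is compared with the definition
  of the law of the loop-erased walk.\<close>

lemma emeasure_walk_pmf:
  "emeasure (walk_pmf N) S =
    ennreal (11 / 7) * (pmass (W N (apex N) \<inter> S) + pmass (W N (corner N) \<inter> S)) +
    ennreal (12 / 7) * (pmass (V N (corner N) (apex N) \<inter> S) + pmass (V N (apex N) (corner N) \<inter> S))"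
  unfolding U_mass_integral[symmetric] measure_pmf_eq_density
  by (subst emeasure_density) (simp_all add: pmf_walk_pmf)

lemma refined_walk_steps:
  "is_target (Suc N) p q \<Longrightarrow> ts \<in> W_walks N p \<union> V_walks N q p \<Longrightarrow> steps N 0 ts"
  using walks_split(1) walks_steps by blast

lemma emeasure_fibre:
  assumes pq: "is_target (Suc N) p q"
  shows "emeasure (walk_pmf (Suc N)) {w. first_piece_of N w = u} =
    ennreal (11 / 7) * (mass {ts \<in> W_walks N p. first_piece_of N (as_path ts) = u} + mass {ts \<in> W_walks N q. first_piece_of N (as_path ts) = u}) +
    ennreal (12 / 7) * (mass {ts \<in> V_walks N q p. first_piece_of N (as_path ts) = u} + mass {ts \<in> V_walks N p q. first_piece_of N (as_path ts) = u})"
proof -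
  note qp = target_sym[OF pq]
  have "pmass (W (Suc N) p \<inter> {w. first_piece_of N w = u}) = mass {ts \<in> W_walks N p. first_piece_of N (as_path ts) = u}"
    by (rule pmass_fibre[OF W_refined[OF pq]]) (use refined_walk_steps[OF pq] in blast)
  moreover have "pmass (W (Suc N) q \<inter> {w. first_piece_of N w = u}) = mass {ts \<in> W_walks N q. first_piece_of N (as_path ts) = u}"
    by (rule pmass_fibre[OF W_refined[OF qp]]) (use refined_walk_steps[OF qp] in blast)
  moreover have "pmass (V (Suc N) q p \<inter> {w. first_piece_of N w = u}) = mass {ts \<in> V_walks N q p. first_piece_of N (as_path ts) = u}"
    by (rule pmass_fibre[OF V_refined[OF pq]]) (use refined_walk_steps[OF pq] in blast)
  moreover have "pmass (V (Suc N) p q \<inter> {w. first_piece_of N w = u}) = mass {ts \<in> V_walks N p q. first_piece_of N (as_path ts) = u}"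
    by (rule pmass_fibre[OF V_refined[OF qp]]) (use refined_walk_steps[OF qp] in blast)
  moreover have "(p = apex (Suc N) \<and> q = corner (Suc N)) \<or> (p = corner (Suc N) \<and> q = apex (Suc N))"
    using pq by (simp add: is_target_def)
  ultimately show ?thesis unfolding emeasure_walk_pmf by (elim disjE) (simp_all add: add.commute)
qed

lemma target_lift:
  assumes "is_target N m m'"
  obtains p q where "is_target (Suc N) p q" "m = mid 0 p" "m' = mid 0 q"
proof -
  have "mid 0 (apex (Suc N)) = apex N" "mid 0 (corner (Suc N)) = corner N"
    by (simp_all add: zero_eq_pt apex_eq_pt corner_eq_pt mid_pt)
  then show ?thesis using assms that targets[of "Suc N"] unfolding is_target_def by metis
qed

lemma first_piece_in_U:
  assumes "w \<in> U (Suc N)"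
  shows "first_piece_of N w \<in> U N"
proof -
  obtain p q where pq: "is_target (Suc N) p q" "w \<in> W (Suc N) p \<union> V (Suc N) q p"
    using assms unfolding U_def is_target_def by blast
  then have "w \<in> as_path ` (W_walks N p \<union> V_walks N q p)" using W_refined[OF pq(1)] V_refined[OF pq(1)] by blast
  then obtain ts where ts: "w = as_path ts" "ts \<in> W_walks N p \<union> V_walks N q p" by (rule imageE)
  obtain t us z z' where *: "erase_loops 0 ts = t # us" "is_target N z z'" "last t = z" "is_step N 0 t" "walk 0 [t]"
    "first_piece_of N (as_path ts) = (if us \<noteq> [] \<and> last (hd us) = z' then 0 # t @ hd us else 0 # t)"
    "us \<noteq> [] \<longrightarrow> [hd us] \<in> one_step N z (last (hd us))"
    by (rule first_piece_walks[OF pq(1) ts(2)])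
  have t: "[t] \<in> one_step N 0 z" using *(3-5) unfolding one_step_iff by (simp add: walk_def)
  show ?thesis
  proof (cases "us \<noteq> [] \<and> last (hd us) = z'")
    case True
    then have "[t, hd us] \<in> routes N [z, z']" using t *(7) unfolding routes_pair by blast
    from U_I[OF target_sym[OF *(2)] disjI2[OF this]] show ?thesis using *(6) True ts(1) by simp
  next
    case False
    have "[t] \<in> routes N [z]" using t by (simp only: routes_single)
    from U_I[OF *(2) disjI1[OF this]] show ?thesis unfolding ts(1) *(6) if_not_P[OF False] by simp
  qed
qed

lemma U_mass_W:
  assumes "is_target N m m'" "[t] \<in> one_step N 0 m"
  shows "U_mass N (0 # t) = 11 / 7 * (1 / 4) ^ length t"
proof -
  have "[t] \<in> routes N [m]" using assms(2) by (simp only: routes_single)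
  from imageI[OF this, of as_path] have "0 # t \<in> W N m" unfolding W_eq by simp
  then show ?thesis using assms(1) by (auto simp: U_mass_def is_target_def path_length_def)
qed

lemma U_mass_V:
  assumes "is_target N m m'" "[t] \<in> one_step N 0 m" "[s] \<in> one_step N m m'"
  shows "U_mass N (0 # t @ s) = 12 / 7 * (1 / 4) ^ length (t @ s)"
proof -
  have "[t, s] \<in> routes N [m, m']" using assms(2,3) unfolding routes_pair by blast
  from imageI[OF this, of as_path] have "0 # t @ s \<in> V N m m'" unfolding V_eq by simp
  then have "0 # t @ s \<in> V N (corner N) (apex N) \<union> V N (apex N) (corner N)" using assms(1) by (auto simp: is_target_def)
  moreover from this have "0 # t @ s \<notin> W N (apex N) \<union> W N (corner N)" using U_parts_disjoint(2)[of N] by blast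
  ultimately show ?thesis by (simp add: U_mass_def path_length_def)
qed

text \<open>The mass above a piece is a constant multiple of its own weight, and the weights of the
  mixture are such that the constants agree with those of \<open>U_mass\<close>.\<close>

theorem first_piece_law: "map_pmf (first_piece_of N) (walk_pmf (Suc N)) = walk_pmf N"
proof (rule pmf_eqI)
  fix u
  have E: "ennreal (pmf (map_pmf (first_piece_of N) (walk_pmf (Suc N))) u) = emeasure (walk_pmf (Suc N)) {w. first_piece_of N w = u}"
    unfolding ennreal_pmf_map by (simp add: vimage_def)
  show "pmf (map_pmf (first_piece_of N) (walk_pmf (Suc N))) u = pmf (walk_pmf N) u"
  proof (cases "u \<in> U N")
    case False
    then have "u \<notin> set_pmf (map_pmf (first_piece_of N) (walk_pmf (Suc N)))"
      using set_walk_pmf[of "Suc N"] first_piece_in_U by auto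
    then show ?thesis using False set_walk_pmf[of N] by (metis pmf_eq_0_set_pmf subsetD)
  next
    case True
    then obtain m m' ts where u: "is_target N m' m" "u = as_path ts" "ts \<in> routes N [m'] \<or> ts \<in> routes N [m, m']"
      by (rule U_cases)
    from u(3) have "emeasure (walk_pmf (Suc N)) {w. first_piece_of N w = u} = ennreal (U_mass N u)"
    proof
      assume "ts \<in> routes N [m']"
      then have "ts \<in> one_step N 0 m'" by (simp only: routes_single)
      then obtain t where t: "ts = [t]" "[t] \<in> one_step N 0 m'" by (auto simp: one_step_iff)
      obtain p q where pq: "is_target (Suc N) p q" "m' = mid 0 p" "m = mid 0 q" by (rule target_lift[OF u(1)])
      have ut: "u = 0 # t" using u(2) t(1) by simp
      let ?w = "(1 / 4) ^ length t :: real"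
      have "emeasure (walk_pmf (Suc N)) {w. first_piece_of N w = u} =
        ennreal (11 / 7) * (ennreal (19 / 30 * ?w) + ennreal (1 / 6 * ?w)) + ennreal (12 / 7) * (ennreal (7 / 120 * ?w) + ennreal (1 / 8 * ?w))"
        unfolding emeasure_fibre[OF pq(1)] ut masses_one[OF pq(1) t(2)[unfolded pq(2)]] ..
      also have "\<dots> = ennreal (11 / 7 * (19 / 30 * ?w + 1 / 6 * ?w) + 12 / 7 * (7 / 120 * ?w + 1 / 8 * ?w))"
        by (rule ennreal_mixture) simp_all
      also have "11 / 7 * (19 / 30 * ?w + 1 / 6 * ?w) + 12 / 7 * (7 / 120 * ?w + 1 / 8 * ?w) = 11 / 7 * ?w" by simp
      finally show ?thesis unfolding ut U_mass_W[OF u(1) t(2)] .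
    next
      assume "ts \<in> routes N [m, m']"
      then obtain t s where t: "ts = [t, s]" "[t] \<in> one_step N 0 m" "[s] \<in> one_step N m m'" unfolding routes_pair by blast
      note tm = target_sym[OF u(1)]
      obtain p q where pq: "is_target (Suc N) p q" "m = mid 0 p" "m' = mid 0 q" by (rule target_lift[OF tm])
      have ut: "u = 0 # t @ s" using u(2) t(1) by simp
      let ?w = "(1 / 4) ^ length (t @ s) :: real"
      have "emeasure (walk_pmf (Suc N)) {w. first_piece_of N w = u} =
        ennreal (11 / 7) * (ennreal (2 / 15 * ?w) + ennreal (2 / 3 * ?w)) + ennreal (12 / 7) * (ennreal (1 / 10 * ?w) + ennreal (1 / 6 * ?w))"
        unfolding emeasure_fibre[OF pq(1)] ut masses_two[OF pq(1) t(2)[unfolded pq(2)] t(3)[unfolded pq(2,3)]] ..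
      also have "\<dots> = ennreal (11 / 7 * (2 / 15 * ?w + 2 / 3 * ?w) + 12 / 7 * (1 / 10 * ?w + 1 / 6 * ?w))"
        by (rule ennreal_mixture) simp_all
      also have "11 / 7 * (2 / 15 * ?w + 2 / 3 * ?w) + 12 / 7 * (1 / 10 * ?w + 1 / 6 * ?w) = 12 / 7 * ?w" by simp
      finally show ?thesis unfolding ut U_mass_V[OF tm t(2,3)] .
    qed
    then show ?thesis using E by (simp add: pmf_walk_pmf U_mass_nonneg)
  qed
qed

definition lerw_pmf :: "nat \<Rightarrow> path pmf" where
  "lerw_pmf N = map_pmf (loop_erasure N) (walk_pmf N)"

text \<open>The first of the erasures produces a self-avoiding list of steps, to which locality of
  the remaining ones applies.\<close>

lemma stopped_loop_erasure_U:
  assumes "w \<in> U (Suc N)"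
  shows "stopped N (loop_erasure (Suc N) w) = loop_erasure N (first_piece_of N w)"
proof -
  obtain p q where pq: "is_target (Suc N) p q" "w \<in> W (Suc N) p \<union> V (Suc N) q p"
    using assms unfolding U_def is_target_def by blast
  then have "w \<in> as_path ` (W_walks N p \<union> V_walks N q p)" using W_refined[OF pq(1)] V_refined[OF pq(1)] by blast
  then obtain ts where ts: "w = as_path ts" "ts \<in> W_walks N p \<union> V_walks N q p" by (rule imageE)
  have st: "steps N 0 ts" by (rule refined_walk_steps[OF pq(1) ts(2)])
  obtain t us z z' where *: "erase_loops 0 ts = t # us" "erase_level N (as_path ts) = as_path (t # us)"
    "good N 0 (t # us)" "is_target N z z'" "last t = z"
    "us = [] \<or> last (hd us) \<noteq> z' \<Longrightarrow> first_run N 0 [t] us"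
    "us \<noteq> [] \<Longrightarrow> last (hd us) = z' \<Longrightarrow> first_run N 0 [t, hd us] (tl us)"
    using first_piece[OF pq(1) assms[unfolded ts(1)] st] by blast
  obtain g r where g: "t # us = g @ r" "first_run N 0 g r"
  proof (cases "us \<noteq> [] \<and> last (hd us) = z'")
    case True
    then show thesis using that[of "[t, hd us]" "tl us"] *(7) by simp
  next
    case False
    then show thesis using that[of "[t]" us] *(6) by auto
  qed
  note good = *(3)[unfolded g(1)]
  have steps: "steps N 0 (g @ r)" using good by (simp add: good_def)
  have "first_piece_of N w = as_path g"
    unfolding first_piece_of_def ts(1) *(2) g(1) by (rule stopped_first_run[OF steps g(2)])
  moreover have "stopped N (loop_erasure (Suc N) w) = loop_erasure N (as_path g)"
    unfolding loop_erasure.simps ts(1) *(2) g(1) by (rule stopped_loop_erasure[OF good g(2)])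
  ultimately show ?thesis by simp
qed

theorem lerw_consistent: "map_pmf (stopped N) (lerw_pmf (Suc N)) = lerw_pmf N"
proof -
  have "map_pmf (stopped N) (lerw_pmf (Suc N)) = map_pmf (\<lambda>w. loop_erasure N (first_piece_of N w)) (walk_pmf (Suc N))"
    unfolding lerw_pmf_def map_pmf_comp
    by (rule map_pmf_cong) (use stopped_loop_erasure_U set_walk_pmf in \<open>auto simp del: loop_erasure.simps\<close>)
  also have "\<dots> = lerw_pmf N"
    unfolding lerw_pmf_def map_pmf_comp[symmetric] first_piece_law ..
  finally show ?thesis .
qed

lemma set_lerw_pmf: "set_pmf (lerw_pmf N) \<subseteq> \<Gamma> N"
  using set_walk_pmf[of N] loop_erasure_U[of _ N] by (auto simp: lerw_pmf_def)

section \<open>Projective limits of discrete laws\<close>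

text \<open>The sequence is built as a Markov chain that goes from \<open>\<omega> n\<close> to
  \<open>\<omega> (Suc n)\<close> by the conditional law of the latter given
  \<open>r n (\<omega> (Suc n)) = \<omega> n\<close>. Consistency makes the marginals correct, and
  the theorem of Ionescu-Tulcea gives the law of the whole chain.\<close>

lemma projective_limit_pmf:
  fixes \<mu> :: "nat \<Rightarrow> 'a pmf" and r :: "nat \<Rightarrow> 'a \<Rightarrow> 'a"
  assumes consistent: "\<And>n. map_pmf (r n) (\<mu> (Suc n)) = \<mu> n"
  obtains Q :: "(nat \<Rightarrow> 'a) measure"
  where "prob_space Q" "sets Q = sets (PiM UNIV (\<lambda>_. count_space UNIV))"
    "\<And>n. distr Q (count_space UNIV) (\<lambda>\<omega>. \<omega> n) = measure_pmf (\<mu> n)"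
    "\<And>n. AE \<omega> in Q. \<omega> n \<in> set_pmf (\<mu> n) \<and> r n (\<omega> (Suc n)) = \<omega> n"
proof -
  let ?M = "\<lambda>_::nat. count_space (UNIV :: 'a set)"
  \<comment> \<open>Conditioning needs an event of positive probability; the default value makes the
    kernel total.\<close>
  define K where "K n x = (if x \<in> set_pmf (\<mu> n) then cond_pmf (\<mu> (Suc n)) {y. r n y = x} else \<mu> (Suc n))" for n x
  have ne: "set_pmf (\<mu> (Suc n)) \<inter> {y. r n y = x} \<noteq> {}" if "x \<in> set_pmf (\<mu> n)" for n x
  proof -
    have "x \<in> r n ` set_pmf (\<mu> (Suc n))" using that unfolding consistent[symmetric, of n] by simp
    then show ?thesis by blast
  qed
  have bind: "bind_pmf (\<mu> n) (K n) = \<mu> (Suc n)" for n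
  proof -
    have "bind_pmf (\<mu> n) (K n) = bind_pmf (\<mu> n) (\<lambda>x. cond_pmf (\<mu> (Suc n)) {y. r n y = x})"
      by (rule bind_pmf_cong) (simp_all add: K_def)
    also have "\<dots> = \<mu> (Suc n)"
    proof (rule bind_cond_pmf_cancel)
      fix y assume "y \<in> set_pmf (\<mu> (Suc n))"
      then have "r n y \<in> set_pmf (\<mu> n)" unfolding consistent[symmetric, of n] by simp
      then show "set_pmf (\<mu> n) \<inter> {x. r n y = x} \<noteq> {}" by blast
    next
      fix x y assume "r n y = x"
      have "measure (\<mu> n) {x'. r n y = x'} = measure (map_pmf (r n) (\<mu> (Suc n))) {x}"
        using \<open>r n y = x\<close> by (simp add: consistent)
      then show "measure (\<mu> (Suc n)) {y. r n y = x} = measure (\<mu> n) {x. r n y = x}"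
        by (simp add: vimage_def)
    qed (use ne in auto)
    finally show ?thesis .
  qed
  have Kset: "r n y = x" if "x \<in> set_pmf (\<mu> n)" "y \<in> set_pmf (K n x)" for n x y
    using that set_cond_pmf[OF ne[OF that(1)]] by (simp add: K_def)
  define P where "P n \<omega> = (case n of 0 \<Rightarrow> measure_pmf (\<mu> 0) | Suc m \<Rightarrow> measure_pmf (K m (\<omega> m)))"
    for n and \<omega> :: "nat \<Rightarrow> 'a"
  have pmf_space: "measure_pmf p \<in> space (subprob_algebra (count_space UNIV))" for p :: "'a pmf"
    by (simp add: space_subprob_algebra prob_space_imp_subprob_space measure_pmf.prob_space_axioms)
  have P_measurable: "P i \<in> measurable (PiM {0..<i} ?M) (subprob_algebra (?M i))" for i
  proof -
    show "P i \<in> measurable (PiM {0..<i} ?M) (subprob_algebra (?M i))"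
    proof (cases i)
      case 0
      then show ?thesis using pmf_space by (simp add: P_def[abs_def])
    next
      case (Suc m)
      have "(\<lambda>\<omega>. \<omega> m) \<in> measurable (PiM {0..<i} ?M) (count_space UNIV)"
        by (rule measurable_component_singleton) (simp add: Suc)
      moreover have "(\<lambda>x. measure_pmf (K m x)) \<in> measurable (count_space UNIV) (subprob_algebra (count_space UNIV))"
        using pmf_space by simp
      ultimately have "(\<lambda>\<omega>. measure_pmf (K m (\<omega> m))) \<in> measurable (PiM {0..<i} ?M) (subprob_algebra (count_space UNIV))"
        by (rule measurable_compose)
      then show ?thesis by (simp add: P_def[abs_def] Suc)
    qed
  qed
  interpret Ionescu_Tulcea P ?M
  proof (rule Ionescu_Tulcea.intro)
    show "prob_space (P i x)" for i x by (simp add: P_def measure_pmf.prob_space_axioms split: nat.split)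
  qed (rule P_measurable)
  let ?u = "\<lambda>_::nat. undefined :: 'a"
  \<comment> \<open>The first n coordinates of the limit have the law of the first n steps of the
    chain.\<close>
  have CI: "distr PF.lim (PiM {0..<n} ?M) (\<lambda>x. restrict x {0..<n}) = C 0 n ?u" for n
  proof -
    have "distr PF.lim (PiM {0..<n} ?M) (\<lambda>x. restrict x {0..<n}) = CI {0..<n}" by (rule distr_lim) simp
    also have "\<dots> = C 0 n ?u"
    proof (rule measure_eqI)
      show "sets (CI {0..<n}) = sets (C 0 n ?u)" by (simp add: CI_def sets_C)
      fix A assume "A \<in> sets (CI {0..<n})"
      then have A: "A \<in> sets (PiM {0..<n} ?M)" by (simp add: CI_def)
      then have "PF.emb {0..<n} {0..<n} A = A"
        using sets.sets_into_space[OF A] by (intro prod_emb_id) (simp add: space_PiM)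
      then show "emeasure (CI {0..<n}) A = emeasure (C 0 n ?u) A" using emeasure_CI[of "{0..<n}" n A] A by simp
    qed
    finally show ?thesis .
  qed
  have usp: "?u \<in> space (PiM {0..<0} ?M)" by (simp add: space_PiM PiE_def extensional_def)
  have comp [measurable]: "(\<lambda>\<omega>. \<omega> i) \<in> measurable (PiM {0..<n} ?M) (count_space UNIV)" if "i < n" for i n
    by (rule measurable_component_singleton) (use that in simp)
  have step: "(\<integral>\<^sup>+\<omega>. f \<omega> \<partial>C 0 (Suc n) ?u) = (\<integral>\<^sup>+\<omega>. (\<integral>\<^sup>+y. f (fun_upd \<omega> n y) \<partial>P n \<omega>) \<partial>C 0 n ?u)"
    if f: "f \<in> borel_measurable (PiM {0..<Suc n} ?M)" for f n
  proof -
    have "(\<integral>\<^sup>+\<omega>. f \<omega> \<partial>C 0 (Suc n) ?u) = (\<integral>\<^sup>+\<omega>. (\<integral>\<^sup>+x. f x \<partial>eP n \<omega>) \<partial>C 0 n ?u)"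
      using f measurable_eP[of n] sets_C[OF usp, of n] usp
      by (simp add: nn_integral_bind[where B="PiM {0..<Suc n} ?M"] cong: measurable_cong_sets)
    also have "\<dots> = (\<integral>\<^sup>+\<omega>. (\<integral>\<^sup>+y. f (fun_upd \<omega> n y) \<partial>P n \<omega>) \<partial>C 0 n ?u)"
      by (rule nn_integral_cong) (use nn_integral_eP[OF _ f] space_C[OF usp, of n] in simp)
    finally show ?thesis .
  qed
  have marginal: "(\<integral>\<^sup>+\<omega>. g (\<omega> n) \<partial>C 0 (Suc n) ?u) = (\<integral>\<^sup>+x. g x \<partial>\<mu> n)" for g :: "'a \<Rightarrow> ennreal" and n
  proof (induction n arbitrary: g)
    case 0
    have "(\<lambda>\<omega>. g (\<omega> 0)) \<in> borel_measurable (PiM {0..<Suc 0} ?M)"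
      by (rule measurable_compose[OF comp]) simp_all
    from step[OF this] have "(\<integral>\<^sup>+\<omega>. g (\<omega> 0) \<partial>C 0 (Suc 0) ?u) = (\<integral>\<^sup>+\<omega>. (\<integral>\<^sup>+y. g y \<partial>\<mu> 0) \<partial>C 0 0 ?u)"
      by (simp add: P_def)
    then show ?case using prob_space.emeasure_space_1[OF prob_space_C[OF usp, of 0]] by simp
  next
    case (Suc n)
    have "(\<lambda>\<omega>. g (\<omega> (Suc n))) \<in> borel_measurable (PiM {0..<Suc (Suc n)} ?M)"
      by (rule measurable_compose[OF comp]) simp_all
    from step[OF this] have "(\<integral>\<^sup>+\<omega>. g (\<omega> (Suc n)) \<partial>C 0 (Suc (Suc n)) ?u) = (\<integral>\<^sup>+\<omega>. (\<integral>\<^sup>+y. g y \<partial>K n (\<omega> n)) \<partial>C 0 (Suc n) ?u)"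
      by (simp add: P_def)
    also have "\<dots> = (\<integral>\<^sup>+x. (\<integral>\<^sup>+y. g y \<partial>K n x) \<partial>\<mu> n)" by (rule Suc)
    also have "\<dots> = (\<integral>\<^sup>+y. g y \<partial>\<mu> (Suc n))" unfolding bind[symmetric, of n] by simp
    finally show ?case .
  qed
  define B where "B n = {\<omega>. \<omega> n \<in> set_pmf (\<mu> n) \<and> r n (\<omega> (Suc n)) = \<omega> n}" for n
  have B_sets: "{\<omega> \<in> space (PiM {0..<Suc (Suc n)} ?M). \<omega> \<in> B n} \<in> sets (PiM {0..<Suc (Suc n)} ?M)" for n
  proof -
    let ?S = "PiM {0..<Suc (Suc n)} ?M"
    have "{\<omega> \<in> space ?S. \<omega> \<in> B n} = (\<Union>x\<in>set_pmf (\<mu> n). ((\<lambda>\<omega>. \<omega> n) -` {x} \<inter> space ?S) \<inter> ((\<lambda>\<omega>. \<omega> (Suc n)) -` (r n -` {x}) \<inter> space ?S))"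
      by (auto simp: B_def)
    also have "\<dots> \<in> sets ?S"
      by (intro sets.countable_UN'' countable_set_pmf sets.Int measurable_sets[OF comp]) simp_all
    finally show ?thesis .
  qed
  have B_AE: "AE \<omega> in C 0 (Suc (Suc n)) ?u. \<omega> \<in> B n" for n
  proof -
    let ?S = "PiM {0..<Suc (Suc n)} ?M" let ?C = "C 0 (Suc (Suc n)) ?u"
    have sC: "space ?C = space ?S" "sets ?C = sets ?S" using space_C[OF usp, of "Suc (Suc n)"] sets_C[OF usp, of "Suc (Suc n)"] by simp_all
    let ?N = "space ?S - {\<omega> \<in> space ?S. \<omega> \<in> B n}"
    have N: "?N \<in> sets ?S" using B_sets[of n] by blast
    have bad: "(\<integral>\<^sup>+y. indicator {y. \<not> (x \<in> set_pmf (\<mu> n) \<and> r n y = x)} y \<partial>K n x) = (0::ennreal)"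
      if "x \<in> set_pmf (\<mu> n)" for x
    proof -
      have "AE y in K n x. indicator {y. \<not> (x \<in> set_pmf (\<mu> n) \<and> r n y = x)} y = (0::ennreal)"
        using that Kset[OF that] by (auto simp: AE_measure_pmf_iff)
      then show ?thesis by (subst nn_integral_0_iff_AE) simp_all
    qed
    have "emeasure ?C ?N = (\<integral>\<^sup>+\<omega>. indicator ?N \<omega> \<partial>?C)" using N sC by simp
    also have "\<dots> = (\<integral>\<^sup>+\<omega>. (\<integral>\<^sup>+y. indicator ?N (fun_upd \<omega> (Suc n) y) \<partial>P (Suc n) \<omega>) \<partial>C 0 (Suc n) ?u)"
      by (rule step) (use N in simp)
    also have "\<dots> \<le> (\<integral>\<^sup>+\<omega>. (\<integral>\<^sup>+y. indicator {y. \<not> (\<omega> n \<in> set_pmf (\<mu> n) \<and> r n y = \<omega> n)} y \<partial>K n (\<omega> n)) \<partial>C 0 (Suc n) ?u)"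
      unfolding P_def nat.case
      by (intro nn_integral_mono) (auto simp: B_def space_PiM split: split_indicator)
    also have "\<dots> = (\<integral>\<^sup>+x. (\<integral>\<^sup>+y. indicator {y. \<not> (x \<in> set_pmf (\<mu> n) \<and> r n y = x)} y \<partial>K n x) \<partial>\<mu> n)"
      by (rule marginal)
    also have "\<dots> = 0" using bad by (subst nn_integral_0_iff_AE) (auto simp: AE_measure_pmf_iff)
    finally have "emeasure ?C ?N = 0" by simp
    then show ?thesis using N sC by (intro AE_I[of _ _ ?N]) auto
  qed
  have restr: "(\<lambda>\<omega>. restrict \<omega> {0..<n}) \<in> measurable PF.lim (PiM {0..<n} ?M)" for n
    by (simp add: measurable_restrict_subset cong: measurable_cong_sets)
  show thesis
  proof (rule that[of PF.lim])
    show lim_sets: "sets PF.lim = sets (PiM UNIV ?M)" by simp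
    have d: "distr PF.lim (count_space UNIV) (\<lambda>\<omega>. \<omega> n) = measure_pmf (\<mu> n)" for n
    proof -
      have "distr PF.lim (count_space UNIV) (\<lambda>\<omega>. \<omega> n) =
          distr (distr PF.lim (PiM {0..<Suc n} ?M) (\<lambda>\<omega>. restrict \<omega> {0..<Suc n})) (count_space UNIV) (\<lambda>\<omega>. \<omega> n)"
        by (subst distr_distr[OF comp restr]) (simp_all add: comp_def)
      also have "\<dots> = distr (C 0 (Suc n) ?u) (count_space UNIV) (\<lambda>\<omega>. \<omega> n)" unfolding CI ..
      also have "\<dots> = measure_pmf (\<mu> n)"
      proof (rule measure_eqI)
        fix A :: "'a set"
        have m: "(\<lambda>\<omega>. \<omega> n) \<in> measurable (C 0 (Suc n) ?u) (count_space UNIV)"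
          by (subst measurable_cong_sets[OF sets_C[OF usp, of "Suc n"] refl]) (simp add: comp)
        have "emeasure (distr (C 0 (Suc n) ?u) (count_space UNIV) (\<lambda>\<omega>. \<omega> n)) A
          = (\<integral>\<^sup>+x. indicator A x \<partial>distr (C 0 (Suc n) ?u) (count_space UNIV) (\<lambda>\<omega>. \<omega> n))" by simp
        also have "\<dots> = (\<integral>\<^sup>+\<omega>. indicator A (\<omega> n) \<partial>C 0 (Suc n) ?u)" by (rule nn_integral_distr[OF m]) simp
        also have "\<dots> = emeasure (\<mu> n) A" unfolding marginal by simp
        finally show "emeasure (distr (C 0 (Suc n) ?u) (count_space UNIV) (\<lambda>\<omega>. \<omega> n)) A = emeasure (\<mu> n) A" .
      qed simp
      finally show ?thesis .
    qed
    then show "\<And>n. distr PF.lim (count_space UNIV) (\<lambda>\<omega>. \<omega> n) = measure_pmf (\<mu> n)" .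
    show "prob_space PF.lim"
    proof (rule prob_spaceI)
      have "(\<lambda>\<omega>. \<omega> 0) \<in> measurable PF.lim (count_space UNIV)"
        unfolding measurable_cong_sets[OF lim_sets refl] by (rule measurable_component_singleton) simp
      then have "emeasure (distr PF.lim (count_space UNIV) (\<lambda>\<omega>. \<omega> 0)) UNIV = emeasure PF.lim (space PF.lim)"
        by (subst emeasure_distr) simp_all
      then show "emeasure PF.lim (space PF.lim) = 1" unfolding d by (simp add: measure_pmf.emeasure_space_1[simplified])
    qed
    show "AE \<omega> in PF.lim. \<omega> n \<in> set_pmf (\<mu> n) \<and> r n (\<omega> (Suc n)) = \<omega> n" for n
    proof -
      have "AE \<omega> in distr PF.lim (PiM {0..<Suc (Suc n)} ?M) (\<lambda>\<omega>. restrict \<omega> {0..<Suc (Suc n)}). \<omega> \<in> B n"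
        unfolding CI by (rule B_AE)
      then have "AE \<omega> in PF.lim. restrict \<omega> {0..<Suc (Suc n)} \<in> B n"
        by (subst (asm) AE_distr_iff[OF restr B_sets])
      then show ?thesis by (simp add: B_def)
    qed
  qed
qed

section \<open>The infinite path\<close>

lemma countable_gasket_vertices: "countable (gasket_vertices k)"
proof -
  have "cells k \<subseteq> (\<lambda>(i, l). pt (2 ^ k * of_int i) (2 ^ k * of_int l)) ` (UNIV :: (int \<times> int) set)"
    unfolding cells_def by (auto intro: image_eqI[of _ _ "(_, _)"])
  then have "countable (cells k)" by (rule countable_subset) simp
  then show ?thesis by (simp add: gasket_vertices_eq corners_def)
qed

lemma \<Gamma>_path: "w \<in> \<Gamma> N \<Longrightarrow> is_path w \<and> w ! 0 = 0 \<and> distinct w"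
  by (auto simp: \<Gamma>_def U_def W_def V_def)

lemma countable_\<Gamma>: "countable (\<Gamma> N)"
proof (rule countable_subset)
  show "\<Gamma> N \<subseteq> lists (gasket_vertices 0)" using \<Gamma>_path by (auto simp: is_path_def lists_eq_set)
qed (intro countable_lists countable_gasket_vertices)

lemma U_end: "w \<in> U N \<Longrightarrow> w ! path_length w \<in> {apex N, corner N}"
  by (auto simp: U_def W_def V_def hit_point_def hit_time_def)

lemma adj_norm: "adj 0 p q \<Longrightarrow> norm q \<le> norm p + 1"
proof -
  assume "adj 0 p q"
  then obtain v where "p \<in> corners 0 v" "q \<in> corners 0 v" unfolding adj_iff by blast
  then have "norm (q - p) \<le> 1"
    by (auto simp: corners_def apex_def corner_def norm_Pair power2_eq_square)
  moreover have "norm q \<le> norm p + norm (q - p)" using norm_triangle_ineq[of p "q - p"] by simp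
  ultimately show ?thesis by linarith
qed

text \<open>Each edge has Euclidean length 1 and the end point is at distance \<open>2 ^ N\<close>
  from the origin.\<close>

lemma U_length:
  assumes "w \<in> U N"
  shows "2 ^ N \<le> path_length w"
proof -
  have w: "is_path w" "w ! 0 = 0" using assms by (auto simp: U_def W_def V_def)
  have "norm (w ! i) \<le> real i" if "i \<le> path_length w" for i
    using that
  proof (induction i)
    case (Suc i)
    then have "adj 0 (w ! i) (w ! Suc i)" using w(1) by (simp add: is_path_def adj_def)
    from adj_norm[OF this] Suc show ?case by simp
  qed (simp add: w(2))
  from this[of "path_length w"] have "norm (w ! path_length w) \<le> real (path_length w)" by simp
  moreover have "norm (w ! path_length w) = 2 ^ N"
  proof -
    have "norm (1 / 2 :: real, sqrt 3 / 2 :: real) = 1" "norm (1 :: real, 0 :: real) = 1" by (simp_all add: norm_Pair power_divide)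
    then show ?thesis using U_end[OF assms] by (auto simp: apex_def corner_def simp del: scaleR_Pair)
  qed
  ultimately have "real (2 ^ N) \<le> real (path_length w)" by simp
  then show ?thesis by (simp only: of_nat_le_iff)
qed

lemma \<Omega>_prefix:
  assumes "\<omega> \<in> \<Omega>" "N \<le> M"
  shows "\<exists>t. \<omega> N = take t (\<omega> M)"
  using assms(2)
proof (induction M rule: dec_induct)
  case base
  show ?case by (rule exI[of _ "length (\<omega> N)"]) simp
next
  case (step M)
  then obtain t where "\<omega> N = take t (\<omega> M)" by blast
  moreover have "\<omega> M = stopped M (\<omega> (Suc M))" using assms(1) by (simp add: \<Omega>_def)
  ultimately show ?case by (auto simp: stopped_def segment_def)
qed

lemma \<Omega>_length: "\<omega> \<in> \<Omega> \<Longrightarrow> 2 ^ N \<le> path_length (\<omega> N)"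
  by (rule U_length) (auto simp: \<Omega>_def \<Gamma>_def)

lemma \<Omega>_nth:
  assumes "\<omega> \<in> \<Omega>" "i \<le> path_length (\<omega> N)" "N \<le> M"
  shows "\<omega> M ! i = \<omega> N ! i"
proof -
  obtain t where t: "\<omega> N = take t (\<omega> M)" using \<Omega>_prefix[OF assms(1,3)] by blast
  have "\<omega> N \<noteq> []" using assms(1) \<Gamma>_path[of "\<omega> N" N] by (auto simp: \<Omega>_def is_path_def)
  then have "i < length (\<omega> N)" using assms(2) by (cases "\<omega> N") (simp_all add: path_length_def)
  then show ?thesis by (simp add: t)
qed

lemma X_eq:
  assumes "\<omega> \<in> \<Omega>" "i \<le> 2 ^ N"
  shows "X \<omega> i = \<omega> N ! i"
proof -
  let ?n = "LEAST n. i \<le> 2 ^ n"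
  have n: "i \<le> 2 ^ ?n" "?n \<le> N" using assms(2) by (rule LeastI Least_le)+
  then have "i \<le> path_length (\<omega> ?n)" using \<Omega>_length[OF assms(1), of ?n] by linarith
  then show ?thesis unfolding X_def using \<Omega>_nth[OF assms(1) _ n(2)] by simp
qed

theorem infinite_path:
  assumes "\<omega> \<in> \<Omega>"
  shows "i \<le> 2 ^ N \<Longrightarrow> i \<le> path_length (\<omega> N) \<and> X \<omega> i = \<omega> N ! i"
    and "X \<omega> 0 = 0" and "{X \<omega> i, X \<omega> (Suc i)} \<in> gasket_edges 0" and "inj (X \<omega>)"
proof -
  have \<Gamma>: "is_path (\<omega> N)" "\<omega> N ! 0 = 0" "distinct (\<omega> N)" for N
    using assms \<Gamma>_path[of "\<omega> N" N] by (simp_all add: \<Omega>_def)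
  note len = \<Omega>_length[OF assms]
  show "i \<le> path_length (\<omega> N) \<and> X \<omega> i = \<omega> N ! i" if "i \<le> 2 ^ N" for i N
    using X_eq[OF assms that] len[of N] that by simp
  show "X \<omega> 0 = 0" using X_eq[OF assms, of 0 0] \<Gamma>(2) by simp
  have pow: "n \<le> 2 ^ n" for n :: nat using less_exp[of n] by simp
  show "{X \<omega> i, X \<omega> (Suc i)} \<in> gasket_edges 0"
  proof -
    have i: "Suc i \<le> 2 ^ Suc i" by (rule pow)
    then have "i < path_length (\<omega> (Suc i))" using len[of "Suc i"] by linarith
    then have "{\<omega> (Suc i) ! i, \<omega> (Suc i) ! Suc i} \<in> gasket_edges 0" using \<Gamma>(1)[of "Suc i"] by (simp add: is_path_def)
    then show ?thesis using X_eq[OF assms i] X_eq[OF assms, of i "Suc i"] i by simp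
  qed
  show "inj (X \<omega>)"
  proof (rule injI)
    fix i j assume e: "X \<omega> i = X \<omega> j"
    let ?N = "i + j"
    have b: "i \<le> 2 ^ ?N" "j \<le> 2 ^ ?N" using pow[of ?N] by linarith+
    have "\<omega> ?N \<noteq> []" using \<Gamma>(1) by (simp add: is_path_def)
    then have "i < length (\<omega> ?N)" "j < length (\<omega> ?N)"
      using b len[of ?N] by (cases "\<omega> ?N"; simp add: path_length_def)+
    then show "i = j" using e \<Gamma>(3)[of ?N] X_eq[OF assms b(1)] X_eq[OF assms b(2)] by (simp add: nth_eq_iff_index_eq)
  qed
qed

text \<open>A sequence in \<open>\<Omega>\<close> is determined up to index \<open>N\<close> by its
  entry \<open>N\<close>, because stopping recovers the earlier entries. Hence the law of the first
  entries is that of the last one among them.\<close>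

lemma \<Omega>_determined:
  assumes "\<omega> \<in> \<Omega>" "\<omega>' \<in> \<Omega>" "\<omega> N = \<omega>' N" "i \<le> N"
  shows "\<omega> i = \<omega>' i"
  using assms(4)
proof (induction i rule: inc_induct)
  case (step i)
  then show ?case using assms(1,2) unfolding \<Omega>_def by (metis (mono_tags, lifting) mem_Collect_eq)
qed (rule assms(3))

lemma proj_eq_iff: "\<omega> \<in> \<Omega> \<Longrightarrow> \<omega>' \<in> \<Omega> \<Longrightarrow> proj N \<omega> = proj N \<omega>' \<longleftrightarrow> \<omega> N = \<omega>' N"
  using \<Omega>_determined[of \<omega> \<omega>' N] by (auto simp: proj_def)

lemma countable_proj: "countable (proj N ` \<Omega>)"
proof (rule countable_subset)
  show "proj N ` \<Omega> \<subseteq> lists (\<Union>i. \<Gamma> i)" unfolding \<Omega>_def proj_def by (clarsimp simp del: upt_Suc) blast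
qed (intro countable_lists countable_UN countable_\<Gamma> countableI_type)

section \<open>The law of the infinite path\<close>

lemma routes_length:
  assumes "ts \<in> routes N ps"
  shows "length ps \<le> path_length (as_path ts)"
proof -
  have "length us \<le> length (concat us)" if "steps N x us" for x us
    using that
  proof (induction us arbitrary: x)
    case (Cons t us)
    then have "t \<noteq> []" "length us \<le> length (concat us)" using Cons.IH[of "last t"] by (simp_all add: is_step_def)
    then show ?case by (cases t) simp_all
  qed simp
  moreover have "steps N 0 ts" "length ps = length ts" using assms by (auto simp: routes_def)
  ultimately show ?thesis by (simp add: path_length_def)
qed

lemma W_length: "w \<in> W N p \<Longrightarrow> 1 \<le> path_length w"
  using routes_length[of _ N "[p]"] by (auto simp: W_eq)

lemma V_length: "w \<in> V N q p \<Longrightarrow> 2 \<le> path_length w"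
  using routes_length[of _ N "[q, p]"] by (auto simp: V_eq numeral_2_eq_2)

lemma emeasure_point_measure_pmass:
  assumes "\<And>w. w \<in> A \<Longrightarrow> n \<le> path_length w" "B \<subseteq> A"
  shows "emeasure (point_measure A (\<lambda>w. ennreal ((1 / 4) ^ (path_length w - n)))) B = ennreal (4 ^ n) * pmass B"
proof -
  have e: "ennreal ((1 / 4) ^ (path_length w - n)) * indicator B w * indicator A w =
      ennreal (4 ^ n) * (ennreal ((1 / 4) ^ path_length w) * indicator B w)" for w
    using assms(1)[of w] assms(2)
    by (auto simp: power_diff ennreal_mult[symmetric] power_one_over simp del: ennreal_power split: split_indicator)
  have "emeasure (point_measure A (\<lambda>w. ennreal ((1 / 4) ^ (path_length w - n)))) B =
      (\<integral>\<^sup>+w. ennreal ((1 / 4) ^ (path_length w - n)) * indicator B w * indicator A w \<partial>count_space UNIV)"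
    using assms(2) by (simp add: point_measure_def emeasure_density nn_integral_count_space_indicator)
  also have "\<dots> = ennreal (4 ^ n) * (\<integral>\<^sup>+w. ennreal ((1 / 4) ^ path_length w) * indicator B w \<partial>count_space UNIV)"
    unfolding e by (rule nn_integral_cmult) simp
  also have "(\<integral>\<^sup>+w. ennreal ((1 / 4) ^ path_length w) * indicator B w \<partial>count_space UNIV) = pmass B"
    by (simp add: pmass_eq nn_integral_count_space_indicator)
  finally show ?thesis .
qed

lemma emeasure_erased_law:
  assumes "A \<subseteq> U N" "\<And>w. w \<in> A \<Longrightarrow> n \<le> path_length w" "x \<in> \<Gamma> N"
  shows "emeasure (erased_law N (point_measure A (\<lambda>w. ennreal ((1 / 4) ^ (path_length w - n))))) {x} =
    ennreal (4 ^ n) * pmass (A \<inter> loop_erasure N -` {x})"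
proof -
  let ?M = "point_measure A (\<lambda>w. ennreal ((1 / 4) ^ (path_length w - n)))"
  have "loop_erasure N \<in> measurable ?M (count_space (\<Gamma> N))"
    unfolding measurable_point_measure_eq1 space_count_space
    by (rule Pi_I, rule loop_erasure_U, rule subsetD[OF assms(1)])
  then have "emeasure (erased_law N ?M) {x} = emeasure ?M (loop_erasure N -` {x} \<inter> A)"
    unfolding erased_law_def using assms(3) by (subst emeasure_distr) (simp_all add: space_point_measure)
  also have "\<dots> = ennreal (4 ^ n) * pmass (loop_erasure N -` {x} \<inter> A)"
    by (rule emeasure_point_measure_pmass) (use assms(2) in auto)
  finally show ?thesis by (simp only: Int_commute)
qed

lemma LERW_law_singleton:
  assumes "\<eta> \<in> proj N ` \<Omega>"
  shows "emeasure (LERW_law N) {\<eta>} = emeasure (lerw_pmf N) {\<eta> ! N}"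
proof -
  obtain \<omega> where \<omega>: "\<omega> \<in> \<Omega>" "\<eta> = proj N \<omega>" using assms by blast
  have "proj N \<omega> ! N = \<omega> N" unfolding proj_def by (subst nth_map) (simp_all del: upt_Suc)
  then have x: "\<eta> ! N \<in> \<Gamma> N" using \<omega> by (simp add: \<Omega>_def)
  let ?S = "loop_erasure N -` {\<eta> ! N}"
  have W: "emeasure (erased_law N (W_law N p)) {\<eta> ! N} = ennreal 4 * pmass (W N p \<inter> ?S)" if "W N p \<subseteq> U N" for p
    unfolding W_law_def using emeasure_erased_law[OF that W_length x] by simp
  have V: "emeasure (erased_law N (V_law N q p)) {\<eta> ! N} = ennreal 16 * pmass (V N q p \<inter> ?S)" if "V N q p \<subseteq> U N" for p q
    unfolding V_law_def using emeasure_erased_law[OF that V_length x] by simp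
  have sub: "W N (apex N) \<subseteq> U N" "W N (corner N) \<subseteq> U N" "V N (corner N) (apex N) \<subseteq> U N" "V N (apex N) (corner N) \<subseteq> U N"
    by (auto simp: U_def)
  have c: "ennreal (11 / 28) * (ennreal 4 * a + ennreal 4 * b) = ennreal (11 / 7) * (a + b)"
    "ennreal (3 / 28) * (ennreal 16 * a + ennreal 16 * b) = ennreal (12 / 7) * (a + b)" for a b
    unfolding distrib_left[symmetric] mult.assoc[symmetric]
    by (subst ennreal_mult[symmetric]; simp)+
  have "emeasure (LERW_law N) {\<eta>} =
     ennreal (11 / 28) *
       (emeasure (erased_law N (W_law N (apex N))) {\<eta> ! N} +
        emeasure (erased_law N (W_law N (corner N))) {\<eta> ! N}) +
     ennreal (3 / 28) *
       (emeasure (erased_law N (V_law N (corner N) (apex N))) {\<eta> ! N} +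
        emeasure (erased_law N (V_law N (apex N) (corner N))) {\<eta> ! N})"
    unfolding LERW_law_def using assms by (subst emeasure_point_measure_finite2) (simp_all only: sum.insert sum.empty finite.intros empty_iff not_False_eq_True add_0_right insert_subset empty_subsetI)
  also have "\<dots> = emeasure (walk_pmf N) ?S"
    unfolding emeasure_walk_pmf W[OF sub(1)] W[OF sub(2)] V[OF sub(3)] V[OF sub(4)] c ..
  finally have "emeasure (LERW_law N) {\<eta>} = emeasure (walk_pmf N) ?S" .
  then show ?thesis by (simp add: lerw_pmf_def)
qed

lemma cylinder_eq:
  assumes "A \<subseteq> proj N ` \<Omega>"
  shows "proj N -` A \<inter> \<Omega> = (\<lambda>\<omega>. \<omega> N) -` ((\<lambda>\<eta>. \<eta> ! N) ` A) \<inter> \<Omega>"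
proof -
  have last: "proj N \<omega> ! N = \<omega> N" for \<omega> unfolding proj_def by (subst nth_map) (simp_all del: upt_Suc)
  have "proj N \<omega> \<in> A" if \<omega>\<eta>: "\<omega> \<in> \<Omega>" "\<eta> \<in> A" "\<omega> N = \<eta> ! N" for \<omega> \<eta>
  proof -
    have "\<eta> \<in> proj N ` \<Omega>" by (rule subsetD[OF assms \<omega>\<eta>(2)])
    then obtain \<omega>' where \<omega>': "\<eta> = proj N \<omega>'" "\<omega>' \<in> \<Omega>" by (rule imageE)
    then have "proj N \<omega> = \<eta>" using \<omega>\<eta>(3) last[of \<omega>'] proj_eq_iff[OF \<omega>\<eta>(1) \<omega>'(2), of N] by simp
    then show ?thesis using \<omega>\<eta>(2) by simp
  qed
  moreover have "\<omega> N \<in> (\<lambda>\<eta>. \<eta> ! N) ` A" if "proj N \<omega> \<in> A" for \<omega>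
    using that last[of \<omega>] by (intro image_eqI[of _ _ "proj N \<omega>"]) simp_all
  ultimately show ?thesis by (intro equalityI subsetI) auto
qed

theorem theorem1:
  shows "\<exists>P :: (nat \<Rightarrow> path) measure.
     prob_space P \<and> space P = \<Omega> \<and> sets P = sigma_sets \<Omega> cylinder_sets \<and>
     (\<forall>N. distr P (count_space (proj N ` \<Omega>)) (proj N) = LERW_law N) \<and>
     (\<forall>i. (\<lambda>\<omega>. X \<omega> i) \<in> measurable P (count_space (gasket_vertices 0))) \<and>
     (\<forall>\<omega>\<in>space P.
        (\<forall>N i. i \<le> 2 ^ N \<longrightarrow> i \<le> path_length (\<omega> N) \<and> X \<omega> i = \<omega> N ! i) \<and>
        X \<omega> 0 = 0 \<and>
        (\<forall>i. {X \<omega> i, X \<omega> (Suc i)} \<in> gasket_edges 0) \<and>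
        inj (X \<omega>))"
proof -
  obtain Q :: "(nat \<Rightarrow> path) measure" where Q: "prob_space Q" "sets Q = sets (PiM UNIV (\<lambda>_. count_space UNIV))"
    "\<And>n. distr Q (count_space UNIV) (\<lambda>\<omega>. \<omega> n) = measure_pmf (lerw_pmf n)"
    "\<And>n. AE \<omega> in Q. \<omega> n \<in> set_pmf (lerw_pmf n) \<and> stopped n (\<omega> (Suc n)) = \<omega> n"
    by (rule projective_limit_pmf[of stopped lerw_pmf, OF lerw_consistent]) blast
  have sp: "space Q = UNIV" using sets_eq_imp_space_eq[OF Q(2)] by (simp add: space_PiM)
  have ev: "(\<lambda>\<omega>. \<omega> n) \<in> measurable Q (count_space UNIV)" for n
    unfolding measurable_cong_sets[OF Q(2) refl] by (rule measurable_component_singleton) simp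
  have ev_sets: "(\<lambda>\<omega>. \<omega> n) -` A \<in> sets Q" for n A
    using measurable_sets[OF ev, of A n] by (simp add: sp)
  \<comment> \<open>Only countably many values are possible at each index, so the defining conditions are
    countable unions of conditions on single entries.\<close>
  have "\<Omega> = (\<Inter>N. \<Union>x\<in>\<Gamma> N. (\<lambda>\<omega>. \<omega> N) -` {x} \<inter> (\<lambda>\<omega>. \<omega> (Suc N)) -` (stopped N -` {x}))"
    by (auto simp: \<Omega>_def)
  also have "\<dots> \<in> sets Q"
    by (intro sets.countable_INT'' sets.countable_UN'' countable_\<Gamma> sets.Int ev_sets) (simp_all add: sp[symmetric])
  finally have \<Omega>_sets: "\<Omega> \<in> sets Q" .
  have "AE \<omega> in Q. \<forall>n. \<omega> n \<in> set_pmf (lerw_pmf n) \<and> stopped n (\<omega> (Suc n)) = \<omega> n"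
    unfolding AE_all_countable using Q(4) by blast
  then have \<Omega>_AE: "AE \<omega> in Q. \<omega> \<in> \<Omega>"
    by (rule eventually_mono) (use set_lerw_pmf in \<open>auto simp: \<Omega>_def\<close>)
  \<comment> \<open>The projective limit lives on all sequences and gives full mass to
    \<open>\<Omega>\<close>; restrict it and pass to the generated sigma-algebra.\<close>
  define P where "P = distr (restrict_space Q \<Omega>) (sigma \<Omega> cylinder_sets) (\<lambda>\<omega>. \<omega>)"
  have cyl: "cylinder_sets \<subseteq> Pow \<Omega>" by (auto simp: cylinder_sets_def)
  have P: "space P = \<Omega>" "sets P = sigma_sets \<Omega> cylinder_sets" by (simp_all add: P_def cyl)
  have incl: "(\<lambda>\<omega>. \<omega>) \<in> measurable (restrict_space Q \<Omega>) (sigma \<Omega> cylinder_sets)"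
  proof (rule measurable_measure_of[OF cyl])
    fix C assume "C \<in> cylinder_sets"
    then obtain N A where A: "C = proj N -` A \<inter> \<Omega>" "A \<subseteq> proj N ` \<Omega>" by (auto simp: cylinder_sets_def)
    have "C = (\<lambda>\<omega>. \<omega> N) -` ((\<lambda>\<eta>. \<eta> ! N) ` A) \<inter> \<Omega>" using cylinder_eq[OF A(2)] A(1) by simp
    also have "\<dots> \<in> sets (restrict_space Q \<Omega>)" unfolding sets_restrict_space using ev_sets by (auto simp: Int_commute)
    finally show "(\<lambda>\<omega>. \<omega>) -` C \<inter> space (restrict_space Q \<Omega>) \<in> sets (restrict_space Q \<Omega>)"
      using A(1) by (simp add: space_restrict_space sp Int_absorb2)
  qed (simp add: space_restrict_space)
  have emP: "emeasure P B = emeasure Q B" if "B \<in> sets P" for B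
  proof -
    have B: "B \<in> sets (sigma \<Omega> cylinder_sets)" "B \<subseteq> \<Omega>" using that sets.sets_into_space[OF that] P(1) by (simp_all add: P_def)
    then have "emeasure P B = emeasure (restrict_space Q \<Omega>) (B \<inter> \<Omega>)"
      unfolding P_def by (subst emeasure_distr[OF incl]) (simp_all add: space_restrict_space sp)
    then show ?thesis using B(2) \<Omega>_sets by (simp add: emeasure_restrict_space sp Int_absorb2)
  qed
  have cyl_P: "proj N -` A \<inter> \<Omega> \<in> sets P" if "A \<subseteq> proj N ` \<Omega>" for N A
    unfolding P(2) by (rule sigma_sets.Basic) (use that in \<open>auto simp: cylinder_sets_def\<close>)
  have "emeasure P \<Omega> = emeasure Q \<Omega>" by (rule emP) (use sets.top[of P] P(1) in simp)
  also have "\<dots> = emeasure Q (space Q)" by (rule emeasure_eq_AE) (use \<Omega>_AE \<Omega>_sets sets.top[of Q] sp in auto)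
  finally have prob: "prob_space P"
    using prob_space.emeasure_space_1[OF Q(1)] P(1) by (intro prob_spaceI) simp
  have proj: "proj N \<in> measurable P (count_space (proj N ` \<Omega>))" for N
    by (rule measurableI) (use cyl_P P(1) in auto)
  have law: "distr P (count_space (proj N ` \<Omega>)) (proj N) = LERW_law N" for N
  proof (rule measure_eqI_countable[OF _ _ countable_proj])
    fix \<eta> assume \<eta>: "\<eta> \<in> proj N ` \<Omega>"
    then have "emeasure (distr P (count_space (proj N ` \<Omega>)) (proj N)) {\<eta>} = emeasure Q (proj N -` {\<eta>} \<inter> \<Omega>)"
      using emP[OF cyl_P[of "{\<eta>}" N]] by (subst emeasure_distr[OF proj]) (simp_all add: P(1))
    also have "\<dots> = emeasure Q ((\<lambda>\<omega>. \<omega> N) -` {\<eta> ! N} \<inter> \<Omega>)" using cylinder_eq[of "{\<eta>}" N] \<eta> by simp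
    also have "\<dots> = emeasure Q ((\<lambda>\<omega>. \<omega> N) -` {\<eta> ! N})"
      by (rule emeasure_eq_AE) (use \<Omega>_AE \<Omega>_sets ev_sets in auto)
    also have "\<dots> = emeasure (lerw_pmf N) {\<eta> ! N}"
      unfolding Q(3)[symmetric] by (subst emeasure_distr[OF ev]) (simp_all add: sp)
    finally show "emeasure (distr P (count_space (proj N ` \<Omega>)) (proj N)) {\<eta>} = emeasure (LERW_law N) {\<eta>}"
      unfolding LERW_law_singleton[OF \<eta>] .
  qed (simp_all add: LERW_law_def sets_point_measure)
  have X: "(\<lambda>\<omega>. X \<omega> i) \<in> measurable P (count_space (gasket_vertices 0))" for i
  proof (rule measurableI)
    fix \<omega> assume "\<omega> \<in> space P"
    then have "\<omega> \<in> \<Omega>" using P(1) by simp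
    from infinite_path(3)[OF this, of i] have "adj 0 (X \<omega> i) (X \<omega> (Suc i))" by (simp add: adj_def)
    then show "X \<omega> i \<in> space (count_space (gasket_vertices 0))" using adj_vertices by simp
  next
    fix A :: "point set"
    have i: "i \<le> 2 ^ i" using less_exp[of i] by simp
    have last: "proj i \<omega> ! i = \<omega> i" for \<omega> unfolding proj_def by (subst nth_map) (simp_all del: upt_Suc)
    have "(\<lambda>\<omega>. X \<omega> i) -` A \<inter> space P = proj i -` {\<eta> \<in> proj i ` \<Omega>. \<eta> ! i ! i \<in> A} \<inter> \<Omega>"
      using X_eq[OF _ i] last by (auto simp: P(1))
    also have "\<dots> \<in> sets P" by (rule cyl_P) simp
    finally show "(\<lambda>\<omega>. X \<omega> i) -` A \<inter> space P \<in> sets P" .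
  qed
  show ?thesis
    by (intro exI[of _ P] conjI ballI allI impI prob P law X)
      (use infinite_path P(1) in simp_all)
qed

end
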